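(* Let $L>0$ and $\Omega=(-L,L)\times(-1,1)$. There exists a constant $K_\Omega>0$ such that the following holds. Let $T>1$, let $u_p(x)=(1-x_2^2)u_{\max}e_1$, $u_{\max}>0$, be a Poiseuille flow with $\|\nabla u_p\|_\infty\le K_\Omega$, and let $\psi\in\mathscr C^0_c(\Gamma^l)\cap\mathrm{Lip}(\Gamma^l)$ be nonnegative and such that $u_p$ satisfies the lateral exit geometric condition (lateral EGC) in time $T-1$ with respect to $\operatorname{Supp}\psi$. Then there exists a neighborhood $O$ of $(u_p,0)$ in $\mathcal E\times W^{1,\infty}(\Omega\times\mathbb R^2)$ such that every constructed stationary solution $(\overline u,\overline f)\in O$ (see context) of the Vlasov-Navier-Stokes system in the pipe with boundary data $(u_p,\psi)$ is locally unique in the following sense: there exists a neighborhood of $(\overline u,\overline f)$ in $\mathcal E\times W^{1,\infty}(\Omega\times\mathbb R^2)$ in which $(\overline u,\overline f)$ is the only stationary solution of the Vlasov-Navier-Stokes system in the pipe with boundary data $(u_p,\psi)$.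
   Context: Boundary of phase space. $n(x)$ is the outward unit normal of $\partial\Omega$ (defined away from the four corners). $\Gamma^l=\{-L\}\times(-1,1)\times\{v_1>0\}$, $\Gamma^r=\{L\}\times(-1,1)\times\{v_1<0\}$, $\Gamma^u=(-L,L)\times\{1\}\times\{v_2<0\}$, $\Gamma^d=(-L,L)\times\{-1\}\times\{v_2>0\}$. $\Sigma^-=\Gamma^l\cup\Gamma^r\cup\Gamma^u\cup\Gamma^d$ and $\Sigma^+=\{(x,v):(x,-v)\in\Sigma^-\}$. Function space. With $\gamma(x_1,x_2)=1-x_2^2$, $\mathcal E$ is the space of vector fields $u\in\mathscr C^1(\overline\Omega)$ with $\gamma^{-1}u\in L^\infty(\Omega)$, normed by $\|u\|_{\mathcal E}=\|u\|_\infty+\|\nabla u\|_\infty+\|\gamma^{-1}u\|_\infty$. Stationary solutions of the Vlasov-Navier-Stokes system in the pipe with boundary data $(u_p,\psi)$: pairs $(u,f)=(u(x),f(x,v))$ with $$v\cdot\nabla_xf+\operatorname{div}_v((u-v)f)=0\ \text{ in }\Omega\times\mathbb R^2,$$ $$(u\cdot\nabla)u-\Delta u+\nabla p=\int_{\mathbb R^2}f(x,v)(v-u(x))\,dv,\quad\operatorname{div}u=0\ \text{ in }\Omega,$$ and $u=u_p$ on $\partial\Omega$, $f=\psi$ on $\Gamma^l$, $f=0$ on $\Gamma^r\cup\Gamma^u\cup\Gamma^d$. Characteristics. Let $P$ be a fixed linear extension operator, continuous from $L^\infty(\Omega)$ to $L^\infty(\mathbb R^2)$ and from $\mathrm{Lip}(\Omega)$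 to $\mathrm{Lip}(\mathbb R^2)$, of norm less than $2$, with $\operatorname{Supp}Pu$ contained in a fixed compact set. For a Lipschitz vector field $u$ on $\Omega$, $(X,V)(s,t,x,v)$ is the value at time $t$ of the solution of $\dot X=V$, $\dot V=(Pu)(X)-V$, $(X,V)|_{t=s}=(x,v)\in\overline\Omega\times\mathbb R^2$; $\tau_+(s,x,v)=\inf\{t>s:X(s,t,x,v)\notin\overline\Omega\}$; $\tau_{x,v}=\sup\{t<0:X(0,t,x,v)\notin\overline\Omega\}\in[-\infty,0]$, and when $\tau_{x,v}\ne-\infty$, $(X_{x,v},V_{x,v})=(X,V)(0,\tau_{x,v},x,v)$. Lateral EGC in time $T$ with respect to a compact $K\subset\Gamma^l$: $\sup_{(s,x,v)\in\mathbb R\times K}(\tau_+(s,x,v)-s)<T$ and $(X,V)(s,\tau_+(s,x,v),x,v)\in\Sigma^+$ for all $(s,x,v)\in\mathbb R\times K$. Constructed stationary solutions. The paper's existence theorem states that, when $u_p$ satisfies the lateral EGC in time $T-1$ with respect to $K:=\operatorname{Supp}\psi$ and $\|u_p\|_{W^{1,\infty}}$, $\|\psi\|_\infty$ are small enough, there is a stationary solution $(\overline u,\overline f)\in\mathcal E\times L^\infty(\Omega\times\mathbb R^2)$ close to $(u_p,0)$, with $\overline f$ Lipschitz and compactly supported in $\overline\Omega\times\mathbb R^2$. It is obtained as follows: $\overline f(x,v)=e^{-2\tau_{x,v}}\psi(X_{x,v},V_{x,v})$ if $\tau_{x,v}\ne-\infty$ and $(X_{x,v},V_{x,v})\in K$,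 and $\overline f(x,v)=0$ otherwise, where the characteristics are those of $\overline u$, and $\overline u$ solves the stationary Navier-Stokes equations with this source and $\overline u=u_p$ on $\partial\Omega$. A stationary solution of this form is called constructed. *)

theory Defs
  imports "HOL-Analysis.Analysis" "HOL-Probability.Essential_Supremum"
begin

section \<open>Function spaces\<close>

definition Linf_norm :: "'a::euclidean_space set \<Rightarrow> ('a \<Rightarrow> 'b::real_normed_vector) \<Rightarrow> ennreal" where
  "Linf_norm S g = esssup (lebesgue_on S) (\<lambda>x. ennreal (norm (g x)))"

definition Linf :: "'a::euclidean_space set \<Rightarrow> ('a \<Rightarrow> 'b::real_normed_vector) set" where
  "Linf S = {g. g \<in> borel_measurable (lebesgue_on S) \<and> Linf_norm S g < top}"

text \<open>\<open>Lip(S)\<close> carries its full norm, supremum plus best Lipschitz constant (the infimum over the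
  empty set is \<open>top\<close>).\<close>

definition Lip_norm :: "'a::euclidean_space set \<Rightarrow> ('a \<Rightarrow> 'b::real_normed_vector) \<Rightarrow> ennreal" where
  "Lip_norm S g = Linf_norm S g + (INF C\<in>{C. C-lipschitz_on S g}. ennreal C)"

definition Lip :: "'a::euclidean_space set \<Rightarrow> ('a \<Rightarrow> 'b::real_normed_vector) set" where
  "Lip S = {g. Lip_norm S g < top}"

primrec Ck :: "nat \<Rightarrow> ('a::euclidean_space \<Rightarrow> 'b::real_normed_vector) \<Rightarrow> bool" where
  "Ck 0 g \<longleftrightarrow> continuous_on UNIV g"
| "Ck (Suc k) g \<longleftrightarrow> (\<forall>x. g differentiable (at x)) \<and>
     (\<forall>b\<in>Basis. Ck k (\<lambda>x. frechet_derivative g (at x) b))"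

text \<open>Test functions on an open set \<open>S\<close>, extended by zero to the whole space.\<close>

definition test_functions :: "'a::euclidean_space set \<Rightarrow> ('a \<Rightarrow> 'b::real_normed_vector) set" where
  "test_functions S = {\<phi>. (\<forall>k. Ck k \<phi>) \<and>
     compact (closure (support_on UNIV \<phi>)) \<and> closure (support_on UNIV \<phi>) \<subseteq> S}"

definition locally_integrable_on ::
    "('a::euclidean_space \<Rightarrow> 'b::euclidean_space) \<Rightarrow> 'a set \<Rightarrow> bool" where
  "locally_integrable_on g S \<longleftrightarrow> (\<forall>C. compact C \<and> C \<subseteq> S \<longrightarrow> g absolutely_integrable_on C)"

definition is_weak_gradient ::
    "'a::euclidean_space set \<Rightarrow> ('a \<Rightarrow> real) \<Rightarrow> ('a \<Rightarrow> 'a) \<Rightarrow> bool" where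
  "is_weak_gradient S f G \<longleftrightarrow> locally_integrable_on f S \<and> locally_integrable_on G S \<and>
     (\<forall>\<phi>\<in>test_functions S. \<forall>b\<in>Basis.
        (LINT x|lebesgue_on S. f x * frechet_derivative \<phi> (at x) b) =
        - (LINT x|lebesgue_on S. (G x \<bullet> b) * \<phi> x))"

text \<open>The weak gradient is unique up to null sets, so the infimum is over a single value, or over
  the empty set (giving \<open>top\<close>) if there is no weak gradient.\<close>

definition W1inf_norm :: "'a::euclidean_space set \<Rightarrow> ('a \<Rightarrow> real) \<Rightarrow> ennreal" where
  "W1inf_norm S f = Linf_norm S f + (INF G\<in>{G. is_weak_gradient S f G}. Linf_norm S G)"

definition W1inf :: "'a::euclidean_space set \<Rightarrow> ('a \<Rightarrow> real) set" where
  "W1inf S = {f. f \<in> borel_measurable (lebesgue_on S) \<and> W1inf_norm S f < top}"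

definition C1_closure :: "(real^'n) set \<Rightarrow> (real^'n \<Rightarrow> real^'n) set" where
  "C1_closure S = {u. continuous_on (closure S) u \<and> (\<forall>x\<in>S. u differentiable (at x)) \<and>
     (\<exists>G. continuous_on (closure S) G \<and> (\<forall>x\<in>S. G x = jacobian u (at x)))}"


section \<open>The pipe and its phase space boundary\<close>

type_synonym vec2 = "real^2"
type_synonym phase = "vec2 \<times> vec2"

definition Omega :: "real \<Rightarrow> vec2 set" where
  "Omega L = {x. - L < x$1 \<and> x$1 < L \<and> - 1 < x$2 \<and> x$2 < 1}"

definition Gamma_l :: "real \<Rightarrow> phase set" where
  "Gamma_l L = {(x, v). x$1 = - L \<and> - 1 < x$2 \<and> x$2 < 1 \<and> v$1 > 0}"

definition Gamma_r :: "real \<Rightarrow> phase set" where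
  "Gamma_r L = {(x, v). x$1 = L \<and> - 1 < x$2 \<and> x$2 < 1 \<and> v$1 < 0}"

definition Gamma_u :: "real \<Rightarrow> phase set" where
  "Gamma_u L = {(x, v). - L < x$1 \<and> x$1 < L \<and> x$2 = 1 \<and> v$2 < 0}"

definition Gamma_d :: "real \<Rightarrow> phase set" where
  "Gamma_d L = {(x, v). - L < x$1 \<and> x$1 < L \<and> x$2 = - 1 \<and> v$2 > 0}"

definition Sigma_minus :: "real \<Rightarrow> phase set" where
  "Sigma_minus L = Gamma_l L \<union> Gamma_r L \<union> Gamma_u L \<union> Gamma_d L"

definition Sigma_plus :: "real \<Rightarrow> phase set" where
  "Sigma_plus L = {(x, v). (x, - v) \<in> Sigma_minus L}"

definition gam :: "vec2 \<Rightarrow> real" where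
  "gam x = 1 - (x$2)\<^sup>2"

definition E_norm :: "real \<Rightarrow> (vec2 \<Rightarrow> vec2) \<Rightarrow> ennreal" where
  "E_norm L u = Linf_norm (Omega L) u + Linf_norm (Omega L) (\<lambda>x. jacobian u (at x))
     + Linf_norm (Omega L) (\<lambda>x. u x /\<^sub>R gam x)"

text \<open>Elements are functions on the whole plane, of which only the values on
  \<open>closure (Omega L)\<close> are relevant.\<close>

definition E_space :: "real \<Rightarrow> (vec2 \<Rightarrow> vec2) set" where
  "E_space L = {u \<in> C1_closure (Omega L). (\<lambda>x. u x /\<^sub>R gam x) \<in> Linf (Omega L)}"

definition poiseuille :: "real \<Rightarrow> vec2 \<Rightarrow> vec2" where
  "poiseuille umax x = ((1 - (x$2)\<^sup>2) * umax) *\<^sub>R axis 1 1"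

text \<open>Neighborhoods in \<open>\<E> \<times> W\<^sup>1\<^sup>,\<^sup>\<infinity>(\<Omega> \<times> \<real>\<^sup>2)\<close>, whose elements are given by representatives.\<close>

definition is_neighborhood ::
    "real \<Rightarrow> ((vec2 \<Rightarrow> vec2) \<times> (phase \<Rightarrow> real)) set \<Rightarrow> (vec2 \<Rightarrow> vec2) \<Rightarrow> (phase \<Rightarrow> real) \<Rightarrow> bool" where
  "is_neighborhood L N u f \<longleftrightarrow>
     N \<subseteq> E_space L \<times> W1inf (Omega L \<times> UNIV) \<and>
     (\<exists>\<epsilon>>0. \<forall>u'\<in>E_space L. \<forall>f'\<in>W1inf (Omega L \<times> UNIV).
        E_norm L (\<lambda>x. u' x - u x) + W1inf_norm (Omega L \<times> UNIV) (\<lambda>z. f' z - f z) < ennreal \<epsilon>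
        \<longrightarrow> (u', f') \<in> N)"


section \<open>Characteristics\<close>

text \<open>\<open>P\<close> acts on representatives: on \<open>L\<^sup>\<infinity>\<close> its properties hold almost everywhere (so that, by
  linearity and the norm bound, it descends to classes), whereas the \<open>Lip\<close> bound makes \<open>P u\<close> a
  Lipschitz function everywhere when \<open>u\<close> is Lipschitz on \<open>S\<close>.\<close>

definition extension_operator ::
    "vec2 set \<Rightarrow> ((vec2 \<Rightarrow> vec2) \<Rightarrow> (vec2 \<Rightarrow> vec2)) \<Rightarrow> bool" where
  "extension_operator S P \<longleftrightarrow>
     (\<forall>u\<in>Linf S. \<forall>w\<in>Linf S. \<forall>a b. AE x in lebesgue.
        P (\<lambda>y. a *\<^sub>R u y + b *\<^sub>R w y) x = a *\<^sub>R P u x + b *\<^sub>R P w x) \<and>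
     (\<forall>u\<in>Linf S. P u \<in> Linf UNIV \<and> (AE x in lebesgue_on S. P u x = u x)) \<and>
     (\<exists>c. 0 \<le> c \<and> c < 2 \<and>
        (\<forall>u\<in>Linf S. Linf_norm UNIV (P u) \<le> ennreal c * Linf_norm S u) \<and>
        (\<forall>u\<in>Lip S. Lip_norm UNIV (P u) \<le> ennreal c * Lip_norm S u)) \<and>
     (\<exists>C. compact C \<and> (\<forall>u\<in>Linf S. AE x in lebesgue. x \<notin> C \<longrightarrow> P u x = 0))"

text \<open>Meaningful when \<open>P u\<close> is Lipschitz: the solution then exists globally and is unique.\<close>

definition characteristic ::
    "((vec2 \<Rightarrow> vec2) \<Rightarrow> (vec2 \<Rightarrow> vec2)) \<Rightarrow> (vec2 \<Rightarrow> vec2) \<Rightarrow> real \<Rightarrow> real \<Rightarrow> phase \<Rightarrow> phase" where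
  "characteristic P u s t z =
     (THE Z. Z s = z \<and>
        (\<forall>r. (Z has_vector_derivative (snd (Z r), P u (fst (Z r)) - snd (Z r))) (at r))) t"

definition tau_plus ::
    "real \<Rightarrow> ((vec2 \<Rightarrow> vec2) \<Rightarrow> (vec2 \<Rightarrow> vec2)) \<Rightarrow> (vec2 \<Rightarrow> vec2) \<Rightarrow> real \<Rightarrow> phase \<Rightarrow> ereal" where
  "tau_plus L P u s z =
     Inf (ereal ` {t. t > s \<and> fst (characteristic P u s t z) \<notin> closure (Omega L)})"

definition tau_minus ::
    "real \<Rightarrow> ((vec2 \<Rightarrow> vec2) \<Rightarrow> (vec2 \<Rightarrow> vec2)) \<Rightarrow> (vec2 \<Rightarrow> vec2) \<Rightarrow> phase \<Rightarrow> ereal" where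
  "tau_minus L P u z =
     Sup (ereal ` {t. t < 0 \<and> fst (characteristic P u 0 t z) \<notin> closure (Omega L)})"

text \<open>The first condition forces \<open>tau_plus\<close> to be finite on \<open>K\<close>, so that \<open>real_of_ereal\<close> is
  harmless in the second one.\<close>

definition lateral_EGC ::
    "real \<Rightarrow> ((vec2 \<Rightarrow> vec2) \<Rightarrow> (vec2 \<Rightarrow> vec2)) \<Rightarrow> (vec2 \<Rightarrow> vec2) \<Rightarrow> real \<Rightarrow> phase set \<Rightarrow> bool" where
  "lateral_EGC L P u T K \<longleftrightarrow>
     (SUP (s, z)\<in>UNIV \<times> K. tau_plus L P u s z - ereal s) < ereal T \<and>
     (\<forall>s. \<forall>z\<in>K. characteristic P u s (real_of_ereal (tau_plus L P u s z)) z \<in> Sigma_plus L)"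


section \<open>Stationary solutions\<close>

definition Supp :: "real \<Rightarrow> (phase \<Rightarrow> real) \<Rightarrow> phase set" where
  "Supp L \<psi> = closure (support_on (Gamma_l L) \<psi>)"

text \<open>Nonnegative elements of \<open>C\<^sup>0\<^sub>c(\<Gamma>\<^sup>l) \<inter> Lip(\<Gamma>\<^sup>l)\<close>; boundedness is automatic.\<close>

definition inflow_data :: "real \<Rightarrow> (phase \<Rightarrow> real) \<Rightarrow> bool" where
  "inflow_data L \<psi> \<longleftrightarrow> continuous_on (Gamma_l L) \<psi> \<and>
     compact (Supp L \<psi>) \<and> Supp L \<psi> \<subseteq> Gamma_l L \<and>
     (\<exists>C. C-lipschitz_on (Gamma_l L) \<psi>) \<and> (\<forall>z\<in>Gamma_l L. 0 \<le> \<psi> z)"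

text \<open>The equation in the sense of distributions; the derivative of \<open>\<phi>\<close> in the direction
  \<open>(v, u(x) - v)\<close> is \<open>v \<cdot> \<nabla>\<^sub>x\<phi> + (u(x) - v) \<cdot> \<nabla>\<^sub>v\<phi>\<close>.\<close>

definition vlasov :: "real \<Rightarrow> (vec2 \<Rightarrow> vec2) \<Rightarrow> (phase \<Rightarrow> real) \<Rightarrow> bool" where
  "vlasov L u f \<longleftrightarrow>
     (\<forall>\<phi>\<in>test_functions (Omega L \<times> UNIV).
        (LINT z|lebesgue_on (Omega L \<times> UNIV).
           f z * frechet_derivative \<phi> (at z) (snd z, u (fst z) - snd z)) = 0)"

definition drag :: "(vec2 \<Rightarrow> vec2) \<Rightarrow> (phase \<Rightarrow> real) \<Rightarrow> vec2 \<Rightarrow> vec2" where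
  "drag u f x = (LINT v|lebesgue. f (x, v) *\<^sub>R (v - u x))"

text \<open>Only \<open>u \<in> C\<^sup>1\<close> is available, so the momentum equation, with a pressure, is also understood in
  the sense of distributions. The inner product of Jacobians is \<open>\<nabla>u : \<nabla>\<phi>\<close>. The drag is required to
  be well defined and locally integrable, because the Bochner integral of a non-integrable
  function is 0 by convention.\<close>

definition navier_stokes :: "real \<Rightarrow> (vec2 \<Rightarrow> vec2) \<Rightarrow> (phase \<Rightarrow> real) \<Rightarrow> bool" where
  "navier_stokes L u f \<longleftrightarrow>
     (AE x in lebesgue_on (Omega L). integrable lebesgue (\<lambda>v. f (x, v) *\<^sub>R (v - u x))) \<and>
     locally_integrable_on (drag u f) (Omega L) \<and>
     (\<exists>p::vec2 \<Rightarrow> real. locally_integrable_on p (Omega L) \<and>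
       (\<forall>\<phi>\<in>test_functions (Omega L).
          (LINT x|lebesgue_on (Omega L).
             (jacobian u (at x) *v u x) \<bullet> \<phi> x + jacobian u (at x) \<bullet> jacobian \<phi> (at x)
             - p x * trace (jacobian \<phi> (at x)))
          = (LINT x|lebesgue_on (Omega L). drag u f x \<bullet> \<phi> x))) \<and>
     (\<forall>x\<in>Omega L. trace (jacobian u (at x)) = 0)"

text \<open>Boundary values of a class \<open>f\<close> are those of its continuous representative up to the
  boundary, which exists for \<open>f\<close> in \<open>W\<^sup>1\<^sup>,\<^sup>\<infinity>(\<Omega> \<times> \<real>\<^sup>2)\<close>.\<close>

definition kinetic_boundary :: "real \<Rightarrow> (phase \<Rightarrow> real) \<Rightarrow> (phase \<Rightarrow> real) \<Rightarrow> bool" where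
  "kinetic_boundary L \<psi> f \<longleftrightarrow>
     (\<exists>F. continuous_on (closure (Omega L) \<times> UNIV) F \<and>
       (AE z in lebesgue_on (Omega L \<times> UNIV). f z = F z) \<and>
       (\<forall>z\<in>Gamma_l L. F z = \<psi> z) \<and>
       (\<forall>z\<in>Gamma_r L \<union> Gamma_u L \<union> Gamma_d L. F z = 0))"

definition stationary_solution ::
    "real \<Rightarrow> (vec2 \<Rightarrow> vec2) \<Rightarrow> (phase \<Rightarrow> real) \<Rightarrow> (vec2 \<Rightarrow> vec2) \<Rightarrow> (phase \<Rightarrow> real) \<Rightarrow> bool" where
  "stationary_solution L up \<psi> u f \<longleftrightarrow>
     u \<in> E_space L \<and> f \<in> W1inf (Omega L \<times> UNIV) \<and>
     vlasov L u f \<and> navier_stokes L u f \<and>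
     (\<forall>x\<in>frontier (Omega L). u x = up x) \<and> kinetic_boundary L \<psi> f"

definition backward_density ::
    "real \<Rightarrow> ((vec2 \<Rightarrow> vec2) \<Rightarrow> (vec2 \<Rightarrow> vec2)) \<Rightarrow> (phase \<Rightarrow> real) \<Rightarrow> (vec2 \<Rightarrow> vec2) \<Rightarrow> phase \<Rightarrow> real" where
  "backward_density L P \<psi> u z =
     (let t = real_of_ereal (tau_minus L P u z); z' = characteristic P u 0 t z in
      if tau_minus L P u z \<noteq> - \<infinity> \<and> z' \<in> Supp L \<psi> then exp (- 2 * t) * \<psi> z' else 0)"

definition constructed_solution ::
    "real \<Rightarrow> ((vec2 \<Rightarrow> vec2) \<Rightarrow> (vec2 \<Rightarrow> vec2)) \<Rightarrow> (vec2 \<Rightarrow> vec2) \<Rightarrow> (phase \<Rightarrow> real) \<Rightarrow>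
      (vec2 \<Rightarrow> vec2) \<Rightarrow> (phase \<Rightarrow> real) \<Rightarrow> bool" where
  "constructed_solution L P up \<psi> u f \<longleftrightarrow>
     stationary_solution L up \<psi> u f \<and>
     (AE z in lebesgue_on (Omega L \<times> UNIV). f z = backward_density L P \<psi> u z)"

end

theory Submission
  imports Defs
begin

text \<open>Any two stationary solutions \<open>(u, f)\<close>, \<open>(u', f')\<close> whose velocities are close to \<open>u\<^sub>p\<close> and whose
  densities are small in \<open>W\<^sup>1\<^sup>,\<^sup>\<infinity>\<close> coincide, whether or not they are constructed. Put \<open>w = u' - u\<close>.

  Testing the difference of the momentum equations with \<open>w\<close> bounds \<open>A = \<parallel>\<nabla>w\<parallel>\<^sup>2\<close> (in \<open>L\<^sup>2\<close>) by a small
  multiple of \<open>A\<close> plus the contribution of \<open>f' - f\<close> to the drag. The latter is controlled uniformly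
  by \<open>\<parallel>\<nabla>w\<parallel>\<close>: along the characteristics of \<open>u\<close>, \<open>f'\<close> solves the transport equation up to an error
  \<open>|w| \<parallel>\<nabla>\<^sub>v f'\<parallel>\<close>, and a characteristic that carries mass starts in \<open>Supp \<psi>\<close>, leaves the pipe in
  bounded time by the exit condition, and keeps \<open>v\<^sub>1\<close> bounded below, because closeness in \<open>\<E>\<close> forces
  \<open>u\<^sub>1 \<ge> 0\<close>. Hence it is a graph over \<open>x\<^sub>1\<close>, and as \<open>w\<close> vanishes on the wall,
  \<open>|w(x\<^sub>1, x\<^sub>2)| \<le> \<integral> |\<nabla>w(x\<^sub>1, s)| ds\<close>, so that the integral of \<open>|w|\<close> along the characteristic is at
  most a multiple of \<open>\<parallel>\<nabla>w\<parallel>\<close>. Characteristics trapped in the pipe backwards in time are negligible: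
  if the gradient of \<open>u\<close> is small, the friction separates them exponentially in backward time, so at
  most one velocity over each point is trapped, and continuity of the densities takes care of it.\<close>

section \<open>Smooth functions with compact support\<close>

text \<open>The estimate closes on one scalar \<open>I\<close>, the integral over x_1 of the
  cross-section integrals of |grad w|. The densities differ by at most a small multiple of
  \<open>I\<close>, the integral of |w| is at most 2 I, and I^2 <= 4 L A, so this part of the drag
  costs a small multiple of \<open>A\<close>. Near the walls u_p itself vanishes, and only the
  weight in \<open>E_norm\<close> saves the sign of u_1: |u - u_p| <= e gamma <= u_max gamma. Low
  regularity shapes the rest. The densities are only Lipschitz, and a gradient known almost
  everywhere cannot be restricted to a curve, so transport is proved by mollifying the equation. The
  difference w is only C^1, hence no test function; smooth solenoidal approximations replace it and
  remove the two pressures. A characteristic may enter at a corner or tangentially, where no datum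
  is prescribed; continuity up to the boundary decides these cases. The constant 1/20 for K_Omega
  does not depend on L, because Poincare is applied across the pipe. It gives |u| <= 1/20 and |grad
  u| <= 1/10: convection then consumes at most half of \<open>A\<close>, and the Lipschitz constant
  stays below the 1/8 under which friction separates trapped characteristics.\<close>

lemma Ck_Suc_imp: "Ck (Suc k) g \<Longrightarrow> Ck k g"
proof (induction k arbitrary: g)
  case 0
  then show ?case
    by (simp add: continuous_at_imp_continuous_on differentiable_imp_continuous_within)
next
  case (Suc k)
  then show ?case by (metis Ck.simps(2))
qed

text \<open>\<open>Ck\<close> is recursive in \<open>k\<close>, so smoothness of a concrete function
  needs a family that contains all its derivatives. For \<open>expinv\<close> the family is indexed
  by polynomials, for \<open>mol\<close> by the smooth kernels with a common support radius.\<close>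

lemma Ck_coinduct:
  assumes "g \<in> F"
    and "\<And>g. g \<in> F \<Longrightarrow> \<forall>x. g differentiable (at x)"
    and "\<And>g b. g \<in> F \<Longrightarrow> b \<in> Basis \<Longrightarrow> (\<lambda>x. frechet_derivative g (at x) b) \<in> F"
  shows "Ck k g"
  using assms(1)
proof (induction k arbitrary: g)
  case 0
  then show ?case
    using assms(2) by (simp add: continuous_at_imp_continuous_on differentiable_imp_continuous_within)
next
  case (Suc k)
  then show ?case using assms by simp
qed

lemma Ck_const: "Ck k (\<lambda>x. c)"
  by (induction k arbitrary: c) simp_all

lemma Ck_add: "Ck k f \<Longrightarrow> Ck k g \<Longrightarrow> Ck k (\<lambda>x. f x + g x)"
proof (induction k arbitrary: f g)
  case 0
  then show ?case by (simp add: continuous_on_add)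
next
  case (Suc k)
  have "(\<lambda>x. frechet_derivative (\<lambda>x. f x + g x) (at x) b) =
     (\<lambda>x. frechet_derivative f (at x) b + frechet_derivative g (at x) b)" for b
  proof
    fix x
    have d: "f differentiable (at x)" "g differentiable (at x)" using Suc.prems by auto
    have "((\<lambda>x. f x + g x) has_derivative
      (\<lambda>b. frechet_derivative f (at x) b + frechet_derivative g (at x) b)) (at x)"
      by (rule has_derivative_add) (use d frechet_derivative_works in blast)+
    then show "frechet_derivative (\<lambda>x. f x + g x) (at x) b =
        frechet_derivative f (at x) b + frechet_derivative g (at x) b"
      by (metis frechet_derivative_at)
  qed
  moreover have "Ck k (\<lambda>x. frechet_derivative f (at x) b + frechet_derivative g (at x) b)"
    if "b \<in> Basis" for b
    by (rule Suc.IH) (use Suc.prems that in simp_all)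
  moreover have "(\<lambda>x. f x + g x) differentiable (at x)" for x
    using Suc.prems by (intro differentiable_add) simp_all
  ultimately show ?case by simp
qed

lemma Ck_sum: "finite I \<Longrightarrow> (\<And>i. i \<in> I \<Longrightarrow> Ck k (f i)) \<Longrightarrow> Ck k (\<lambda>x. \<Sum>i\<in>I. f i x)"
  by (induction I rule: finite_induct) (simp_all add: Ck_add Ck_const)

lemma Ck_mult:
  fixes f g :: "'a::euclidean_space \<Rightarrow> real"
  shows "Ck k f \<Longrightarrow> Ck k g \<Longrightarrow> Ck k (\<lambda>x. f x * g x)"
proof (induction k arbitrary: f g)
  case 0
  then show ?case by (simp add: continuous_on_mult)
next
  case (Suc k)
  have d: "f differentiable (at x)" "g differentiable (at x)" for x using Suc.prems by auto
  have D: "((\<lambda>x. f x * g x) has_derivative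
    (\<lambda>b. f x * frechet_derivative g (at x) b + frechet_derivative f (at x) b * g x)) (at x)" for x
    by (rule has_derivative_mult) (use d frechet_derivative_works in blast)+
  have "(\<lambda>x. frechet_derivative (\<lambda>x. f x * g x) (at x) b) =
     (\<lambda>x. f x * frechet_derivative g (at x) b + frechet_derivative f (at x) b * g x)" for b
    using frechet_derivative_at[OF D] by (intro ext) (rule fun_cong[OF sym])
  moreover have k: "Ck k f" "Ck k g" using Suc.prems Ck_Suc_imp by blast+
  moreover have "(\<lambda>x. f x * g x) differentiable (at x)" for x
    using d by (intro differentiable_mult)
  moreover have "Ck k (\<lambda>x. f x * frechet_derivative g (at x) b + frechet_derivative f (at x) b * g x)"
    if "b \<in> Basis" for b
    by (rule Ck_add; rule Suc.IH) (use k Suc.prems that in simp_all)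
  ultimately show ?case by simp
qed

lemma Ck_prod:
  fixes f :: "'i \<Rightarrow> 'a::euclidean_space \<Rightarrow> real"
  shows "finite I \<Longrightarrow> (\<And>i. i \<in> I \<Longrightarrow> Ck k (f i)) \<Longrightarrow> Ck k (\<lambda>x. \<Prod>i\<in>I. f i x)"
  by (induction I rule: finite_induct) (simp_all add: Ck_mult Ck_const)

lemma Ck_affine:
  fixes f :: "'c::euclidean_space \<Rightarrow> real" and A :: "'a::euclidean_space \<Rightarrow> 'c"
  assumes "bounded_linear A"
  shows "Ck k f \<Longrightarrow> Ck k (\<lambda>x. f (A x + d))"
proof (induction k arbitrary: f)
  case 0
  have "continuous_on UNIV (\<lambda>x. A x + d)"
    using assms by (intro continuous_intros linear_continuous_on)
  with 0 show ?case by (auto intro: continuous_on_compose2)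
next
  case (Suc k)
  have D: "((\<lambda>x. f (A x + d)) has_derivative (\<lambda>h. frechet_derivative f (at (A x + d)) (A h))) (at x)" for x
  proof (rule has_derivative_compose[of "\<lambda>x. A x + d" A x UNIV f])
    show "((\<lambda>x. A x + d) has_derivative A) (at x)"
      using bounded_linear_imp_has_derivative[OF assms] by (auto intro!: derivative_eq_intros)
    show "(f has_derivative frechet_derivative f (at (A x + d))) (at (A x + d))"
      using Suc.prems frechet_derivative_works by auto
  qed
  \<comment> \<open>The chain rule gives a derivative in the direction \<open>A b\<close>, which
    need not be a basis vector; the expansion returns to the partial derivatives that
    \<open>Ck\<close> controls.\<close>
  have "frechet_derivative (\<lambda>x. f (A x + d)) (at x) b =
      (\<Sum>c\<in>Basis. (A b \<bullet> c) * frechet_derivative f (at (A x + d)) c)" for x b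
  proof -
    have l: "linear (frechet_derivative f (at (A x + d)))"
      using Suc.prems by (simp add: linear_frechet_derivative)
    have "frechet_derivative (\<lambda>x. f (A x + d)) (at x) b = frechet_derivative f (at (A x + d)) (A b)"
      using frechet_derivative_at[OF D] by metis
    also have "\<dots> = frechet_derivative f (at (A x + d)) (\<Sum>c\<in>Basis. (A b \<bullet> c) *\<^sub>R c)"
      by (simp add: euclidean_representation)
    also have "\<dots> = (\<Sum>c\<in>Basis. (A b \<bullet> c) * frechet_derivative f (at (A x + d)) c)"
      by (simp add: linear_sum[OF l] linear_scale[OF l])
    finally show ?thesis .
  qed
  then have e: "(\<lambda>x. frechet_derivative (\<lambda>x. f (A x + d)) (at x) b) =
      (\<lambda>x. \<Sum>c\<in>Basis. (A b \<bullet> c) * frechet_derivative f (at (A x + d)) c)" for b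
    by (rule ext)
  have IH: "Ck k (\<lambda>x. frechet_derivative f (at (A x + d)) c)" if "c \<in> Basis" for c
    using Suc.prems that by (intro Suc.IH[of "\<lambda>y. frechet_derivative f (at y) c"]) simp
  have "Ck k (\<lambda>x. frechet_derivative (\<lambda>x. f (A x + d)) (at x) b)" for b
    unfolding e by (rule Ck_sum[OF finite_Basis], rule Ck_mult[OF Ck_const IH])
  moreover have "(\<lambda>x. f (A x + d)) differentiable (at x)" for x
    using D differentiableI by blast
  ultimately show ?case by simp
qed

text \<open>The flat function exp(-1/s), multiplied by a polynomial in 1/s so that the family is
  closed under differentiation.\<close>

definition expinv :: "real poly \<Rightarrow> real \<Rightarrow> real" where
  "expinv p s = (if s > 0 then poly p (1 / s) * exp (- (1 / s)) else 0)"

lemma tendsto_poly_mult_exp_neg: "((\<lambda>x::real. poly q x * exp (- x)) \<longlongrightarrow> 0) at_top"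
proof -
  have "((\<lambda>x. \<Sum>i\<le>degree q. coeff q i * (x ^ i / exp x)) \<longlongrightarrow> (\<Sum>i\<le>degree q. coeff q i * 0)) at_top"
    by (intro tendsto_intros tendsto_power_div_exp_0)
  moreover have "(\<lambda>x. \<Sum>i\<le>degree q. coeff q i * (x ^ i / exp x)) = (\<lambda>x. poly q x * exp (- x))"
    by (simp add: fun_eq_iff poly_altdef sum_distrib_right exp_minus divide_inverse mult.assoc)
  ultimately show ?thesis by simp
qed

text \<open>With x = 1/s, the derivative in s of p(x) exp(-x) is x^2 (p - p')(x) exp(-x); this is
  the new index polynomial. Only s = 0 needs a limit.\<close>

lemma expinv_has_derivative:
  "(expinv p has_real_derivative expinv (monom 1 2 * (p - pderiv p)) s) (at s)"
proof -
  consider "s > 0" | "s < 0" | "s = 0" by linarith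
  then show ?thesis
  proof cases
    case 1
    have "((\<lambda>s. poly p (1 / s) * exp (- (1 / s))) has_real_derivative
        expinv (monom 1 2 * (p - pderiv p)) s) (at s)"
    proof -
      have i: "((\<lambda>s. 1 / s) has_real_derivative - (1 / s^2)) (at s)"
        using DERIV_inverse[of s UNIV] 1 by (simp add: inverse_eq_divide power2_eq_square)
      have "((\<lambda>s. poly p (1 / s)) has_real_derivative poly (pderiv p) (1 / s) * - (1 / s^2)) (at s)"
        by (rule DERIV_chain2[OF poly_DERIV i])
      moreover have "((\<lambda>s. exp (- (1 / s))) has_real_derivative exp (- (1 / s)) * - (- (1 / s^2))) (at s)"
        by (rule DERIV_chain2[OF DERIV_exp DERIV_minus[OF i]])
      ultimately have "((\<lambda>s. poly p (1 / s) * exp (- (1 / s))) has_real_derivative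
        poly (pderiv p) (1 / s) * - (1 / s^2) * exp (- (1 / s)) +
        exp (- (1 / s)) * - (- (1 / s^2)) * poly p (1 / s)) (at s)"
        by (rule DERIV_mult)
      then show ?thesis
        by (rule DERIV_cong) (use 1 in \<open>simp add: expinv_def poly_monom left_diff_distrib right_diff_distrib power_one_over mult_ac\<close>)
    qed
    then show ?thesis
      by (rule has_field_derivative_transform_within_open[where S="{0<..}"])
        (use 1 in \<open>auto simp: expinv_def\<close>)
  next
    case 2
    have "((\<lambda>s. 0) has_real_derivative expinv (monom 1 2 * (p - pderiv p)) s) (at s)"
      using 2 by (auto simp: expinv_def)
    then show ?thesis
      by (rule has_field_derivative_transform_within_open[where S="{..<0}"])
        (use 2 in \<open>auto simp: expinv_def\<close>)
  next
    case 3
    \<comment> \<open>From the right, the difference quotient at 0 is x p(x) exp(-x) with x = 1/h;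
      the factor \<open>monom 1 1\<close> is the division by h.\<close>
    have "((\<lambda>h. poly (monom 1 1 * p) (inverse h) * exp (- inverse h)) \<longlongrightarrow> 0) (at_right 0)"
      by (rule filterlim_compose[OF tendsto_poly_mult_exp_neg filterlim_inverse_at_top_right])
    then have r: "((\<lambda>h. expinv p h / h) \<longlongrightarrow> 0) (at_right 0)"
      by (rule Lim_transform_eventually)
        (auto simp: expinv_def eventually_at_filter poly_monom field_simps)
    have l: "((\<lambda>h. expinv p h / h) \<longlongrightarrow> 0) (at_left 0)"
      by (rule Lim_transform_eventually[OF tendsto_const])
        (auto simp: expinv_def eventually_at_filter)
    have "((\<lambda>h. expinv p h / h) \<longlongrightarrow> 0) (at 0)"
      using l r by (rule filterlim_split_at)
    then show ?thesis using 3 by (simp add: DERIV_def) (simp add: expinv_def)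
  qed
qed

lemma Ck_expinv: "Ck k (expinv p)"
proof (rule Ck_coinduct[where F="range expinv"])
  have *: "(expinv p has_derivative (*) (expinv (monom 1 2 * (p - pderiv p)) s)) (at s)" for p s
    using expinv_has_derivative[of p s] by (simp add: has_field_derivative_def)
  then have "frechet_derivative (expinv p) (at s) 1 = expinv (monom 1 2 * (p - pderiv p)) s" for p s
    by (metis frechet_derivative_at mult.right_neutral)
  then have e: "(\<lambda>s. frechet_derivative (expinv p) (at s) 1) = expinv (monom 1 2 * (p - pderiv p))" for p
    by (simp add: fun_eq_iff)
  show "(\<lambda>x. frechet_derivative g (at x) b) \<in> range expinv" if "g \<in> range expinv" "b \<in> Basis" for g b
    using that e by auto
  show "\<forall>x. g differentiable (at x)" if "g \<in> range expinv" for g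
    using that * by (auto simp: differentiable_def)
qed auto

section \<open>From almost every point to every point\<close>

lemma AE_lebesgue_on_dense:
  fixes S :: "'a::euclidean_space set"
  assumes "open S" "AE x in lebesgue_on S. Q x" "x \<in> S" "0 < e"
  obtains y where "y \<in> S" "dist y x < e" "Q y"
proof -
  have o: "open (S \<inter> ball x e)" using assms by auto
  have "\<not> negligible (S \<inter> ball x e)"
    using o assms(3,4) by (intro open_not_negligible) auto
  moreover have "negligible {y\<in>S. \<not> Q y}"
  proof -
    have "AE x in lebesgue. x \<in> S \<longrightarrow> Q x"
      using assms(1,2) by (simp add: AE_restrict_space_iff)
    then have "negligible {y. \<not> (y \<in> S \<longrightarrow> Q y)}"
      by (simp add: AE_iff_null_sets eventually_ae_filter negligible_iff_null_sets)
       (metis (no_types, lifting) completion.complete2 Collect_mono null_setsD2 null_sets_completion_subset)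
    moreover have "{y. \<not> (y \<in> S \<longrightarrow> Q y)} = {y\<in>S. \<not> Q y}" by auto
    ultimately show ?thesis by simp
  qed
  ultimately have "\<not> S \<inter> ball x e \<subseteq> {y\<in>S. \<not> Q y}"
    using negligible_subset by blast
  then show ?thesis using that by (auto simp: dist_commute)
qed

text \<open>The set where \<open>g\<close> leaves \<open>C\<close> is open, and a nonempty open set
  is not negligible. This converts essential bounds and almost sure identities into pointwise ones
  whenever a continuous representative is at hand.\<close>

lemma AE_lebesgue_on_closed:
  fixes S :: "'a::euclidean_space set" and g :: "'a \<Rightarrow> 'b::topological_space"
  assumes "open S" "AE x in lebesgue_on S. g x \<in> C" "continuous_on S g" "closed C" "x \<in> S"
  shows "g x \<in> C"
proof (rule ccontr)
  assume "g x \<notin> C"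
  have "open (S \<inter> g -` (- C))"
    using assms by (intro continuous_open_preimage) auto
  moreover have "x \<in> S \<inter> g -` (- C)" using \<open>g x \<notin> C\<close> assms by auto
  ultimately obtain e where e: "e > 0" "ball x e \<subseteq> S \<inter> g -` (- C)"
    using open_contains_ball by blast
  obtain y where "y \<in> S" "dist y x < e" "g y \<in> C"
    using AE_lebesgue_on_dense[OF assms(1,2,5) e(1)] by blast
  with e(2) show False by (auto simp: subset_iff dist_commute)
qed


section \<open>Mollification\<close>

lemma integrable_continuous_bounded_support:
  fixes g :: "'a::euclidean_space \<Rightarrow> 'b::euclidean_space"
  assumes "continuous_on UNIV g" "\<And>y. g y \<noteq> 0 \<Longrightarrow> norm y \<le> R"
  shows "integrable lborel g"
proof -
  have "integrable lborel (\<lambda>x. indicator (cball 0 R) x *\<^sub>R g x)"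
    by (rule borel_integrable_compact) (use assms continuous_on_subset[OF assms(1)] in auto)
  moreover have "(\<lambda>x. indicator (cball 0 R) x *\<^sub>R g x) = g"
    using assms(2) by (force simp: fun_eq_iff indicator_def)
  ultimately show ?thesis by simp
qed

lemma LINT_eq_integral_cbox:
  fixes g :: "'a::euclidean_space \<Rightarrow> 'b::euclidean_space"
  assumes "integrable lborel g" "\<And>y. g y \<noteq> 0 \<Longrightarrow> y \<in> cbox a b"
  shows "(LINT y|lborel. g y) = integral (cbox a b) g"
proof -
  have "(\<lambda>x. if x \<in> cbox a b then g x else 0) = g"
    using assms(2) by (auto simp: fun_eq_iff)
  then show ?thesis
    using integral_lborel[OF assms(1)] Henstock_Kurzweil_Integration.integral_restrict_UNIV[of "cbox a b" g] by simp
qed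

lemma frechet_derivative_zero_outside_support:
  fixes \<xi> :: "'a::euclidean_space \<Rightarrow> real"
  assumes "\<And>y. \<xi> y \<noteq> 0 \<Longrightarrow> y \<in> S" "closed S" "y \<notin> S"
  shows "frechet_derivative \<xi> (at y) = (\<lambda>h. 0)"
proof -
  have "(\<xi> has_derivative (\<lambda>h. 0)) (at y)"
    by (rule has_derivative_transform_within_open[of "\<lambda>y. 0" "\<lambda>h. 0" y UNIV "- S"])
      (use assms in \<open>auto simp: open_Compl\<close>)
  then show ?thesis by (metis frechet_derivative_at)
qed

lemma smooth_derivative:
  assumes "\<And>k. Ck k \<xi>"
  shows "(\<xi> has_derivative frechet_derivative \<xi> (at y)) (at y)"
proof -
  have "\<xi> differentiable (at y)" using assms[of 1] by simp
  then show ?thesis by (simp add: frechet_derivative_works)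
qed

lemma smooth_continuous:
  assumes "\<And>k. Ck k \<xi>"
  shows "continuous_on A \<xi>"
  using assms[of 0] continuous_on_subset by auto

lemma smooth_partial:
  assumes "\<And>k. Ck k \<xi>" "b \<in> Basis"
  shows "Ck k (\<lambda>y. frechet_derivative \<xi> (at y) b)"
  using assms(1)[of "Suc k"] assms(2) by simp

lemma derivative_Basis_expand:
  fixes \<xi> :: "'a::euclidean_space \<Rightarrow> real"
  assumes "\<And>k. Ck k \<xi>"
  shows "frechet_derivative \<xi> (at y) h = (\<Sum>b\<in>Basis. (h \<bullet> b) * frechet_derivative \<xi> (at y) b)"
proof -
  have l: "linear (frechet_derivative \<xi> (at y))"
    using smooth_derivative[OF assms] has_derivative_linear by blast
  have "frechet_derivative \<xi> (at y) h = frechet_derivative \<xi> (at y) (\<Sum>b\<in>Basis. (h \<bullet> b) *\<^sub>R b)"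
    by (simp add: euclidean_representation)
  also have "\<dots> = (\<Sum>b\<in>Basis. (h \<bullet> b) * frechet_derivative \<xi> (at y) b)"
    by (simp add: linear_sum[OF l] linear_scale[OF l])
  finally show ?thesis .
qed

lemma continuous_on_smooth_derivative:
  fixes \<xi> :: "'a::euclidean_space \<Rightarrow> real"
  assumes "\<And>k. Ck k \<xi>" "continuous_on A g" "continuous_on A h"
  shows "continuous_on A (\<lambda>x. frechet_derivative \<xi> (at (g x)) (h x))"
proof -
  have "continuous_on A (\<lambda>x. frechet_derivative \<xi> (at (g x)) b)" if "b \<in> Basis" for b
    by (rule continuous_on_compose2[OF smooth_continuous[OF smooth_partial[OF assms(1) that]] assms(2)]) auto
  then show ?thesis
    unfolding derivative_Basis_expand[OF assms(1), of _ "h _"]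
    by (intro continuous_intros assms)
qed

text \<open>A tensor product of one-dimensional bumps, so that smoothness reduces to
  \<open>expinv\<close> composed with affine maps. The support is a cube, not a ball; bounding the
  norm by the l1 norm gives the radius \<open>DIM('a)\<close> used below.\<close>

definition bump0 :: "'a::euclidean_space \<Rightarrow> real" where
  "bump0 y = (\<Prod>b\<in>Basis. expinv 1 (y \<bullet> b + 1) * expinv 1 (- (y \<bullet> b) + 1))"

lemma expinv_1: "expinv 1 s \<ge> 0" "expinv 1 s \<noteq> 0 \<longleftrightarrow> s > 0"
  by (auto simp: expinv_def)

lemma Ck_bump0: "Ck k bump0"
proof -
  have "Ck k (\<lambda>y. expinv 1 (y \<bullet> b + 1))" "Ck k (\<lambda>y. expinv 1 (- (y \<bullet> b) + 1))" for b :: 'a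
    by (rule Ck_affine[OF _ Ck_expinv], intro bounded_linear_inner_left
        bounded_linear_minus[OF bounded_linear_inner_left])+
  then show ?thesis
    unfolding bump0_def[abs_def] by (intro Ck_prod Ck_mult) auto
qed

lemma bump0_nonneg: "bump0 y \<ge> 0"
  unfolding bump0_def by (intro prod_nonneg) (simp add: expinv_1)

lemma bump0_support:
  fixes y :: "'a::euclidean_space"
  assumes "bump0 y \<noteq> 0" shows "norm y \<le> DIM('a)"
proof -
  have "\<forall>b\<in>Basis. y \<bullet> b + 1 > 0 \<and> - (y \<bullet> b) + 1 > 0"
    using assms unfolding bump0_def by (auto simp: prod_zero_iff expinv_1)
  then have "(\<Sum>b\<in>Basis. \<bar>y \<bullet> b\<bar>) \<le> (\<Sum>b\<in>(Basis::'a set). 1)"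
    by (intro sum_mono) (auto simp: abs_le_iff less_imp_le)
  then show ?thesis using norm_le_l1[of y] by simp
qed

lemma integrable_bump0: "integrable lborel bump0"
  by (rule integrable_continuous_bounded_support[OF smooth_continuous[OF Ck_bump0] bump0_support])

text \<open>A zero integral would make this nonnegative continuous function vanish almost
  everywhere, hence at the origin, where it is positive.\<close>

lemma integral_bump0_pos: "(LINT y|lborel. bump0 (y::'a::euclidean_space)) > 0"
proof -
  have "(LINT y|lborel. bump0 (y::'a)) \<noteq> 0"
  proof
    assume "(LINT y|lborel. bump0 (y::'a)) = 0"
    then have "AE y in lborel. bump0 (y::'a) = 0"
      using integral_nonneg_eq_0_iff_AE[OF integrable_bump0] bump0_nonneg by auto
    then have "AE y in lebesgue_on UNIV. bump0 (y::'a) \<in> {0}"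
      unfolding lebesgue_on_UNIV_eq by (intro AE_completion) simp
    then have "bump0 (0::'a) \<in> {0}"
      by (rule AE_lebesgue_on_closed[OF open_UNIV _ smooth_continuous[OF Ck_bump0]]) auto
    then show False using expinv_1(2)[of 1] by (simp add: bump0_def)
  qed
  moreover have "(LINT y|lborel. bump0 (y::'a)) \<ge> 0"
    by (rule integral_nonneg_AE) (simp add: bump0_nonneg)
  ultimately show ?thesis by linarith
qed

lemma bounded_smooth_compact_support:
  fixes \<xi> :: "'a::euclidean_space \<Rightarrow> real"
  assumes "\<And>k. Ck k \<xi>" "\<And>y. \<xi> y \<noteq> 0 \<Longrightarrow> norm y \<le> R"
  obtains D where "D \<ge> 0" "\<And>y h. \<bar>frechet_derivative \<xi> (at y) h\<bar> \<le> D * norm h"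
proof -
  have "\<exists>d. \<forall>y. \<bar>frechet_derivative \<xi> (at y) b\<bar> \<le> d" if "b \<in> Basis" for b
  proof -
    have "compact ((\<lambda>y. frechet_derivative \<xi> (at y) b) ` cball 0 R)"
      by (intro compact_continuous_image smooth_continuous smooth_partial assms that) auto
    then obtain d where d: "\<And>y. y \<in> cball 0 R \<Longrightarrow> \<bar>frechet_derivative \<xi> (at y) b\<bar> \<le> d"
      by (metis (mono_tags, lifting) bounded_iff compact_imp_bounded image_eqI real_norm_def)
    have "\<bar>frechet_derivative \<xi> (at y) b\<bar> \<le> max d 0" for y
    proof (cases "y \<in> cball 0 R")
      case True then show ?thesis using d by fastforce
    next
      case False
      then show ?thesis
        by (subst frechet_derivative_zero_outside_support[of \<xi> "cball 0 R"]) (use assms in auto)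
    qed
    then show ?thesis by blast
  qed
  then obtain d where d: "\<And>b y. b \<in> Basis \<Longrightarrow> \<bar>frechet_derivative \<xi> (at y) b\<bar> \<le> d b" by metis
  show ?thesis
  proof
    show "0 \<le> (\<Sum>b\<in>Basis. \<bar>d b\<bar>)" by (simp add: sum_nonneg)
    fix y h
    have "\<bar>frechet_derivative \<xi> (at y) h\<bar> \<le> (\<Sum>b\<in>Basis. \<bar>(h \<bullet> b) * frechet_derivative \<xi> (at y) b\<bar>)"
      unfolding derivative_Basis_expand[OF assms(1), of y h] by (rule sum_abs)
    also have "\<dots> \<le> (\<Sum>b\<in>Basis. norm h * \<bar>d b\<bar>)"
      by (intro sum_mono) (auto simp: abs_mult Basis_le_norm intro!: mult_mono order_trans[OF d abs_ge_self])
    finally show "\<bar>frechet_derivative \<xi> (at y) h\<bar> \<le> (\<Sum>b\<in>Basis. \<bar>d b\<bar>) * norm h"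
      by (simp add: sum_distrib_left mult.commute)
  qed
qed

lemma lborel_integral_scale:
  fixes f :: "'a::euclidean_space \<Rightarrow> real"
  assumes "c > 0" "f \<in> borel_measurable borel"
  shows "(LINT y|lborel. f y) = c ^ DIM('a) * (LINT y|lborel. f (c *\<^sub>R y))"
proof -
  have "(LINT y|lborel. f y) =
      (LINT y|density (distr lborel borel (\<lambda>x. 0 + c *\<^sub>R x)) (\<lambda>_. ennreal (\<bar>c\<bar>^DIM('a))). f y)"
    using lborel_affine[of c "0::'a"] assms by simp
  also have "\<dots> = (LINT y|distr lborel borel (\<lambda>x. 0 + c *\<^sub>R x). \<bar>c\<bar>^DIM('a) *\<^sub>R f y)"
    by (rule integral_density) (use assms in auto)
  also have "\<dots> = (LINT y|lborel. \<bar>c\<bar>^DIM('a) *\<^sub>R f (c *\<^sub>R y))"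
    by (subst integral_distr) (use assms in auto)
  also have "\<dots> = c ^ DIM('a) * (LINT y|lborel. f (c *\<^sub>R y))" using assms by simp
  finally show ?thesis .
qed

definition is_mollifier :: "real \<Rightarrow> ('a::euclidean_space \<Rightarrow> real) \<Rightarrow> bool" where
  "is_mollifier r \<eta> \<longleftrightarrow> (\<forall>k. Ck k \<eta>) \<and> (\<forall>y. 0 \<le> \<eta> y) \<and> (\<forall>y. \<eta> y \<noteq> 0 \<longrightarrow> norm y \<le> r) \<and>
     (LINT y|lborel. \<eta> y) = 1"

text \<open>Scaled copies of \<open>bump0\<close>. The derivative of a kernel of mass one in a ball
  of radius r has size r^-(n+1); integrated over the ball it leaves 1/r, which the two Lipschitz
  factors of the transport commutator will absorb. It matters that \<open>C\<close> does not depend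
  on \<open>r\<close>.\<close>

lemma ex_mollifier:
  "\<exists>C\<ge>0. \<forall>r>0. \<exists>\<eta>::'a::euclidean_space \<Rightarrow> real. is_mollifier r \<eta> \<and>
     (\<forall>y h. \<bar>frechet_derivative \<eta> (at y) h\<bar> \<le> C / r ^ (DIM('a) + 1) * norm h)"
proof -
  let ?N = "real DIM('a)" and ?n = "DIM('a)"
  obtain D where D: "D \<ge> 0" "\<And>y h. \<bar>frechet_derivative (bump0::'a \<Rightarrow> real) (at y) h\<bar> \<le> D * norm h"
    using bounded_smooth_compact_support[OF Ck_bump0 bump0_support] by metis
  let ?I = "LINT y|lborel. bump0 (y::'a)"
  have I: "?I > 0" by (rule integral_bump0_pos)
  have N: "?N > 0" by simp
  define C where "C = D * ?N ^ (?n + 1) / ?I"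
  have "\<exists>\<eta>::'a \<Rightarrow> real. is_mollifier r \<eta> \<and>
     (\<forall>y h. \<bar>frechet_derivative \<eta> (at y) h\<bar> \<le> C / r ^ (?n + 1) * norm h)" if r: "r > 0" for r
  proof -
    \<comment> \<open>The scale that maps the support radius \<open>DIM('a)\<close> of
      \<open>bump0\<close> to \<open>r\<close>.\<close>
    define s where "s = ?N / r"
    have s: "s > 0" using r N by (simp add: s_def)
    define \<eta> where "\<eta> y = s ^ ?n / ?I * bump0 (s *\<^sub>R y + (0::'a))" for y :: 'a
    have sm: "Ck k \<eta>" for k
      unfolding \<eta>_def[abs_def]
      by (rule Ck_mult[OF Ck_const Ck_affine[OF bounded_linear_scaleR_right Ck_bump0]])
    have pos: "0 \<le> \<eta> y" for y
      unfolding \<eta>_def using s I bump0_nonneg by (intro mult_nonneg_nonneg divide_nonneg_nonneg) auto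
    have supp: "norm y \<le> r" if "\<eta> y \<noteq> 0" for y
    proof -
      have "bump0 (s *\<^sub>R y) \<noteq> 0" using that by (auto simp: \<eta>_def)
      then have "norm (s *\<^sub>R y) \<le> ?N" by (rule bump0_support)
      then show ?thesis using s r N by (simp add: s_def field_simps)
    qed
    have int: "(LINT y|lborel. \<eta> y) = 1"
      using lborel_integral_scale[OF s borel_measurable_continuous_onI[OF smooth_continuous[OF Ck_bump0]]] I s
      by (simp add: \<eta>_def[abs_def])
    have "\<bar>frechet_derivative \<eta> (at y) h\<bar> \<le> C / r ^ (?n + 1) * norm h" for y h
    proof -
      have d: "((\<lambda>y. s *\<^sub>R y + (0::'a)) has_derivative (\<lambda>h. s *\<^sub>R h)) (at y)"
        by (auto intro!: derivative_eq_intros)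
      have "(\<eta> has_derivative (\<lambda>h. s ^ ?n / ?I * frechet_derivative bump0 (at (s *\<^sub>R y + 0)) (s *\<^sub>R h))) (at y)"
        unfolding \<eta>_def[abs_def]
        by (rule has_derivative_mult_right[OF has_derivative_compose[OF d smooth_derivative[OF Ck_bump0]]])
      then have "frechet_derivative \<eta> (at y) h = s ^ ?n / ?I * frechet_derivative bump0 (at (s *\<^sub>R y + 0)) (s *\<^sub>R h)"
        using frechet_derivative_at by metis
      then have "\<bar>frechet_derivative \<eta> (at y) h\<bar> \<le> s ^ ?n / ?I * (D * norm (s *\<^sub>R h))"
        using mult_left_mono[OF D(2)[of "s *\<^sub>R y + 0" "s *\<^sub>R h"], of "s ^ ?n / ?I"] s I
        by (simp add: abs_mult)
      also have "\<dots> = C / r ^ (?n + 1) * norm h"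
        using s r N by (simp add: C_def s_def power_divide field_simps)
      finally show ?thesis .
    qed
    then show ?thesis using sm pos supp int unfolding is_mollifier_def by blast
  qed
  moreover have "C \<ge> 0" using D I by (simp add: C_def)
  ultimately show ?thesis by blast
qed

text \<open>The convolution of \<open>F\<close> with the kernel. \<open>F\<close> has to be given on
  the whole space, which is why functions on the pipe are later extended by projection or by
  zero.\<close>

definition mol :: "('a::euclidean_space \<Rightarrow> real) \<Rightarrow> ('a \<Rightarrow> 'b::euclidean_space) \<Rightarrow> 'a \<Rightarrow> 'b" where
  "mol \<xi> F z = (LINT y|lborel. \<xi> (z - y) *\<^sub>R F y)"

lemma norm_le_of_norm_diff: "norm (z - y) \<le> r \<Longrightarrow> norm y \<le> norm z + r"
  by (metis add.commute add_le_cancel_left dual_order.trans norm_minus_commute norm_triangle_sub)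

lemma integrable_mol:
  fixes F :: "'a::euclidean_space \<Rightarrow> 'b::euclidean_space"
  assumes "continuous_on UNIV \<xi>" "\<And>y. \<xi> y \<noteq> 0 \<Longrightarrow> norm y \<le> r" "continuous_on UNIV F"
  shows "integrable lborel (\<lambda>y. \<xi> (z - y) *\<^sub>R F y)"
proof (rule integrable_continuous_bounded_support[where R="norm z + r"])
  show "continuous_on UNIV (\<lambda>y. \<xi> (z - y) *\<^sub>R F y)"
    by (intro continuous_intros continuous_on_compose2[OF assms(1)] assms(3)) auto
  show "norm y \<le> norm z + r" if "\<xi> (z - y) *\<^sub>R F y \<noteq> 0" for y
    using that assms(2)[of "z - y"] norm_le_of_norm_diff[of z y r] by auto
qed

text \<open>Differentiation under the integral sign with the derivative falling on the kernel, so
  that continuity of \<open>F\<close> is enough.\<close>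

lemma mol_has_derivative:
  fixes F :: "'a::euclidean_space \<Rightarrow> 'b::euclidean_space"
  assumes \<xi>: "\<And>k. Ck k \<xi>" "\<And>y. \<xi> y \<noteq> 0 \<Longrightarrow> norm y \<le> r" and F: "continuous_on UNIV F"
  shows "(mol \<xi> F has_derivative (\<lambda>h. LINT y|lborel. frechet_derivative \<xi> (at (z - y)) h *\<^sub>R F y)) (at z)"
proof -
  obtain a where a: "cball 0 (norm z + 1 + r) \<subseteq> cbox (- a) (a::'a)"
    using bounded_subset_cbox_symmetric[OF bounded_cball] by metis
  \<comment> \<open>The Leibniz rule wants the derivative as a bounded linear map that is jointly
    continuous in both variables; the basis expansion makes this continuity visible.\<close>
  define fx where "fx x y = (\<Sum>b\<in>Basis. frechet_derivative \<xi> (at (x - y)) b *\<^sub>R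
     (blinfun_scaleR_left (F y) o\<^sub>L blinfun_inner_left b))" for x y
  have fx: "blinfun_apply (fx x y) h = frechet_derivative \<xi> (at (x - y)) h *\<^sub>R F y" for x y h
    by (simp add: fx_def blinfun.sum_left blinfun.scaleR_left
        derivative_Basis_expand[OF \<xi>(1), of "x - y" h] scaleR_sum_left mult.commute inner_commute)
  have zero: "y \<in> cbox (-a) a" if "norm (x - y) \<le> r" "x \<in> ball z 1" for x y
  proof -
    have "norm x < norm z + 1" using that(2)
      by (metis add.commute add_less_cancel_left dist_commute dist_norm mem_ball norm_triangle_sub order_le_less_trans)
    with norm_le_of_norm_diff[OF that(1)] have "y \<in> cball 0 (norm z + 1 + r)" by simp
    with a show ?thesis by blast
  qed
  have mol: "integral (cbox (-a) a) (\<lambda>y. \<xi> (x - y) *\<^sub>R F y) = mol \<xi> F x" if "x \<in> ball z 1" for x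
    unfolding mol_def
    by (rule LINT_eq_integral_cbox[symmetric, OF integrable_mol[OF smooth_continuous[OF \<xi>(1)] \<xi>(2) F]])
      (use \<xi>(2) zero that in auto)
  have cfx: "continuous_on A (\<lambda>p. fx (f p) (g p))" if "continuous_on A f" "continuous_on A g"
    for A :: "'d::topological_space set" and f g
    unfolding fx_def
    by (intro continuous_intros continuous_on_smooth_derivative[OF \<xi>(1)] that
        bounded_linear.continuous_on[OF bounded_linear_blinfun_scaleR_left]
        continuous_on_compose2[OF F that(2)]) auto
  have "((\<lambda>x. integral (cbox (-a) a) (\<lambda>y. \<xi> (x - y) *\<^sub>R F y)) has_derivative
      blinfun_apply (integral (cbox (-a) a) (fx z))) (at z within ball z 1)"
  proof (rule leibniz_rule)
    fix x t
    have "((\<lambda>x. \<xi> (x - t)) has_derivative frechet_derivative \<xi> (at (x - t))) (at x)"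
      by (rule has_derivative_compose[of "\<lambda>x. x - t" "\<lambda>h. h", OF _ smooth_derivative[OF \<xi>(1)]])
        (auto intro!: derivative_eq_intros)
    then show "((\<lambda>x. \<xi> (x - t) *\<^sub>R F t) has_derivative blinfun_apply (fx x t)) (at x within ball z 1)"
      unfolding fx[abs_def] by (rule has_derivative_scaleR_left[OF has_derivative_at_withinI])
  next
    fix x
    show "(\<lambda>y. \<xi> (x - y) *\<^sub>R F y) integrable_on cbox (-a) a"
      by (rule integrable_continuous)
        (intro continuous_intros continuous_on_compose2[OF smooth_continuous[OF \<xi>(1)]] continuous_on_subset[OF F]; auto)
  next
    show "continuous_on (ball z 1 \<times> cbox (-a) a) (\<lambda>(x, t). fx x t)"
      unfolding split_beta by (intro cfx continuous_intros)
  qed auto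
  moreover have "blinfun_apply (integral (cbox (-a) a) (fx z)) =
      (\<lambda>h. LINT y|lborel. frechet_derivative \<xi> (at (z - y)) h *\<^sub>R F y)"
  proof
    fix h
    have s: "frechet_derivative \<xi> (at y) h \<noteq> 0 \<Longrightarrow> norm y \<le> r" for y
      using frechet_derivative_zero_outside_support[of \<xi> "cball 0 r" y] \<xi>(2) by force
    have "integral (cbox (-a) a) (\<lambda>y. frechet_derivative \<xi> (at (z - y)) h *\<^sub>R F y) =
       (LINT y|lborel. frechet_derivative \<xi> (at (z - y)) h *\<^sub>R F y)"
    proof (rule LINT_eq_integral_cbox[symmetric])
      show "integrable lborel (\<lambda>y. frechet_derivative \<xi> (at (z - y)) h *\<^sub>R F y)"
        by (rule integrable_mol[OF _ s F]) (intro continuous_on_smooth_derivative[OF \<xi>(1)] continuous_intros)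
      show "y \<in> cbox (-a) a" if "frechet_derivative \<xi> (at (z - y)) h *\<^sub>R F y \<noteq> 0" for y
        using that by (intro zero[OF s, of z]) auto
    qed
    moreover have "fx z integrable_on cbox (-a) a"
      by (intro integrable_continuous cfx continuous_intros)
    ultimately show "blinfun_apply (integral (cbox (-a) a) (fx z)) h =
      (LINT y|lborel. frechet_derivative \<xi> (at (z - y)) h *\<^sub>R F y)"
      by (simp add: blinfun_apply_integral fx)
  qed
  ultimately have "((\<lambda>x. integral (cbox (-a) a) (\<lambda>y. \<xi> (x - y) *\<^sub>R F y)) has_derivative
      (\<lambda>h. LINT y|lborel. frechet_derivative \<xi> (at (z - y)) h *\<^sub>R F y)) (at z)"
    by (simp add: at_within_open[of z "ball z 1"])
  then show ?thesis
    by (rule has_derivative_transform_within_open[OF _ open_ball[of z 1]]) (use mol in auto)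
qed

lemma Ck_mol:
  fixes F :: "'a::euclidean_space \<Rightarrow> 'b::euclidean_space"
  assumes \<xi>: "\<And>k. Ck k \<xi>" "\<And>y. \<xi> y \<noteq> 0 \<Longrightarrow> norm y \<le> r" and F: "continuous_on UNIV F"
  shows "Ck k (mol \<xi> F)"
proof -
  let ?S = "{\<xi>::'a \<Rightarrow> real. (\<forall>k. Ck k \<xi>) \<and> (\<forall>y. \<xi> y \<noteq> 0 \<longrightarrow> norm y \<le> r)}"
  show ?thesis
  proof (rule Ck_coinduct[where F="(\<lambda>\<xi>. mol \<xi> F) ` ?S"])
    show "mol \<xi> F \<in> (\<lambda>\<xi>. mol \<xi> F) ` ?S" using \<xi> by auto
    fix g assume "g \<in> (\<lambda>\<xi>. mol \<xi> F) ` ?S"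
    then obtain \<zeta> where g: "g = mol \<zeta> F" and \<zeta>: "\<And>k. Ck k \<zeta>" "\<And>y. \<zeta> y \<noteq> 0 \<Longrightarrow> norm y \<le> r" by auto
    note D = mol_has_derivative[OF \<zeta> F]
    show "\<forall>x. g differentiable at x" using D g differentiableI by blast
    fix b :: 'a assume b: "b \<in> Basis"
    have e: "(\<lambda>x. frechet_derivative g (at x) b) = mol (\<lambda>y. frechet_derivative \<zeta> (at y) b) F"
    proof
      fix x show "frechet_derivative g (at x) b = mol (\<lambda>y. frechet_derivative \<zeta> (at y) b) F x"
        using fun_cong[OF frechet_derivative_at[OF D[of x]], of b] by (simp add: g mol_def)
    qed
    have "frechet_derivative \<zeta> (at y) b \<noteq> 0 \<Longrightarrow> norm y \<le> r" for y
      using frechet_derivative_zero_outside_support[of \<zeta> "cball 0 r" y] \<zeta>(2) by force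
    then show "(\<lambda>x. frechet_derivative g (at x) b) \<in> (\<lambda>\<xi>. mol \<xi> F) ` ?S"
      unfolding e using smooth_partial[OF \<zeta>(1) b] by blast
  qed
qed


section \<open>Transport along curves\<close>

lemma integral_norm_bound_integral_ae:
  fixes f :: "'a \<Rightarrow> 'b::{banach, second_countable_topology}"
  assumes "integrable M f" "integrable M g" "AE x in M. norm (f x) \<le> g x"
  shows "norm (LINT x|M. f x) \<le> (LINT x|M. g x)"
  using integral_norm_bound[of M f] integral_mono_AE[OF integrable_norm[OF assms(1)] assms(2,3)]
  by (rule order_trans)

lemma lborel_integral_reflect:
  fixes f :: "'a::euclidean_space \<Rightarrow> 'b::euclidean_space"
  assumes "f \<in> borel_measurable borel"
  shows "(LINT y|lborel. f (z - y)) = (LINT y|lborel. f y)"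
proof -
  have "(LINT y|lborel. f y) =
      (LINT y|density (distr lborel borel (\<lambda>x. z + (-1) *\<^sub>R x)) (\<lambda>_. ennreal (\<bar>-1\<bar>^DIM('a))). f y)"
    using lborel_affine[of "-1" z] by simp
  also have "\<dots> = (LINT y|distr lborel borel (\<lambda>x. z + (-1) *\<^sub>R x). f y)"
    by (simp add: density_1)
  also have "\<dots> = (LINT y|lborel. f (z + (-1) *\<^sub>R y))"
    by (rule integral_distr) (use assms in auto)
  finally show ?thesis by simp
qed

lemma lborel_integral_translate:
  fixes f :: "'a::euclidean_space \<Rightarrow> 'b::euclidean_space"
  assumes "f \<in> borel_measurable borel"
  shows "(LINT y|lborel. f (z + y)) = (LINT y|lborel. f y)"
proof -
  have "(LINT y|lborel. f y) =
      (LINT y|density (distr lborel borel (\<lambda>x. z + 1 *\<^sub>R x)) (\<lambda>_. ennreal (\<bar>1\<bar>^DIM('a))). f y)"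
    using lborel_affine[of 1 z] by simp
  also have "\<dots> = (LINT y|distr lborel borel (\<lambda>x. z + 1 *\<^sub>R x). f y)"
    by (simp add: density_1)
  also have "\<dots> = (LINT y|lborel. f (z + 1 *\<^sub>R y))"
    by (rule integral_distr) (use assms in auto)
  finally show ?thesis by simp
qed

lemma is_mollifierD:
  assumes "is_mollifier r \<eta>"
  shows "Ck k \<eta>" "0 \<le> \<eta> y" "\<eta> y \<noteq> 0 \<Longrightarrow> norm y \<le> r" "(LINT y|lborel. \<eta> y) = 1"
    "integrable lborel (\<lambda>y. \<eta> (z - y))" "(LINT y|lborel. \<eta> (z - y)) = 1" "continuous_on A \<eta>"
proof -
  show "Ck k \<eta>" for k using assms by (simp add: is_mollifier_def)
  note c = smooth_continuous[OF this]
  show "continuous_on A \<eta>" by (rule c)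
  show "0 \<le> \<eta> y" "(LINT y|lborel. \<eta> y) = 1" using assms by (auto simp: is_mollifier_def)
  show n: "\<eta> y \<noteq> 0 \<Longrightarrow> norm y \<le> r" for y using assms by (auto simp: is_mollifier_def)
  show "(LINT y|lborel. \<eta> (z - y)) = 1"
    using assms lborel_integral_reflect[of \<eta> z] borel_measurable_continuous_onI[OF c]
    by (auto simp: is_mollifier_def)
  show "integrable lborel (\<lambda>y. \<eta> (z - y))"
    using integrable_mol[OF c n, of "\<lambda>_. 1::real"] by simp
qed

text \<open>The kernel is a probability density, so averaging values within \<open>e\<close> of
  \<open>p\<close> stays within \<open>e\<close> of \<open>p\<close>. No continuity of
  \<open>g\<close> enters: it will also be applied to a Jacobian that jumps at the boundary.\<close>

lemma mollifier_average_close: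
  fixes g :: "'a::euclidean_space \<Rightarrow> 'b::euclidean_space"
  assumes \<eta>: "is_mollifier r \<eta>" and i: "integrable lborel (\<lambda>y. \<eta> (z - y) *\<^sub>R g y)"
    and e: "\<And>y. norm (z - y) \<le> r \<Longrightarrow> norm (g y - p) \<le> e"
  shows "norm ((LINT y|lborel. \<eta> (z - y) *\<^sub>R g y) - p) \<le> e"
proof -
  note d = is_mollifierD[OF \<eta>]
  have i2: "integrable lborel (\<lambda>y. \<eta> (z - y) *\<^sub>R p)" using d(5) by simp
  have "p = (LINT y|lborel. \<eta> (z - y) *\<^sub>R p)"
    using d(6)[of z] d(5)[of z] by simp
  then have "(LINT y|lborel. \<eta> (z - y) *\<^sub>R g y) - p = (LINT y|lborel. \<eta> (z - y) *\<^sub>R g y - \<eta> (z - y) *\<^sub>R p)"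
    using Bochner_Integration.integral_diff[OF i i2] by simp
  also have "norm \<dots> \<le> (LINT y|lborel. \<eta> (z - y) * e)"
  proof (rule Bochner_Integration.integral_norm_bound_integral)
    show "integrable lborel (\<lambda>y. \<eta> (z - y) *\<^sub>R g y - \<eta> (z - y) *\<^sub>R p)"
      using i i2 by (rule Bochner_Integration.integrable_diff)
    show "integrable lborel (\<lambda>y. \<eta> (z - y) * e)" using d(5) by simp
    show "norm (\<eta> (z - y) *\<^sub>R g y - \<eta> (z - y) *\<^sub>R p) \<le> \<eta> (z - y) * e" for y
    proof (cases "\<eta> (z - y) = 0")
      case False
      then show ?thesis
        using e[OF d(3)[OF False]] d(2)[of "z - y"]
        by (simp add: scaleR_diff_right[symmetric] mult_left_mono)
    qed simp
  qed
  also have "\<dots> = e" using d(6)[of z] d(5)[of z] by simp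
  finally show ?thesis .
qed

lemma mol_close:
  fixes F :: "'a::euclidean_space \<Rightarrow> 'b::euclidean_space"
  assumes \<eta>: "is_mollifier r \<eta>" and F: "continuous_on UNIV F"
    and e: "\<And>y. norm (z - y) \<le> r \<Longrightarrow> norm (F y - p) \<le> e"
  shows "norm (mol \<eta> F z - p) \<le> e"
  unfolding mol_def
  by (rule mollifier_average_close[OF \<eta> integrable_mol[OF is_mollifierD(7,3)[OF \<eta>] F] e])

lemma test_functionsI:
  assumes "\<And>k. Ck k \<phi>" "compact C" "C \<subseteq> S" "\<And>y. \<phi> y \<noteq> 0 \<Longrightarrow> y \<in> C"
  shows "\<phi> \<in> test_functions S"
proof -
  have "closure (support_on UNIV \<phi>) \<subseteq> C"
    by (rule closure_minimal) (use assms in \<open>auto simp: support_on_def compact_imp_closed\<close>)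
  moreover from this have "compact (closure (support_on UNIV \<phi>))"
    using assms(2) by (metis closed_closure compact_Int_closed inf.absorb_iff2)
  ultimately show ?thesis using assms by (auto simp: test_functions_def)
qed

lemma mollifier_test_function:
  assumes \<eta>: "is_mollifier r (\<eta>::'a::euclidean_space \<Rightarrow> real)" and "cball z r \<subseteq> S"
  shows "(\<lambda>y. \<eta> (z - y)) \<in> test_functions S"
    "frechet_derivative (\<lambda>y. \<eta> (z - y)) (at y) h = - frechet_derivative \<eta> (at (z - y)) h"
proof -
  note d = is_mollifierD[OF \<eta>]
  show "(\<lambda>y. \<eta> (z - y)) \<in> test_functions S"
  proof (rule test_functionsI[where C="cball z r"])
    show "Ck k (\<lambda>y. \<eta> (z - y))" for k
      using Ck_affine[OF bounded_linear_minus[OF bounded_linear_ident] d(1), of k z] by simp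
    show "y \<in> cball z r" if "\<eta> (z - y) \<noteq> 0" for y
      using d(3)[OF that] by (simp add: dist_norm)
  qed (use assms in auto)
  have "((\<lambda>y. \<eta> (z - y)) has_derivative (\<lambda>h. frechet_derivative \<eta> (at (z - y)) (- h))) (at y)"
    by (rule has_derivative_compose[of "\<lambda>y. z - y" "\<lambda>h. - h", OF _ smooth_derivative[OF d(1)]])
      (auto intro!: derivative_eq_intros)
  from frechet_derivative_at[OF this]
  have "frechet_derivative (\<lambda>y. \<eta> (z - y)) (at y) h = frechet_derivative \<eta> (at (z - y)) (- h)" by metis
  also have "\<dots> = - frechet_derivative \<eta> (at (z - y)) h"
    using has_derivative_linear[OF smooth_derivative[OF d(1)]] by (simp add: linear_neg)
  finally show "frechet_derivative (\<lambda>y. \<eta> (z - y)) (at y) h = - frechet_derivative \<eta> (at (z - y)) h" .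
qed

lemma LINT_lebesgue_on_eq_lborel:
  fixes g :: "'a::euclidean_space \<Rightarrow> 'b::euclidean_space"
  assumes "open S" "g \<in> borel_measurable borel" "\<And>y. g y \<noteq> 0 \<Longrightarrow> y \<in> S"
  shows "(LINT y|lebesgue_on S. g y) = (LINT y|lborel. g y)"
proof -
  have "(LINT y|lebesgue_on S. g y) = (LINT y|lebesgue. indicator S y *\<^sub>R g y)"
    using assms(1) by (subst integral_restrict_space) auto
  also have "(\<lambda>y. indicator S y *\<^sub>R g y) = g" using assms(3) by (auto simp: indicator_def fun_eq_iff)
  also have "(LINT y|lebesgue. g y) = (LINT y|lborel. g y)"
    by (rule integral_completion) (use assms in auto)
  finally show ?thesis .
qed

lemma borel_measurable_lebesgue_on_continuous:
  fixes g :: "'a::euclidean_space \<Rightarrow> 'b::euclidean_space"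
  assumes "continuous_on UNIV g"
  shows "g \<in> borel_measurable (lebesgue_on S)"
  using assms borel_measurable_continuous_onI measurable_completion measurable_lborel2 measurable_restrict_space1
  by metis

section \<open>Weak gradients and Lipschitz continuity\<close>

lemma integrable_locally_inner:
  fixes G \<psi> :: "'a::euclidean_space \<Rightarrow> 'b::euclidean_space"
  assumes "open S" "locally_integrable_on G S" "compact C" "C \<subseteq> S" "continuous_on UNIV \<psi>"
    "\<And>y. \<psi> y \<noteq> 0 \<Longrightarrow> y \<in> C"
  shows "integrable (lebesgue_on S) (\<lambda>y. G y \<bullet> \<psi> y)"
proof -
  have i: "integrable lebesgue (\<lambda>y. indicator C y *\<^sub>R G y)"
    using assms(2,3,4) by (auto simp: locally_integrable_on_def set_integrable_def)
  obtain B where B: "\<And>y. y \<in> C \<Longrightarrow> norm (\<psi> y) \<le> B"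
    using compact_imp_bounded[OF compact_continuous_image[OF continuous_on_subset[OF assms(5) subset_UNIV] assms(3)]]
    by (auto simp: bounded_iff)
  have B': "norm (\<psi> y) \<le> max B 0" for y
    using B[of y] assms(6)[of y] by (cases "\<psi> y = 0") auto
  have m: "\<psi> \<in> borel_measurable lebesgue"
    using borel_measurable_lebesgue_on_continuous[OF assms(5), of UNIV] by (simp add: lebesgue_on_UNIV_eq)
  have "integrable lebesgue (\<lambda>y. (indicator C y *\<^sub>R G y) \<bullet> \<psi> y)"
  proof (rule Bochner_Integration.integrable_bound)
    show "integrable lebesgue (\<lambda>y. norm (indicator C y *\<^sub>R G y) * max B 0)"
      using i by (intro integrable_mult_left integrable_norm)
    show "(\<lambda>y. (indicator C y *\<^sub>R G y) \<bullet> \<psi> y) \<in> borel_measurable lebesgue"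
      using i m by (intro borel_measurable_inner) auto
    show "AE y in lebesgue. norm ((indicator C y *\<^sub>R G y) \<bullet> \<psi> y)
        \<le> norm (norm (indicator C y *\<^sub>R G y) * max B 0)"
    proof (intro AE_I2)
      fix y
      have "norm ((indicator C y *\<^sub>R G y) \<bullet> \<psi> y) \<le> norm (indicator C y *\<^sub>R G y) * norm (\<psi> y)"
        by (simp only: real_norm_def Cauchy_Schwarz_ineq2)
      also have "\<dots> \<le> norm (indicator C y *\<^sub>R G y) * max B 0"
        by (intro mult_left_mono B') auto
      also have "\<dots> \<le> norm (norm (indicator C y *\<^sub>R G y) * max B 0)"
        by (simp only: real_norm_def abs_ge_self)
      finally show "norm ((indicator C y *\<^sub>R G y) \<bullet> \<psi> y)
        \<le> norm (norm (indicator C y *\<^sub>R G y) * max B 0)" .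
    qed
  qed
  moreover have "(\<lambda>y. (indicator C y *\<^sub>R G y) \<bullet> \<psi> y) = (\<lambda>y. indicator S y *\<^sub>R (G y \<bullet> \<psi> y))"
  proof
    fix y show "(indicator C y *\<^sub>R G y) \<bullet> \<psi> y = indicator S y *\<^sub>R (G y \<bullet> \<psi> y)"
      using assms(4) assms(6)[of y] by (cases "\<psi> y = 0") auto
  qed
  ultimately show ?thesis
    using assms(1) by (subst integrable_restrict_space) auto
qed

text \<open>As long as its ball stays in \<open>S\<close>, the reflected kernel is an admissible
  test function. The derivative of the mollified \<open>F\<close> is therefore the average of
  \<open>G\<close> against a probability density and inherits the essential bound of
  \<open>G\<close>.\<close>

lemma weak_gradient_mol_bound:
  fixes f F :: "'a::euclidean_space \<Rightarrow> real"
  assumes S: "open S" and w: "is_weak_gradient S f G" and l: "AE x in lebesgue_on S. norm (G x) \<le> l"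
    and fm: "f \<in> borel_measurable (lebesgue_on S)"
    and F: "continuous_on UNIV F" and fF: "AE x in lebesgue_on S. f x = F x"
    and \<eta>: "is_mollifier r \<eta>" and z: "cball z r \<subseteq> S"
  shows "\<bar>LINT y|lborel. frechet_derivative \<eta> (at (z - y)) h *\<^sub>R F y\<bar> \<le> l * norm h"
proof -
  note d = is_mollifierD[OF \<eta>]
  let ?\<phi> = "\<lambda>y. \<eta> (z - y)"
  note t = mollifier_test_function[OF \<eta> z]
  have zS: "y \<in> cball z r" if "norm (z - y) \<le> r" for y using that by (simp add: dist_norm)
  have s: "frechet_derivative \<eta> (at y) b \<noteq> 0 \<Longrightarrow> norm y \<le> r" for y b
    using frechet_derivative_zero_outside_support[of \<eta> "cball 0 r" y] d(3) by force
  have cD: "continuous_on UNIV (\<lambda>y. frechet_derivative \<eta> (at (z - y)) b)" for b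
    by (intro continuous_on_smooth_derivative[OF d(1)] continuous_intros)
  have ib: "integrable lborel (\<lambda>y. frechet_derivative \<eta> (at (z - y)) b *\<^sub>R F y)" for b
    by (rule integrable_mol[OF _ s F]) (intro continuous_on_smooth_derivative[OF d(1)] continuous_intros)
  have iG: "integrable (lebesgue_on S) (\<lambda>y. G y \<bullet> (?\<phi> y *\<^sub>R b))" for b
  proof (rule integrable_locally_inner[OF S _ compact_cball z])
    show "locally_integrable_on G S" using w by (simp add: is_weak_gradient_def)
    show "continuous_on UNIV (\<lambda>y. ?\<phi> y *\<^sub>R b)"
      by (intro continuous_intros continuous_on_compose2[OF d(7)]) auto
    show "y \<in> cball z r" if "?\<phi> y *\<^sub>R b \<noteq> 0" for y using that by (intro zS d(3)) auto
  qed
  have bb: "(LINT y|lborel. frechet_derivative \<eta> (at (z - y)) b *\<^sub>R F y) =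
      (LINT y|lebesgue_on S. G y \<bullet> (?\<phi> y *\<^sub>R b))" if "b \<in> Basis" for b
  proof -
    have "(LINT y|lborel. frechet_derivative \<eta> (at (z - y)) b *\<^sub>R F y) =
        (LINT y|lebesgue_on S. frechet_derivative \<eta> (at (z - y)) b *\<^sub>R F y)"
      by (rule LINT_lebesgue_on_eq_lborel[symmetric, OF S])
        (use ib s zS z in \<open>auto simp: borel_measurable_integrable dest!: s\<close>)
    also have "\<dots> = (LINT y|lebesgue_on S. f y * frechet_derivative \<eta> (at (z - y)) b)"
    proof (rule integral_cong_AE)
      show "(\<lambda>y. frechet_derivative \<eta> (at (z - y)) b *\<^sub>R F y) \<in> borel_measurable (lebesgue_on S)"
        by (intro borel_measurable_lebesgue_on_continuous continuous_intros cD F)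
      show "(\<lambda>y. f y * frechet_derivative \<eta> (at (z - y)) b) \<in> borel_measurable (lebesgue_on S)"
        by (intro borel_measurable_times fm borel_measurable_lebesgue_on_continuous cD)
      show "AE y in lebesgue_on S. frechet_derivative \<eta> (at (z - y)) b *\<^sub>R F y = f y * frechet_derivative \<eta> (at (z - y)) b"
        using fF by eventually_elim simp
    qed
    also have "\<dots> = - (LINT y|lebesgue_on S. f y * frechet_derivative ?\<phi> (at y) b)"
      by (simp add: t(2))
    also have "\<dots> = (LINT y|lebesgue_on S. (G y \<bullet> b) * ?\<phi> y)"
      using w t(1) that by (simp add: is_weak_gradient_def)
    finally show ?thesis by (simp add: mult.commute)
  qed
  have "(LINT y|lborel. frechet_derivative \<eta> (at (z - y)) h *\<^sub>R F y) =
      (LINT y|lborel. (\<Sum>b\<in>Basis. (h \<bullet> b) *\<^sub>R (frechet_derivative \<eta> (at (z - y)) b *\<^sub>R F y)))"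
    by (subst derivative_Basis_expand[OF d(1), of _ h]) (simp add: sum_distrib_right mult.assoc)
  also have "\<dots> = (\<Sum>b\<in>Basis. (h \<bullet> b) *\<^sub>R (LINT y|lborel. frechet_derivative \<eta> (at (z - y)) b *\<^sub>R F y))"
    by (subst Bochner_Integration.integral_sum) (use ib in auto)
  also have "\<dots> = (\<Sum>b\<in>Basis. (h \<bullet> b) *\<^sub>R (LINT y|lebesgue_on S. G y \<bullet> (?\<phi> y *\<^sub>R b)))"
    by (rule sum.cong[OF refl]) (simp only: bb)
  also have "\<dots> = (LINT y|lebesgue_on S. (\<Sum>b\<in>Basis. (h \<bullet> b) *\<^sub>R (G y \<bullet> (?\<phi> y *\<^sub>R b))))"
    by (subst Bochner_Integration.integral_sum) (use iG in auto)
  also have "\<dots> = (LINT y|lebesgue_on S. G y \<bullet> (?\<phi> y *\<^sub>R h))"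
  proof (rule Bochner_Integration.integral_cong[OF refl])
    fix y
    have "G y \<bullet> (?\<phi> y *\<^sub>R h) = ?\<phi> y * (\<Sum>b\<in>Basis. (G y \<bullet> b) * (h \<bullet> b))"
      by (simp add: euclidean_inner[of "G y" h])
    then show "(\<Sum>b\<in>Basis. (h \<bullet> b) *\<^sub>R (G y \<bullet> (?\<phi> y *\<^sub>R b))) = G y \<bullet> (?\<phi> y *\<^sub>R h)"
      by (simp add: sum_distrib_left mult_ac)
  qed
  finally have e: "(LINT y|lborel. frechet_derivative \<eta> (at (z - y)) h *\<^sub>R F y) =
    (LINT y|lebesgue_on S. G y \<bullet> (?\<phi> y *\<^sub>R h))" .
  have int1: "(LINT y|lebesgue_on S. ?\<phi> y) = 1"
  proof -
    have "(LINT y|lebesgue_on S. ?\<phi> y) = (LINT y|lborel. ?\<phi> y)"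
    proof (rule LINT_lebesgue_on_eq_lborel[OF S])
      show "?\<phi> \<in> borel_measurable borel"
        using borel_measurable_integrable[OF d(5)[of z]] by simp
      show "y \<in> S" if "?\<phi> y \<noteq> 0" for y
        using zS[OF d(3)[OF that]] z by blast
    qed
    then show ?thesis using d(6) by simp
  qed
  \<comment> \<open>A non-integrable function would have integral 0 by convention, so the value 1
    already proves integrability.\<close>
  have "integrable (lebesgue_on S) ?\<phi>"
    using int1 not_integrable_integral_eq by fastforce
  then have "\<bar>LINT y|lebesgue_on S. G y \<bullet> (?\<phi> y *\<^sub>R h)\<bar> \<le> (LINT y|lebesgue_on S. (l * norm h) * ?\<phi> y)"
    unfolding real_norm_def[symmetric]
  proof (intro integral_norm_bound_integral_ae iG integrable_mult_right)
    show "AE y in lebesgue_on S. norm (G y \<bullet> (?\<phi> y *\<^sub>R h)) \<le> l * norm h * ?\<phi> y"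
      using l
    proof eventually_elim
      fix y assume "norm (G y) \<le> l"
      have "norm (G y \<bullet> (?\<phi> y *\<^sub>R h)) \<le> norm (G y) * norm (?\<phi> y *\<^sub>R h)"
        by (simp only: real_norm_def Cauchy_Schwarz_ineq2)
      also have "\<dots> \<le> l * norm (?\<phi> y *\<^sub>R h)" using \<open>norm (G y) \<le> l\<close> by (intro mult_right_mono) auto
      also have "\<dots> = l * norm h * ?\<phi> y" using d(2)[of "z - y"] by simp
      finally show "norm (G y \<bullet> (?\<phi> y *\<^sub>R h)) \<le> l * norm h * ?\<phi> y" .
    qed
  qed
  also have "\<dots> = l * norm h" using int1 by simp
  finally show ?thesis unfolding e .
qed

text \<open>By compactness the segment between two points keeps a positive distance from the
  boundary. Mollified at a smaller radius, \<open>F\<close> has gradient at most \<open>l\<close>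
  along the segment, and at the two end points it is changed as little as desired.\<close>

lemma lipschitz_of_weak_gradient:
  fixes f F :: "'a::euclidean_space \<Rightarrow> real"
  assumes S: "open S" "convex S" and w: "is_weak_gradient S f G"
    and l: "AE x in lebesgue_on S. norm (G x) \<le> l" "0 \<le> l"
    and fm: "f \<in> borel_measurable (lebesgue_on S)"
    and F: "continuous_on UNIV F" and fF: "AE x in lebesgue_on S. f x = F x"
  shows "l-lipschitz_on S F"
proof (rule lipschitz_onI)
  show "0 \<le> l" by fact
  fix x0 x1 assume x: "x0 \<in> S" "x1 \<in> S"
  let ?I = "closed_segment x0 x1"
  have IS: "?I \<subseteq> S" using x S(2) by (simp add: closed_segment_subset)
  obtain d where d: "d > 0" "(\<Union>z\<in>?I. cball z d) \<subseteq> S"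
    using compact_subset_open_imp_cball_epsilon_subset[OF compact_segment S(1) IS] by metis
  have "dist (F x0) (F x1) \<le> l * dist x0 x1 + e" if e: "e > 0" for e
  proof -
    obtain d0 where d0: "d0 > 0" "\<And>y. norm (x0 - y) < d0 \<Longrightarrow> norm (F y - F x0) < e / 2"
      using F e by (metis UNIV_I continuous_on_iff dist_commute dist_norm half_gt_zero)
    obtain d1 where d1: "d1 > 0" "\<And>y. norm (x1 - y) < d1 \<Longrightarrow> norm (F y - F x1) < e / 2"
      using F e by (metis UNIV_I continuous_on_iff dist_commute dist_norm half_gt_zero)
    define r where "r = min d (min d0 d1) / 2"
    have r: "r > 0" "r \<le> d" "r < d0" "r < d1" using d d0 d1 by (auto simp: r_def)
    obtain \<eta> :: "'a \<Rightarrow> real" where \<eta>: "is_mollifier r \<eta>" using ex_mollifier r(1) by metis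
    note D = mol_has_derivative[OF is_mollifierD(1)[OF \<eta>] is_mollifierD(3)[OF \<eta>] F]
    have "norm (mol \<eta> F x1 - mol \<eta> F x0) \<le> l * norm (x1 - x0)"
    proof (rule differentiable_bound[of ?I])
      fix z assume z: "z \<in> ?I"
      show "(mol \<eta> F has_derivative (\<lambda>h. LINT y|lborel. frechet_derivative \<eta> (at (z - y)) h *\<^sub>R F y)) (at z within ?I)"
        using D by (rule has_derivative_at_withinI)
      have "cball z r \<subseteq> S"
        using d(2) z r(2) subset_cball[of r d z] by blast
      then show "onorm (\<lambda>h. LINT y|lborel. frechet_derivative \<eta> (at (z - y)) h *\<^sub>R F y) \<le> l"
        using weak_gradient_mol_bound[OF S(1) w l(1) fm F fF \<eta>] l(2)
        by (intro onorm_le) (simp only: real_norm_def)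
    qed auto
    moreover have "norm (mol \<eta> F x0 - F x0) \<le> e / 2"
      by (rule mol_close[OF \<eta> F]) (rule less_imp_le[OF d0(2)], use r in simp)
    moreover have "norm (mol \<eta> F x1 - F x1) \<le> e / 2"
      by (rule mol_close[OF \<eta> F]) (rule less_imp_le[OF d1(2)], use r in simp)
    ultimately show ?thesis
      unfolding dist_norm norm_minus_commute[of x0] real_norm_def by linarith
  qed
  then show "dist (F x0) (F x1) \<le> l * dist x0 x1" by (rule field_le_epsilon)
qed


text \<open>Integration by parts in one direction. Moving the centre along \<open>b\<close> and
  translating the integration variable shows that the mollification has the same slope along
  \<open>b\<close> as \<open>c\<close>; two expressions for one derivative are compared, and
  \<open>c\<close> itself need only be continuous.\<close>

lemma derivative_mol_direction:
  fixes c :: "'a::euclidean_space \<Rightarrow> real"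
  assumes \<eta>: "is_mollifier r \<eta>" and c: "continuous_on UNIV c"
    and b: "\<And>y t. c (y + t *\<^sub>R b) = c y + t * \<kappa>"
  shows "(LINT y|lborel. frechet_derivative \<eta> (at (z - y)) b *\<^sub>R c y) = \<kappa>"
proof -
  note d = is_mollifierD[OF \<eta>]
  let ?D = "\<lambda>h. LINT y|lborel. frechet_derivative \<eta> (at (z - y)) h *\<^sub>R c y"
  have shift: "mol \<eta> c (z + t *\<^sub>R b) = mol \<eta> c z + t * \<kappa>" for t
  proof -
    let ?g = "\<lambda>y. \<eta> (z + t *\<^sub>R b - y) *\<^sub>R c y"
    have i: "integrable lborel (\<lambda>y. \<eta> (z - y) *\<^sub>R c y)" "integrable lborel ?g"
      using integrable_mol[OF d(7) d(3) c, of z] integrable_mol[OF d(7) d(3) c, of "z + t *\<^sub>R b"] by auto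
    have "mol \<eta> c (z + t *\<^sub>R b) = (LINT y|lborel. ?g (t *\<^sub>R b + y))"
      unfolding mol_def
      by (rule lborel_integral_translate[symmetric]) (use i(2) in \<open>simp add: borel_measurable_integrable\<close>)
    also have "\<dots> = (LINT y|lborel. \<eta> (z - y) *\<^sub>R c y + (t * \<kappa>) * \<eta> (z - y))"
      by (simp add: b add.commute[of "t *\<^sub>R b"] algebra_simps)
    also have "\<dots> = mol \<eta> c z + t * \<kappa>"
      unfolding mol_def using i(1) d(5,6)[of z] by simp
    finally show ?thesis .
  qed
  have l: "((\<lambda>t. z + t *\<^sub>R b) has_derivative (\<lambda>t. t *\<^sub>R b)) (at (0::real))"
    by (auto intro!: derivative_eq_intros)
  have "(mol \<eta> c has_derivative ?D) (at (z + 0 *\<^sub>R b))"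
    using mol_has_derivative[OF d(1) d(3) c] by simp
  from has_derivative_compose[OF l this]
  have "((\<lambda>t. mol \<eta> c (z + t *\<^sub>R b)) has_derivative (\<lambda>t. ?D (t *\<^sub>R b))) (at 0)" .
  moreover have "((\<lambda>t. mol \<eta> c (z + t *\<^sub>R b)) has_derivative (\<lambda>t. t * \<kappa>)) (at 0)"
    unfolding shift by (auto intro!: derivative_eq_intros)
  ultimately have "(\<lambda>t. ?D (t *\<^sub>R b)) = (\<lambda>t. t * \<kappa>)"
    by (rule has_derivative_unique)
  from fun_cong[OF this, of 1] show ?thesis by simp
qed

text \<open>The divergence of \<open>h\<close> tested with a mollifier. The field is only
  continuous, but each component is affine along its own axis, and this is all that the divergence
  sees. The Vlasov field has this structure: v does not depend on x, and u(x) - v is affine in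
  v.\<close>

lemma integral_derivative_mollifier_field:
  fixes h :: "'a::euclidean_space \<Rightarrow> 'a"
  assumes \<eta>: "is_mollifier r \<eta>" and h: "continuous_on UNIV h"
    and b: "\<And>b y t. b \<in> Basis \<Longrightarrow> h (y + t *\<^sub>R b) \<bullet> b = h y \<bullet> b + t * \<kappa> b"
  shows "(LINT y|lborel. frechet_derivative \<eta> (at (z - y)) (h y)) = (\<Sum>b\<in>Basis. \<kappa> b)"
proof -
  note d = is_mollifierD[OF \<eta>]
  have s: "frechet_derivative \<eta> (at y) b \<noteq> 0 \<Longrightarrow> norm y \<le> r" for y b
    using frechet_derivative_zero_outside_support[of \<eta> "cball 0 r" y] d(3) by force
  have c: "continuous_on UNIV (\<lambda>y. h y \<bullet> b)" for b
    by (intro continuous_intros h)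
  have i: "integrable lborel (\<lambda>y. frechet_derivative \<eta> (at (z - y)) b *\<^sub>R (h y \<bullet> b))" for b
    by (rule integrable_mol[OF _ s c]) (intro continuous_on_smooth_derivative[OF d(1)] continuous_intros)
  have "(LINT y|lborel. frechet_derivative \<eta> (at (z - y)) (h y)) =
      (LINT y|lborel. (\<Sum>b\<in>Basis. frechet_derivative \<eta> (at (z - y)) b *\<^sub>R (h y \<bullet> b)))"
    by (subst derivative_Basis_expand[OF d(1), of _ "h _"]) (simp add: mult.commute)
  also have "\<dots> = (\<Sum>b\<in>Basis. LINT y|lborel. frechet_derivative \<eta> (at (z - y)) b *\<^sub>R (h y \<bullet> b))"
    by (rule Bochner_Integration.integral_sum) (rule i)
  also have "\<dots> = (\<Sum>b\<in>Basis. \<kappa> b)"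
    by (rule sum.cong[OF refl], rule derivative_mol_direction[OF \<eta> c b])
  finally show ?thesis .
qed

text \<open>The equation is tested with a mollifier centred at the moving point. As \<open>F\<close> and the field \<open>A\<close> are
  Lipschitz, the commutator contributes \<open>O(r)\<close>, and the field may differ from the speed of the curve:
  the difference is only multiplied by the Lipschitz constant of \<open>F\<close>. The constant \<open>- K\<close> is the divergence
  of \<open>A\<close>.\<close>

lemma transport_along_curve:
  fixes F :: "'a::euclidean_space \<Rightarrow> real" and A :: "'a \<Rightarrow> 'a" and Z Q :: "real \<Rightarrow> 'a"
  assumes S: "open S"
    and weak: "\<And>\<phi>. \<phi> \<in> test_functions S \<Longrightarrow> (LINT y|lborel. F y * frechet_derivative \<phi> (at y) (A y)) = 0"
    and F: "continuous_on UNIV F" "l-lipschitz_on S F"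
    and Fmol: "\<And>r \<eta> z h. is_mollifier r \<eta> \<Longrightarrow> cball z r \<subseteq> S \<Longrightarrow>
        \<bar>LINT y|lborel. frechet_derivative \<eta> (at (z - y)) h *\<^sub>R F y\<bar> \<le> l * norm h"
    and A: "continuous_on UNIV A" "M-lipschitz_on S A"
    and div: "\<And>b y t. b \<in> Basis \<Longrightarrow> A (y + t *\<^sub>R b) \<bullet> b = A y \<bullet> b - t * \<kappa> b"
    and \<kappa>: "(\<Sum>b\<in>Basis. \<kappa> b) = K" "0 \<le> K"
    and ab: "a \<le> b" and ZS: "\<And>t. t \<in> {a..b} \<Longrightarrow> Z t \<in> S"
    and Z: "\<And>t. t \<in> {a..b} \<Longrightarrow> (Z has_vector_derivative Q t) (at t within {a..b})"
    and k: "\<And>t. t \<in> {a..b} \<Longrightarrow> norm (Q t - A (Z t)) \<le> k t"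
    and B: "\<And>t. t \<in> {a..b} \<Longrightarrow> (B has_vector_derivative k t) (at t within {a..b})"
  shows "\<bar>exp (- K * b) * F (Z b) - exp (- K * a) * F (Z a)\<bar> \<le> exp (- K * a) * (l * (B b - B a))"
proof (cases "a = b")
  case False
  then have ab: "a < b" using ab by simp
  let ?n = "DIM('a)"
  have l: "l \<ge> 0" and M: "M \<ge> 0" using F(2) A(2) lipschitz_on_nonneg by blast+
  have cZ: "continuous_on {a..b} Z"
    using Z by (meson continuous_on_eq_continuous_within has_vector_derivative_continuous)
  have "compact (Z ` {a..b})" by (intro compact_continuous_image cZ) auto
  then obtain d where d: "d > 0" "(\<Union>z\<in>Z ` {a..b}. cball z d) \<subseteq> S"
    using compact_subset_open_imp_cball_epsilon_subset[OF _ S, of "Z ` {a..b}"] ZS by blast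
  obtain C where C: "C \<ge> 0" "\<And>r. r > 0 \<Longrightarrow> \<exists>\<eta>::'a \<Rightarrow> real. is_mollifier r \<eta> \<and>
     (\<forall>y h. \<bar>frechet_derivative \<eta> (at y) h\<bar> \<le> C / r ^ (?n + 1) * norm h)"
    using ex_mollifier by blast
  define V where "V = unit_ball_vol (real ?n)"
  have V: "V \<ge> 0" by (simp add: V_def)
  \<comment> \<open>\<open>E\<close> collects the errors of order r in the derivative: the
    commutator, and the replacement of the mollified value by \<open>F\<close> in the divergence
    term. \<open>E'\<close> adds the replacement of the mollified values at the two end
    points.\<close>
  define E where "E = C * V * l * M + K * l"
  define E' where "E' = exp (- K * a) * E * (b - a) + (exp (- K * b) + exp (- K * a)) * l"
  have E': "E' \<ge> 0" unfolding E'_def E_def using C(1) V l M \<kappa>(2) ab by simp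
  have main: "\<bar>exp (- K * b) * F (Z b) - exp (- K * a) * F (Z a)\<bar>
     \<le> exp (- K * a) * (l * (B b - B a)) + E' * r" if r: "0 < r" "r \<le> d" for r
  proof -
    obtain \<eta> :: "'a \<Rightarrow> real" where \<eta>: "is_mollifier r \<eta>"
      and D\<eta>: "\<And>y h. \<bar>frechet_derivative \<eta> (at y) h\<bar> \<le> C / r ^ (?n + 1) * norm h"
      using C(2)[OF r(1)] by blast
    note d' = is_mollifierD[OF \<eta>]
    have s: "frechet_derivative \<eta> (at y) b \<noteq> 0 \<Longrightarrow> norm y \<le> r" for y b
      using frechet_derivative_zero_outside_support[of \<eta> "cball 0 r" y] d'(3) by force
    have inS: "cball (Z t) r \<subseteq> S" if "t \<in> {a..b}" for t
      using d(2) that r(2) subset_cball[of r d "Z t"] by blast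
    have close: "\<bar>mol \<eta> F (Z t) - F (Z t)\<bar> \<le> l * r" if t: "t \<in> {a..b}" for t
      unfolding real_norm_def[symmetric]
    proof (rule mol_close[OF \<eta> F(1)])
      fix y assume y: "norm (Z t - y) \<le> r"
      have "y \<in> S" using inS[OF t] y by (auto simp: dist_norm subset_iff)
      then have "dist (F y) (F (Z t)) \<le> l * dist y (Z t)"
        by (rule lipschitz_onD[OF F(2) _ ZS[OF t]])
      also have "\<dots> \<le> l * r" using y l by (intro mult_left_mono) (auto simp: dist_norm norm_minus_commute)
      finally show "norm (F y - F (Z t)) \<le> l * r" by (simp add: dist_norm)
    qed
    define \<Phi>' where "\<Phi>' t = (LINT y|lborel. frechet_derivative \<eta> (at (Z t - y)) (Q t) *\<^sub>R F y)" for t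
    have D\<Phi>: "((\<lambda>t. mol \<eta> F (Z t)) has_vector_derivative \<Phi>' t) (at t)" if t: "t \<in> {a<..<b}" for t
    proof -
      have "(Z has_vector_derivative Q t) (at t)"
        using Z[of t] t at_within_Icc_at[of a t b] by simp
      then have "(Z has_derivative (\<lambda>x. x *\<^sub>R Q t)) (at t)" by (simp add: has_vector_derivative_def)
      from has_derivative_compose[OF this mol_has_derivative[OF d'(1) d'(3) F(1)]]
      have D: "((\<lambda>t. mol \<eta> F (Z t)) has_derivative
        (\<lambda>x. LINT y|lborel. frechet_derivative \<eta> (at (Z t - y)) (x *\<^sub>R Q t) *\<^sub>R F y)) (at t)" .
      have "frechet_derivative \<eta> (at y) (x *\<^sub>R h) = x * frechet_derivative \<eta> (at y) h" for x y h
        using linear_scale[OF has_derivative_linear[OF smooth_derivative[OF d'(1)]], of y x h] by simp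
      then show ?thesis using D by (simp add: has_vector_derivative_def \<Phi>'_def mult.assoc)
    qed
    have est: "\<bar>\<Phi>' t - K * mol \<eta> F (Z t)\<bar> \<le> l * k t + E * r" if t: "t \<in> {a..b}" for t
    proof -
      let ?D = "\<lambda>y. frechet_derivative \<eta> (at (Z t - y))"
      have lin: "linear (?D y)" for y
        using has_derivative_linear[OF smooth_derivative[OF d'(1)]] .
      have int: "integrable lborel (\<lambda>y. ?D y (g y) * f y)"
        if "continuous_on UNIV g" "continuous_on UNIV f" for g and f :: "'a \<Rightarrow> real"
      proof (rule integrable_continuous_bounded_support)
        show "continuous_on UNIV (\<lambda>y. ?D y (g y) * f y)"
          by (intro continuous_intros continuous_on_smooth_derivative[OF d'(1)] that)
        show "norm y \<le> norm (Z t) + r" if "?D y (g y) * f y \<noteq> 0" for y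
          using that s[of "Z t - y"] norm_le_of_norm_diff[of "Z t" y r] by auto
      qed
      let ?d = "Q t - A (Z t)"
      have i1: "integrable lborel (\<lambda>y. ?D y ?d * F y)" by (intro int continuous_intros F)
      have i2: "integrable lborel (\<lambda>y. ?D y (A y) * F y)" by (intro int A F)
      have i3: "integrable lborel (\<lambda>y. ?D y (A (Z t) - A y) * (F y - F (Z t)))"
        by (intro int continuous_intros A F)
      have i4: "integrable lborel (\<lambda>y. ?D y (A (Z t) - A y) * F (Z t))"
        by (intro int continuous_intros A)
      have w: "(LINT y|lborel. ?D y (A y) * F y) = 0"
        using weak[OF mollifier_test_function(1)[OF \<eta> inS[OF t]]]
        by (simp add: mollifier_test_function(2)[OF \<eta> inS[OF t]] mult.commute)
      have "\<Phi>' t = (LINT y|lborel. ?D y ?d * F y + ?D y (A y) * F y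
           + ?D y (A (Z t) - A y) * (F y - F (Z t)) + ?D y (A (Z t) - A y) * F (Z t))"
        unfolding \<Phi>'_def
      proof (rule Bochner_Integration.integral_cong[OF refl])
        fix y
        have "Q t = ?d + A y + (A (Z t) - A y)" by simp
        then have "?D y (Q t) = ?D y ?d + ?D y (A y) + ?D y (A (Z t) - A y)"
          by (metis linear_add[OF lin])
        then show "?D y (Q t) *\<^sub>R F y = ?D y ?d * F y + ?D y (A y) * F y
           + ?D y (A (Z t) - A y) * (F y - F (Z t)) + ?D y (A (Z t) - A y) * F (Z t)"
          by (simp add: algebra_simps)
      qed
      also have "\<dots> = (LINT y|lborel. ?D y ?d * F y) + (LINT y|lborel. ?D y (A y) * F y)
           + (LINT y|lborel. ?D y (A (Z t) - A y) * (F y - F (Z t)))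
           + (LINT y|lborel. ?D y (A (Z t) - A y) * F (Z t))"
        using i1 i2 i3 i4 by simp
      also have "(LINT y|lborel. ?D y (A (Z t) - A y) * F (Z t)) = K * F (Z t)"
      proof -
        have "(LINT y|lborel. ?D y (A (Z t) - A y)) = (\<Sum>b\<in>Basis. \<kappa> b)"
          by (rule integral_derivative_mollifier_field[OF \<eta>])
            (auto intro!: continuous_intros A simp: inner_diff_left div)
        then show ?thesis using \<kappa>(1) by simp
      qed
      finally have e: "\<Phi>' t - K * mol \<eta> F (Z t) = (LINT y|lborel. ?D y ?d * F y)
           + (LINT y|lborel. ?D y (A (Z t) - A y) * (F y - F (Z t))) - K * (mol \<eta> F (Z t) - F (Z t))"
        using w by (simp add: algebra_simps)
      have b1: "\<bar>LINT y|lborel. ?D y ?d * F y\<bar> \<le> l * k t"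
        using Fmol[OF \<eta> inS[OF t], of ?d] mult_left_mono[OF k[OF t] l] by simp
      \<comment> \<open>The commutator: two Lipschitz factors give r^2, against r^-(n+1) for the
        derivative of the kernel and r^n for the volume of its ball.\<close>
      have b2: "\<bar>LINT y|lborel. ?D y (A (Z t) - A y) * (F y - F (Z t))\<bar> \<le> C * V * l * M * r"
      proof -
        have "norm (LINT y|lborel. ?D y (A (Z t) - A y) * (F y - F (Z t)))
          \<le> (LINT y|lborel. indicator (cball (Z t) r) y * (C / r ^ (?n + 1) * (M * r) * (l * r)))"
        proof (rule Bochner_Integration.integral_norm_bound_integral[OF i3])
          show "integrable lborel (\<lambda>y. indicator (cball (Z t) r) y * (C / r ^ (?n + 1) * (M * r) * (l * r)))"
            by (intro integrable_mult_left integrable_real_indicator) (use emeasure_bounded_finite[OF bounded_cball, of "Z t" r] in auto)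
          fix y
          show "norm (?D y (A (Z t) - A y) * (F y - F (Z t)))
            \<le> indicator (cball (Z t) r) y * (C / r ^ (?n + 1) * (M * r) * (l * r))"
          proof (cases "norm (Z t - y) \<le> r")
            case True
            then have y: "y \<in> cball (Z t) r" by (simp add: dist_norm)
            then have "y \<in> S" using inS[OF t] by blast
            have "dist (F y) (F (Z t)) \<le> l * dist y (Z t)"
              by (rule lipschitz_onD[OF F(2) \<open>y \<in> S\<close> ZS[OF t]])
            also have "\<dots> \<le> l * r" using True l by (intro mult_left_mono) (auto simp: dist_norm norm_minus_commute)
            finally have f: "\<bar>F y - F (Z t)\<bar> \<le> l * r" by (simp add: dist_norm)
            have "dist (A (Z t)) (A y) \<le> M * dist (Z t) y"
              by (rule lipschitz_onD[OF A(2) ZS[OF t] \<open>y \<in> S\<close>])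
            also have "\<dots> \<le> M * r" using True M by (intro mult_left_mono) (auto simp: dist_norm)
            finally have "norm (A (Z t) - A y) \<le> M * r" by (simp add: dist_norm)
            then have D: "\<bar>?D y (A (Z t) - A y)\<bar> \<le> C / r ^ (?n + 1) * (M * r)"
              using D\<eta>[of "Z t - y" "A (Z t) - A y"] C(1) r(1)
              by (meson divide_nonneg_nonneg less_imp_le mult_left_mono order_trans zero_le_power)
            have "\<bar>?D y (A (Z t) - A y)\<bar> * \<bar>F y - F (Z t)\<bar> \<le> C / r ^ (?n + 1) * (M * r) * (l * r)"
              by (rule mult_mono[OF D f order_trans[OF abs_ge_zero D] abs_ge_zero])
            then have "norm (?D y (A (Z t) - A y) * (F y - F (Z t))) \<le> C / r ^ (?n + 1) * (M * r) * (l * r)"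
              by (simp only: real_norm_def abs_mult)
            moreover have "indicator (cball (Z t) r) y = (1::real)" using y by simp
            ultimately show ?thesis by (simp only: mult_1)
          next
            case False
            then show ?thesis using s[of "Z t - y" "A (Z t) - A y"] by (auto simp: dist_norm)
          qed
        qed
        also have "\<dots> = V * r ^ ?n * (C / r ^ (?n + 1) * (M * r) * (l * r))"
          using content_cball[of r "Z t"] r(1) by (simp add: V_def)
        also have "\<dots> = C * V * l * M * r" using r(1) by (simp add: field_simps)
        finally show ?thesis by simp
      qed
      have b3: "\<bar>K * (mol \<eta> F (Z t) - F (Z t))\<bar> \<le> K * (l * r)"
        using close[OF t] \<kappa>(2) by (simp add: abs_mult mult_left_mono)
      show ?thesis unfolding e E_def using b1 b2 b3 by (simp add: algebra_simps)
    qed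
    have "norm (exp (- K * b) * mol \<eta> F (Z b) - exp (- K * a) * mol \<eta> F (Z a))
        \<le> exp (- K * a) * (l * B b + E * r * b) - exp (- K * a) * (l * B a + E * r * a)"
    proof (rule differentiable_bound_general[OF ab])
      show "continuous_on {a..b} (\<lambda>t. exp (- K * a) * (l * B t + E * r * t))"
        using B by (intro continuous_intros)
          (meson continuous_on_eq_continuous_within has_vector_derivative_continuous)
      have "continuous_on UNIV (mol \<eta> F)"
        using has_derivative_continuous[OF mol_has_derivative[OF d'(1) d'(3) F(1)]]
        by (simp add: continuous_on_eq_continuous_at)
      then show "continuous_on {a..b} (\<lambda>t. exp (- K * t) * mol \<eta> F (Z t))"
        by (intro continuous_intros continuous_on_compose2[OF _ cZ]) auto
      fix t assume t: "a < t" "t < b"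
      have Bt: "(B has_real_derivative k t) (at t)"
        using B[of t] t at_within_Icc_at[of a t b] by (simp add: has_real_derivative_iff_has_vector_derivative)
      show "((\<lambda>t. exp (- K * a) * (l * B t + E * r * t)) has_vector_derivative
          exp (- K * a) * (l * k t + E * r)) (at t)"
        unfolding has_real_derivative_iff_has_vector_derivative[symmetric]
        by (auto intro!: derivative_eq_intros Bt)
      have Pt: "((\<lambda>t. mol \<eta> F (Z t)) has_real_derivative \<Phi>' t) (at t)"
        using D\<Phi>[of t] t by (simp add: has_real_derivative_iff_has_vector_derivative)
      have "((\<lambda>t. exp (- K * t) * mol \<eta> F (Z t)) has_real_derivative
         exp (- K * t) * (\<Phi>' t - K * mol \<eta> F (Z t))) (at t)"
        by (auto intro!: derivative_eq_intros Pt simp: algebra_simps)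
      then show "((\<lambda>t. exp (- K * t) * mol \<eta> F (Z t)) has_vector_derivative
         exp (- K * t) * (\<Phi>' t - K * mol \<eta> F (Z t))) (at t)"
        by (simp add: has_real_derivative_iff_has_vector_derivative)
      have "exp (- K * t) \<le> exp (- K * a)" using t \<kappa>(2) by (simp add: mult_left_mono)
      then show "norm (exp (- K * t) * (\<Phi>' t - K * mol \<eta> F (Z t))) \<le> exp (- K * a) * (l * k t + E * r)"
        using est[of t] t by (simp add: abs_mult) (intro mult_mono, auto)
    qed
    then have g: "\<bar>exp (- K * b) * mol \<eta> F (Z b) - exp (- K * a) * mol \<eta> F (Z a)\<bar>
        \<le> exp (- K * a) * (l * (B b - B a)) + exp (- K * a) * E * (b - a) * r"
      by (simp add: algebra_simps)
    have "\<bar>exp (- K * b) * mol \<eta> F (Z b) - exp (- K * b) * F (Z b)\<bar> \<le> exp (- K * b) * (l * r)"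
      using close[of b] ab by (simp add: abs_mult right_diff_distrib[symmetric])
    moreover have "\<bar>exp (- K * a) * mol \<eta> F (Z a) - exp (- K * a) * F (Z a)\<bar> \<le> exp (- K * a) * (l * r)"
      using close[of a] ab by (simp add: abs_mult right_diff_distrib[symmetric])
    ultimately show ?thesis using g unfolding E'_def by (simp add: distrib_right mult.assoc)
  qed
  show ?thesis
  proof (rule field_le_epsilon)
    fix e :: real assume e: "e > 0"
    define r where "r = min d (e / (E' + 1))"
    have r: "0 < r" "r \<le> d" using d e E' by (auto simp: r_def)
    have "E' * r \<le> E' * (e / (E' + 1))" using E' by (intro mult_left_mono) (auto simp: r_def)
    also have "\<dots> \<le> e" using E' e by (simp add: field_simps)
    finally show "\<bar>exp (- K * b) * F (Z b) - exp (- K * a) * F (Z a)\<bar>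
      \<le> exp (- K * a) * (l * (B b - B a)) + e" using main[OF r] by linarith
  qed
qed simp


section \<open>Ordinary differential equations\<close>

text \<open>The weight \<open>exp (- k |t|)\<close> turns the Picard map into a contraction of the bounded continuous
  functions, so that no continuation argument is needed; only \<open>t \<ge> 0\<close> is meaningful here.\<close>

lemma ode_forward:
  fixes G :: "'a::euclidean_space \<Rightarrow> 'a"
  assumes G: "M-lipschitz_on UNIV G"
  obtains Z where "Z 0 = z0" "\<And>t. t \<ge> 0 \<Longrightarrow> (Z has_vector_derivative G (Z t)) (at t within {0..})"
proof -
  have M: "M \<ge> 0" using G lipschitz_on_nonneg by blast
  have cG: "continuous_on A G" for A
    using lipschitz_on_continuous_on[OF G] continuous_on_subset by blast
  \<comment> \<open>In the weighted unknown the Picard map has Lipschitz constant at most M / k, so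
    this choice gives 1/2; the summand 1 keeps \<open>k\<close> positive when M = 0.\<close>
  define k where "k = 2 * M + 1"
  have k: "k > 0" "M / k \<le> 1 / 2" using M by (auto simp: k_def field_simps)
  define J where "J y \<tau> = integral {0..\<tau>} (\<lambda>s. G (exp (k * s) *\<^sub>R apply_bcontfun y s))"
    for y :: "real \<Rightarrow>\<^sub>C 'a" and \<tau>
  define T where "T y t = exp (- k * \<bar>t\<bar>) *\<^sub>R (z0 + J y \<bar>t\<bar>)" for y t
  have ci: "continuous_on A (\<lambda>s. G (exp (k * s) *\<^sub>R apply_bcontfun y s))" for A y
    by (intro continuous_on_compose2[OF cG[of UNIV]] continuous_intros) auto
  have int: "(\<lambda>s. G (exp (k * s) *\<^sub>R apply_bcontfun y s)) integrable_on {0..\<tau>}" for y \<tau>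
    by (intro integrable_continuous_real ci)
  have expint: "((\<lambda>s. c * exp (k * s)) has_integral c * (exp (k * \<tau>) - 1) / k) {0..\<tau>}" if "\<tau> \<ge> 0" for c \<tau>
  proof -
    have "((\<lambda>s. c * exp (k * s)) has_integral (c * exp (k * \<tau>) / k - c * exp (k * 0) / k)) {0..\<tau>}"
      using k(1) that
      by (intro fundamental_theorem_of_calculus)
        (auto simp: has_real_derivative_iff_has_vector_derivative[symmetric] intro!: derivative_eq_intros)
    moreover have "c * exp (k * \<tau>) / k - c * exp (k * 0) / k = c * (exp (k * \<tau>) - 1) / k"
      by (simp add: right_diff_distrib diff_divide_distrib)
    ultimately show ?thesis by simp
  qed
  have Jb: "norm (J y \<tau>) \<le> (norm (G 0) + M * norm y) * exp (k * \<tau>) / k" if t: "\<tau> \<ge> 0" for y \<tau>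
  proof -
    have "norm (J y \<tau>) \<le> integral {0..\<tau>} (\<lambda>s. (norm (G 0) + M * norm y) * exp (k * s))"
      unfolding J_def
    proof (rule Henstock_Kurzweil_Integration.integral_norm_bound_integral[OF int])
      show "(\<lambda>s. (norm (G 0) + M * norm y) * exp (k * s)) integrable_on {0..\<tau>}"
        using expint[OF t] by blast
      fix s assume s: "s \<in> {0..\<tau>}"
      let ?p = "exp (k * s) *\<^sub>R apply_bcontfun y s"
      have "norm (G ?p) \<le> norm (G 0) + dist (G ?p) (G 0)"
        by (metis add.commute dist_norm norm_triangle_sub)
      also have "\<dots> \<le> norm (G 0) + M * (exp (k * s) * norm y)"
        using lipschitz_onD[OF G, of ?p 0] norm_bounded[of y s] M
        by (smt (verit) dist_0_norm dist_commute exp_gt_zero UNIV_I mult_left_mono norm_scaleR abs_of_pos)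
      also have "\<dots> \<le> (norm (G 0) + M * norm y) * exp (k * s)"
        using s k(1) mult_left_mono[of 1 "exp (k * s)" "norm (G 0)"] by (simp add: algebra_simps)
      finally show "norm (G ?p) \<le> (norm (G 0) + M * norm y) * exp (k * s)" .
    qed
    also have "\<dots> = (norm (G 0) + M * norm y) * (exp (k * \<tau>) - 1) / k"
      using expint[OF t] by (rule integral_unique)
    also have "\<dots> \<le> (norm (G 0) + M * norm y) * exp (k * \<tau>) / k"
      using M k by (intro divide_right_mono mult_left_mono) auto
    finally show ?thesis .
  qed
  have cJ: "continuous_on {0..} (J y)" for y
  proof (subst continuous_on_eq_continuous_within, intro ballI)
    fix x :: real assume "x \<in> {0..}"
    then have "continuous (at x within {0..x+1}) (J y)"
      unfolding J_def using indefinite_integral_continuous_1[OF int]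
      by (simp add: continuous_on_eq_continuous_within)
    moreover have "at x within {0..x+1} = at x within {0..}"
      by (rule at_within_nhd[of x "{..<x+1}"]) auto
    ultimately show "continuous (at x within {0..}) (J y)" by simp
  qed
  have Tb: "T y \<in> bcontfun" for y
  proof (rule bcontfun_normI)
    show "continuous_on UNIV (T y)"
      unfolding T_def[abs_def]
      by (intro continuous_intros continuous_on_compose2[OF cJ]) auto
    fix t
    have "norm (T y t) \<le> exp (- k * \<bar>t\<bar>) * (norm z0 + (norm (G 0) + M * norm y) * exp (k * \<bar>t\<bar>) / k)"
      unfolding T_def using Jb[of "\<bar>t\<bar>" y]
      by (simp add: norm_scaleR) (metis add_left_mono norm_triangle_le)
    also have "\<dots> = exp (- k * \<bar>t\<bar>) * norm z0 + (norm (G 0) + M * norm y) / k"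
      by (simp add: field_simps exp_minus)
    also have "\<dots> \<le> norm z0 + (norm (G 0) + M * norm y) / k"
      using k(1) by (simp add: mult_left_le_one_le)
    finally show "norm (T y t) \<le> norm z0 + (norm (G 0) + M * norm y) / k" .
  qed
  have contr: "dist (Bcontfun (T x)) (Bcontfun (T y)) \<le> 1/2 * dist x y" for x y
  proof (rule dist_bound)
    fix t :: real
    let ?\<tau> = "\<bar>t\<bar>"
    have "norm (J x ?\<tau> - J y ?\<tau>) \<le> integral {0..?\<tau>} (\<lambda>s. (M * dist x y) * exp (k * s))"
      unfolding J_def Henstock_Kurzweil_Integration.integral_diff[OF int int, symmetric]
    proof (rule Henstock_Kurzweil_Integration.integral_norm_bound_integral)
      show "(\<lambda>s. (M * dist x y) * exp (k * s)) integrable_on {0..?\<tau>}"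
        using expint[of ?\<tau>] by auto
      fix s assume s: "s \<in> {0..?\<tau>}"
      have "norm (G (exp (k * s) *\<^sub>R apply_bcontfun x s) - G (exp (k * s) *\<^sub>R apply_bcontfun y s))
        \<le> M * dist (exp (k * s) *\<^sub>R apply_bcontfun x s) (exp (k * s) *\<^sub>R apply_bcontfun y s)"
        using lipschitz_onD[OF G] by (simp add: dist_norm)
      also have "\<dots> = M * (exp (k * s) * dist (apply_bcontfun x s) (apply_bcontfun y s))"
        by (simp add: dist_norm scaleR_diff_right[symmetric])
      also have "\<dots> \<le> M * (exp (k * s) * dist x y)"
        using M dist_bounded by (intro mult_left_mono) auto
      finally show "norm (G (exp (k * s) *\<^sub>R apply_bcontfun x s) - G (exp (k * s) *\<^sub>R apply_bcontfun y s))
         \<le> (M * dist x y) * exp (k * s)" by (simp add: mult_ac)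
    qed (intro Henstock_Kurzweil_Integration.integrable_diff int)
    also have "\<dots> = M * dist x y * (exp (k * ?\<tau>) - 1) / k"
      by (rule integral_unique[OF expint]) simp
    also have "\<dots> \<le> M * dist x y * exp (k * ?\<tau>) / k"
      using M k by (intro divide_right_mono mult_left_mono) auto
    also have "\<dots> = (M / k) * (dist x y * exp (k * ?\<tau>))" by simp
    also have "\<dots> \<le> 1/2 * (dist x y * exp (k * ?\<tau>))"
      by (intro mult_right_mono k) simp
    finally have "norm (J x ?\<tau> - J y ?\<tau>) \<le> 1/2 * dist x y * exp (k * ?\<tau>)" by simp
    then have "exp (- k * ?\<tau>) * norm (J x ?\<tau> - J y ?\<tau>) \<le> exp (- k * ?\<tau>) * (1/2 * dist x y * exp (k * ?\<tau>))"
      by (rule mult_left_mono) simp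
    then have "exp (- k * ?\<tau>) * norm (J x ?\<tau> - J y ?\<tau>) \<le> 1/2 * dist x y"
      by (simp add: exp_minus field_simps)
    then show "dist (apply_bcontfun (Bcontfun (T x)) t) (apply_bcontfun (Bcontfun (T y)) t) \<le> 1/2 * dist x y"
      unfolding Bcontfun_inverse[OF Tb] T_def dist_norm scaleR_diff_right[symmetric] by simp
  qed
  obtain y where y: "Bcontfun (T y) = y"
    using banach_fix_type[of "1/2" "\<lambda>y. Bcontfun (T y)"] contr by auto
  define Z where "Z t = exp (k * t) *\<^sub>R apply_bcontfun y t" for t
  have Z: "Z t = z0 + integral {0..t} (\<lambda>s. G (Z s))" if "t \<ge> 0" for t
  proof -
    have "apply_bcontfun y t = T y t" using y Bcontfun_inverse[OF Tb] by metis
    then have "Z t = z0 + J y t"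
      using that by (simp add: Z_def T_def flip: exp_add)
    then show ?thesis by (simp add: J_def Z_def)
  qed
  show ?thesis
  proof
    show "Z 0 = z0" using Z[of 0] by simp
    fix t :: real assume t: "t \<ge> 0"
    have "((\<lambda>u. integral {0..u} (\<lambda>s. G (Z s))) has_vector_derivative G (Z t)) (at t within {0..t+1})"
      unfolding Z_def by (rule integral_has_vector_derivative[OF ci]) (use t in auto)
    then have "((\<lambda>u. z0 + integral {0..u} (\<lambda>s. G (Z s))) has_vector_derivative G (Z t)) (at t within {0..t+1})"
      using has_vector_derivative_add[OF has_vector_derivative_const[of z0]] by fastforce
    then have "(Z has_vector_derivative G (Z t)) (at t within {0..t+1})"
      by (rule has_vector_derivative_transform[rotated 2]) (use t Z in auto)
    moreover have "at t within {0..t+1} = at t within {0..}"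
      by (rule at_within_nhd[of t "{..<t+1}"]) auto
    ultimately show "(Z has_vector_derivative G (Z t)) (at t within {0..})" by simp
  qed
qed

text \<open>Forward solutions for \<open>G\<close> and for \<open>- G\<close> are glued at time 0.
  The equation is autonomous, so a shift of time moves the initial time to \<open>s\<close>.\<close>

lemma ode_global:
  fixes G :: "'a::euclidean_space \<Rightarrow> 'a"
  assumes G: "M-lipschitz_on UNIV G"
  obtains Z where "Z s = z0" "\<And>t. (Z has_vector_derivative G (Z t)) (at t)"
proof -
  obtain A where A: "A 0 = z0" "\<And>t. t \<ge> 0 \<Longrightarrow> (A has_vector_derivative G (A t)) (at t within {0..})"
    using ode_forward[OF G] by blast
  have "M-lipschitz_on UNIV (\<lambda>x. - G x)"
    using G by (simp add: lipschitz_on_minus)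
  then obtain B where B: "B 0 = z0" "\<And>t. t \<ge> 0 \<Longrightarrow> (B has_vector_derivative - G (B t)) (at t within {0..})"
    using ode_forward[of M "\<lambda>x. - G x"] by blast
  have B': "((\<lambda>t. B (- t)) has_vector_derivative G (B (- t))) (at t within {..0})" if "t \<le> 0" for t
  proof -
    have "uminus ` {..0::real} = {0..}" by simp
    then have "((B \<circ> uminus) has_vector_derivative (- 1) *\<^sub>R (- G (B (- t)))) (at t within {..0})"
      using that B(2)[of "- t"]
      by (intro vector_diff_chain_within) (auto intro!: derivative_eq_intros)
    then show ?thesis by (simp add: o_def)
  qed
  define Z where "Z t = (if t \<in> {0..} then A t else B (- t))" for t
  have Z: "(Z has_vector_derivative G (Z t)) (at t)" for t
  proof -
    have "((\<lambda>t. if t \<in> {0..} then A t else B (- t)) has_vector_derivative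
        (if t \<in> {0..} then G (A t) else G (B (- t)))) (at t within UNIV)"
    proof (rule has_vector_derivative_If_within_closures)
      have "{0..} \<union> closure {0..} \<inter> closure {..<0} = {0::real..}" by auto
      then show "t \<in> {0..} \<union> closure {0..} \<inter> closure {..<0} \<Longrightarrow>
         (A has_vector_derivative G (A t)) (at t within {0..} \<union> closure {0..} \<inter> closure {..<0})"
        using A(2) by auto
      have "{..<0} \<union> closure {0..} \<inter> closure {..<0} = {..0::real}" by auto
      then show "t \<in> {..<0} \<union> closure {0..} \<inter> closure {..<0} \<Longrightarrow>
         ((\<lambda>t. B (- t)) has_vector_derivative G (B (- t))) (at t within {..<0} \<union> closure {0..} \<inter> closure {..<0})"
        using B' by auto
    qed (use A(1) B(1) in auto)
    then show ?thesis
      by (simp add: Z_def[abs_def] if_distrib[of G] cong: if_cong)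
  qed
  have "((\<lambda>t. Z (t - s)) has_vector_derivative G (Z (t - s))) (at t)" for t
  proof -
    have "((Z \<circ> (\<lambda>t. t - s)) has_vector_derivative 1 *\<^sub>R G (Z (t - s))) (at t)"
      by (rule vector_diff_chain_at) (use Z in \<open>auto intro!: derivative_eq_intros\<close>)
    then show ?thesis by (simp add: o_def)
  qed
  moreover have "Z (s - s) = z0" using A(1) by (simp add: Z_def)
  ultimately show ?thesis using that[of "\<lambda>t. Z (t - s)"] by blast
qed

lemma has_real_derivative_inner_self:
  fixes A :: "real \<Rightarrow> 'a::real_inner"
  assumes "(A has_vector_derivative A') (at t)"
  shows "((\<lambda>t. A t \<bullet> A t) has_real_derivative 2 * (A t \<bullet> A')) (at t)"
proof -
  note d = assms[unfolded has_vector_derivative_def]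
  have "(\<lambda>h. A t \<bullet> (h *\<^sub>R A') + (h *\<^sub>R A') \<bullet> A t) = (*) (2 * (A t \<bullet> A'))"
    by (auto simp: fun_eq_iff inner_commute)
  then show ?thesis using has_derivative_inner[OF d d] by (simp add: has_field_derivative_def)
qed

text \<open>Working with the squared distance avoids differentiating a norm at 0. The cross term 2
  |D| e is split into |D|^2 + e^2, whence the 1 in the exponent. The speeds \<open>q1\<close> and
  \<open>q2\<close> are arbitrary, so that trajectories of perturbed fields can be compared.\<close>

lemma gronwall_difference:
  fixes Z1 Z2 :: "real \<Rightarrow> 'a::euclidean_space"
  assumes ab: "a \<le> b" and M: "0 \<le> M"
    and 1: "\<And>t. t \<in> {a..b} \<Longrightarrow> (Z1 has_vector_derivative q1 t) (at t within {a..b})"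
    and 2: "\<And>t. t \<in> {a..b} \<Longrightarrow> (Z2 has_vector_derivative q2 t) (at t within {a..b})"
    and q: "\<And>t. t \<in> {a..b} \<Longrightarrow> norm (q1 t - q2 t) \<le> M * norm (Z1 t - Z2 t) + e"
  shows "(norm (Z1 b - Z2 b))\<^sup>2 \<le> ((norm (Z1 a - Z2 a))\<^sup>2 + e\<^sup>2 * (b - a)) * exp ((2 * M + 1) * (b - a))"
proof -
  define c where "c = 2 * M + 1"
  define D where "D t = Z1 t - Z2 t" for t
  \<comment> \<open>The correction can be the plain e^2 (t - a), because the exponential weight is
    at most 1.\<close>
  define P where "P t = exp (- c * (t - a)) * (D t \<bullet> D t) - e\<^sup>2 * (t - a)" for t
  have dD: "(D has_vector_derivative q1 t - q2 t) (at t within {a..b})" if "t \<in> {a..b}" for t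
    unfolding D_def[abs_def] by (intro derivative_intros 1 2 that)
  have cD: "continuous_on {a..b} D"
    using dD by (meson continuous_on_eq_continuous_within has_vector_derivative_continuous)
  have "P a \<ge> P b"
  proof (rule DERIV_nonpos_imp_decreasing_open[OF ab])
    show "continuous_on {a..b} P"
      unfolding P_def[abs_def] by (intro continuous_intros cD)
    fix t assume t: "a < t" "t < b"
    let ?q = "q1 t - q2 t"
    have d: "(D has_vector_derivative ?q) (at t)"
      using dD[of t] t at_within_Icc_at[of a t b] by simp
    note dN = has_real_derivative_inner_self[OF d]
    have P': "(P has_real_derivative
        exp (- c * (t - a)) * (2 * (D t \<bullet> ?q) - c * (D t \<bullet> D t)) - e\<^sup>2) (at t)"
      unfolding P_def[abs_def] by (auto intro!: derivative_eq_intros dN simp: algebra_simps)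
    have "D t \<bullet> ?q \<le> norm (D t) * norm ?q" by (rule norm_cauchy_schwarz)
    also have "\<dots> \<le> norm (D t) * (M * norm (D t) + e)"
      using q[of t] t by (intro mult_left_mono) (auto simp: D_def)
    finally have "2 * (D t \<bullet> ?q) \<le> 2 * M * (norm (D t))\<^sup>2 + 2 * norm (D t) * e"
      by (simp add: power2_eq_square algebra_simps)
    also have "2 * norm (D t) * e \<le> (norm (D t))\<^sup>2 + e\<^sup>2" by (rule sum_squares_bound)
    finally have "2 * (D t \<bullet> ?q) - c * (D t \<bullet> D t) \<le> e\<^sup>2"
      by (simp add: c_def power2_norm_eq_inner algebra_simps)
    then have "exp (- c * (t - a)) * (2 * (D t \<bullet> ?q) - c * (D t \<bullet> D t)) \<le> exp (- c * (t - a)) * e\<^sup>2"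
      by (intro mult_left_mono) auto
    also have "\<dots> \<le> 1 * e\<^sup>2" using t M by (intro mult_right_mono) (auto simp: c_def mult_nonpos_nonneg)
    finally show "\<exists>y. DERIV P t :> y \<and> y \<le> 0" using P' by (intro exI conjI) auto
  qed
  then have "exp (- c * (b - a)) * (D b \<bullet> D b) \<le> D a \<bullet> D a + e\<^sup>2 * (b - a)" by (simp add: P_def)
  then have "exp (c * (b - a)) * (exp (- c * (b - a)) * (D b \<bullet> D b)) \<le> exp (c * (b - a)) * (D a \<bullet> D a + e\<^sup>2 * (b - a))"
    by (intro mult_left_mono) auto
  moreover have "exp (c * (b - a)) * (exp (- c * (b - a)) * (D b \<bullet> D b)) = D b \<bullet> D b"
    by (simp add: exp_minus)
  ultimately have "D b \<bullet> D b \<le> (D a \<bullet> D a + e\<^sup>2 * (b - a)) * exp (c * (b - a))"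
    by (simp only: mult.commute)
  then show ?thesis unfolding D_def c_def power2_norm_eq_inner .
qed

lemma ode_unique:
  fixes Z1 Z2 :: "real \<Rightarrow> 'a::euclidean_space"
  assumes G: "M-lipschitz_on UNIV G" and s: "Z1 s = Z2 s"
    and 1: "\<And>t. (Z1 has_vector_derivative G (Z1 t)) (at t)"
    and 2: "\<And>t. (Z2 has_vector_derivative G (Z2 t)) (at t)"
  shows "Z1 t = Z2 t"
proof (cases "s \<le> t")
  case True
  have M: "M \<ge> 0" using G lipschitz_on_nonneg by blast
  have "(norm (Z1 t - Z2 t))\<^sup>2 \<le> ((norm (Z1 s - Z2 s))\<^sup>2 + 0\<^sup>2 * (t - s)) * exp ((2 * M + 1) * (t - s))"
    by (rule gronwall_difference[OF True M, of Z1 "\<lambda>t. G (Z1 t)" Z2 "\<lambda>t. G (Z2 t)"])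
      (use 1 2 lipschitz_onD[OF G] in \<open>auto intro: has_vector_derivative_at_within simp: dist_norm\<close>)
  then show ?thesis using s by simp
next
  case False
  then have st: "- s \<le> - t" by simp
  have M: "M \<ge> 0" using G lipschitz_on_nonneg by blast
  have r: "((\<lambda>t. Z (- t)) has_vector_derivative - G (Z (- t))) (at t)"
    if "\<And>t. (Z has_vector_derivative G (Z t)) (at t)" for Z t
  proof -
    have "((Z \<circ> uminus) has_vector_derivative (- 1) *\<^sub>R G (Z (- t))) (at t)"
      by (rule vector_diff_chain_at) (use that in \<open>auto intro!: derivative_eq_intros\<close>)
    then show ?thesis by (simp add: o_def)
  qed
  have "(norm (Z1 (- (- t)) - Z2 (- (- t))))\<^sup>2 \<le> ((norm (Z1 (- (- s)) - Z2 (- (- s))))\<^sup>2 + 0\<^sup>2 * (- t - - s)) * exp ((2 * M + 1) * (- t - - s))"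
    by (rule gronwall_difference[OF st M, of "\<lambda>t. Z1 (- t)" "\<lambda>t. - G (Z1 (- t))" "\<lambda>t. Z2 (- t)" "\<lambda>t. - G (Z2 (- t))"])
      (use r[OF 1] r[OF 2] lipschitz_onD[OF G] in \<open>auto intro: has_vector_derivative_at_within simp: dist_norm norm_minus_commute\<close>)
  then show ?thesis using s by simp
qed

text \<open>With \<open>D\<close> and \<open>W\<close> the differences of positions and velocities, \<open>|W|\<^sup>2 - |D|\<^sup>2 / 4\<close> grows at
  least like \<open>exp (- t)\<close> as \<open>t\<close> decreases, whereas \<open>D + W\<close> grows at most linearly if \<open>D\<close> stays bounded.\<close>

lemma friction_backward_separation:
  fixes X1 X2 V1 V2 :: "real \<Rightarrow> 'a::euclidean_space"
  assumes U: "\<And>x y. norm (U x - U y) \<le> 1 / 8 * norm (x - y)"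
    and X: "\<And>t. (X1 has_vector_derivative V1 t) (at t)" "\<And>t. (X2 has_vector_derivative V2 t) (at t)"
    and V: "\<And>t. (V1 has_vector_derivative U (X1 t) - V1 t) (at t)"
           "\<And>t. (V2 has_vector_derivative U (X2 t) - V2 t) (at t)"
    and init: "X1 0 = X2 0" and bd: "\<And>t. t \<le> 0 \<Longrightarrow> norm (X1 t - X2 t) \<le> R"
  shows "V1 0 = V2 0"
proof -
  define D where "D t = X1 t - X2 t" for t
  define W where "W t = V1 t - V2 t" for t
  define q where "q t = U (X1 t) - U (X2 t)" for t
  have dD: "(D has_vector_derivative W t) (at t)" for t
    unfolding D_def[abs_def] W_def by (intro derivative_intros X)
  have dW: "(W has_vector_derivative q t - W t) (at t)" for t
  proof -
    have "(W has_vector_derivative (U (X1 t) - V1 t) - (U (X2 t) - V2 t)) (at t)"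
      unfolding W_def[abs_def] by (intro derivative_intros V)
    then show ?thesis by (simp add: q_def W_def algebra_simps)
  qed
  have q: "norm (q t) \<le> 1 / 8 * norm (D t)" for t using U by (simp add: q_def D_def)
  define P where "P t = exp t * (W t \<bullet> W t - 1 / 4 * (D t \<bullet> D t))" for t
  have grow: "P t \<ge> P 0" if t: "t \<le> 0" for t
  proof (rule DERIV_nonpos_imp_nonincreasing[OF t])
    fix x
    have P': "(P has_real_derivative exp x * (2 * (W x \<bullet> (q x - W x)) - 1 / 2 * (D x \<bullet> W x)
        + (W x \<bullet> W x - 1 / 4 * (D x \<bullet> D x)))) (at x)"
      unfolding P_def[abs_def]
      by (auto intro!: derivative_eq_intros has_real_derivative_inner_self[OF dW] has_real_derivative_inner_self[OF dD] simp: algebra_simps)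
    \<comment> \<open>With Lipschitz constant 1/8 the bracket is at most (1/4 + 1/2) w d - (w^2 +
      d^2/4), and w^2 + d^2/4 >= w d.\<close>
    define w where "w = norm (W x)"
    define d where "d = norm (D x)"
    have "W x \<bullet> q x \<le> w * (1 / 8 * d)"
      unfolding w_def d_def by (rule order_trans[OF norm_cauchy_schwarz mult_left_mono[OF q norm_ge_zero]])
    moreover have "- (D x \<bullet> W x) \<le> d * w"
      unfolding w_def d_def using norm_cauchy_schwarz[of "- D x" "W x"] by simp
    moreover have "W x \<bullet> W x = w\<^sup>2" "D x \<bullet> D x = d\<^sup>2" by (simp_all add: w_def d_def power2_norm_eq_inner)
    moreover have "w * d \<le> w\<^sup>2 + d\<^sup>2 / 4"
      using zero_le_power2[of "w - d / 2"] by (simp add: power2_eq_square algebra_simps)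
    moreover have "w * d \<ge> 0" by (simp add: w_def d_def)
    ultimately have "2 * (W x \<bullet> (q x - W x)) - 1 / 2 * (D x \<bullet> W x) + (W x \<bullet> W x - 1 / 4 * (D x \<bullet> D x)) \<le> 0"
      by (simp add: inner_diff_right mult.commute)
    then have "exp x * (2 * (W x \<bullet> (q x - W x)) - 1 / 2 * (D x \<bullet> W x) + (W x \<bullet> W x - 1 / 4 * (D x \<bullet> D x))) \<le> 0"
      by (intro mult_nonneg_nonpos) auto
    then show "\<exists>y. DERIV P x :> y \<and> y \<le> 0" using P' by blast
  qed
  have D0: "D 0 = 0" using init by (simp add: D_def)
  have R: "R \<ge> 0" using bd[of 0] norm_ge_zero order_trans by blast
  define c where "c = norm (W 0)"
  have lower: "exp (- t) * c\<^sup>2 \<le> (norm (W t))\<^sup>2" if t: "t \<le> 0" for t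
  proof -
    have "c\<^sup>2 \<le> exp t * (norm (W t))\<^sup>2"
    proof -
      have "W 0 \<bullet> W 0 \<le> exp t * (W t \<bullet> W t) - exp t * (1 / 4 * (D t \<bullet> D t))"
        using grow[OF t] D0 by (simp add: P_def right_diff_distrib)
      moreover have "exp t * (1 / 4 * (D t \<bullet> D t)) \<ge> 0" by simp
      ultimately show ?thesis unfolding c_def power2_norm_eq_inner by linarith
    qed
    then have "exp (- t) * c\<^sup>2 \<le> exp (- t) * (exp t * (norm (W t))\<^sup>2)" by (intro mult_left_mono) auto
    also have "\<dots> = (norm (W t))\<^sup>2" by (simp add: exp_minus)
    finally show ?thesis .
  qed
  \<comment> \<open>In the derivative of \<open>D + W\<close> the terms \<open>W\<close> and
    \<open>- W\<close> cancel and only \<open>q\<close> remains, which is bounded because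
    \<open>D\<close> is.\<close>
  have upper: "norm (W t) \<le> 2 * R + c + R * (- t)" if t: "t \<le> 0" for t
  proof -
    have dS: "((\<lambda>t. D t + W t) has_vector_derivative q t) (at t)" for t
      using has_vector_derivative_add[OF dD dW, of t] by simp
    have "norm ((D 0 + W 0) - (D t + W t)) \<le> R * norm (0 - t)"
    proof (rule differentiable_bound[of "{t..0}"])
      fix x assume x: "x \<in> {t..0}"
      show "((\<lambda>t. D t + W t) has_derivative (\<lambda>h. h *\<^sub>R q x)) (at x within {t..0})"
        using dS[of x] by (simp add: has_vector_derivative_def has_derivative_at_withinI)
      have "norm (q x) \<le> R"
        using q[of x] bd[of x] x R by (auto simp: D_def)
      then show "onorm (\<lambda>h. h *\<^sub>R q x) \<le> R"
        by (intro onorm_le) (simp add: mult.commute[of R] mult_left_mono)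
    qed (use t in auto)
    moreover have "norm (D t) \<le> R" using bd[OF t] by (simp add: D_def)
    moreover have "norm (W t) \<le> norm ((D 0 + W 0) - (D t + W t)) + norm (W 0) + norm (D t)"
    proof -
      define S where "S = (D 0 + W 0) - (D t + W t)"
      have "W t = W 0 - S - D t" using D0 by (simp add: S_def)
      then have "norm (W t) = norm (W 0 - S - D t)" by (rule arg_cong)
      also have "\<dots> \<le> norm (W 0 - S) + norm (D t)" by (rule norm_triangle_ineq4)
      also have "norm (W 0 - S) \<le> norm (W 0) + norm S" by (rule norm_triangle_ineq4)
      finally show ?thesis by (simp add: S_def)
    qed
    ultimately show ?thesis using t R by (simp add: c_def)
  qed
  have "c = 0"
  proof (rule ccontr)
    assume "c \<noteq> 0"
    then have c: "c > 0" by (simp add: c_def)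
    have "((\<lambda>x. (2 * R + c + R * x)\<^sup>2 / exp x) \<longlongrightarrow> 0) at_top"
    proof -
      have "(\<lambda>x. (2 * R + c + R * x)\<^sup>2 / exp x) =
        (\<lambda>x. (2 * R + c)\<^sup>2 * (x ^ 0 / exp x) + 2 * (2 * R + c) * R * (x ^ 1 / exp x) + R\<^sup>2 * (x ^ 2 / exp x))"
        by (auto simp: fun_eq_iff power2_eq_square field_simps)
      moreover have "((\<lambda>x. (2 * R + c)\<^sup>2 * (x ^ 0 / exp x) + 2 * (2 * R + c) * R * (x ^ 1 / exp x) + R\<^sup>2 * (x ^ 2 / exp x))
          \<longlongrightarrow> (2 * R + c)\<^sup>2 * 0 + 2 * (2 * R + c) * R * 0 + R\<^sup>2 * 0) at_top"
        by (intro tendsto_intros tendsto_power_div_exp_0)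
      ultimately show ?thesis by simp
    qed
    then have "\<forall>\<^sub>F x in at_top. (2 * R + c + R * x)\<^sup>2 / exp x < c\<^sup>2"
      using c by (intro order_tendstoD) auto
    then obtain N where N: "\<And>x. x \<ge> N \<Longrightarrow> (2 * R + c + R * x)\<^sup>2 / exp x < c\<^sup>2"
      by (auto simp: eventually_at_top_linorder)
    define x where "x = max N 0"
    have "(norm (W (- x)))\<^sup>2 \<le> (2 * R + c + R * x)\<^sup>2"
      using upper[of "- x"] by (intro power_mono) (auto simp: x_def)
    moreover have "exp x * c\<^sup>2 \<le> (norm (W (- x)))\<^sup>2" using lower[of "- x"] by (simp add: x_def)
    moreover have "(2 * R + c + R * x)\<^sup>2 < exp x * c\<^sup>2" using N[of x] by (simp add: x_def field_simps)
    ultimately show False by linarith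
  qed
  then show ?thesis by (simp add: c_def W_def)
qed

text \<open>The times in [c, 0] spent outside the open set form a nonempty compact set;
  \<open>s\<close> is its maximum. The point reached then lies in the closure because the curve is
  inside immediately afterwards.\<close>

lemma last_exit_before_zero:
  fixes X :: "real \<Rightarrow> 'a::euclidean_space"
  assumes X: "continuous_on UNIV X" and S: "open S" "X 0 \<in> S" and c: "c \<le> 0" "X c \<notin> S"
  obtains s where "s < 0" "X s \<in> frontier S" "\<And>t. s < t \<Longrightarrow> t \<le> 0 \<Longrightarrow> X t \<in> S"
proof -
  define B where "B = {c..0} \<inter> X -` (- S)"
  have "closed B" unfolding B_def
    by (rule continuous_closed_preimage[OF continuous_on_subset[OF X]]) (use S in auto)
  then have "compact B" unfolding B_def by (metis Int_lower1 bounded_closed_interval bounded_subset compact_eq_bounded_closed)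
  moreover have "B \<noteq> {}" using c by (auto simp: B_def)
  ultimately obtain s where s: "s \<in> B" "\<And>t. t \<in> B \<Longrightarrow> t \<le> s"
    using compact_attains_sup by metis
  have s0: "s < 0" using s(1) S(2) by (cases "s = 0") (auto simp: B_def)
  have in_S: "X t \<in> S" if "s < t" "t \<le> 0" for t
    using s(1) s(2)[of t] that by (force simp: B_def)
  have "X s \<in> closure S"
  proof (rule ccontr)
    assume "X s \<notin> closure S"
    then have "open (X -` (- closure S))" "s \<in> X -` (- closure S)"
      using continuous_open_preimage[OF X open_UNIV, of "- closure S"] by auto
    then obtain e where e: "e > 0" "ball s e \<subseteq> X -` (- closure S)"
      using open_contains_ball by blast
    define t where "t = min 0 (s + e / 2)"
    have "t \<in> ball s e" "s < t" "t \<le> 0" using e(1) s0 by (auto simp: t_def dist_real_def)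
    then show False using e(2) in_S[of t] closure_subset by blast
  qed
  moreover have "X s \<notin> S" using s(1) by (simp add: B_def)
  ultimately have "X s \<in> frontier S" using S(1) by (simp add: frontier_def interior_open)
  then show ?thesis using that s0 in_S by blast
qed


section \<open>The pipe and the Vlasov equation\<close>

lemma Omega_eq_box: "Omega L = box (vector [- L, - 1]) (vector [L, 1])"
  by (auto simp: Omega_def mem_box_cart forall_2 vector_2)

lemma open_Omega: "open (Omega L)" and convex_Omega: "convex (Omega L)"
  by (simp_all add: Omega_eq_box open_box convex_box)

lemma closure_Omega:
  assumes "0 < L"
  shows "closure (Omega L) = {x. - L \<le> x$1 \<and> x$1 \<le> L \<and> - 1 \<le> x$2 \<and> x$2 \<le> 1}"
proof -
  have "0 \<in> Omega L" using assms by (simp add: Omega_def)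
  then have "closure (Omega L) = cbox (vector [- L, - 1]) (vector [L, 1])"
    unfolding Omega_eq_box by (intro closure_box) blast
  then show ?thesis unfolding set_eq_iff by (simp add: mem_box_cart forall_2 vector_2 conj_assoc)
qed

lemma frontier_Omega:
  assumes "0 < L"
  shows "frontier (Omega L) = {x \<in> closure (Omega L). x$1 = - L \<or> x$1 = L \<or> x$2 = - 1 \<or> x$2 = 1}"
  unfolding frontier_def interior_open[OF open_Omega] closure_Omega[OF assms]
  by (auto simp: Omega_def)

lemma Omega_ne:
  assumes "0 < L" shows "Omega L \<noteq> {}"
proof -
  have "0 \<in> Omega L" using assms by (simp add: Omega_def)
  then show ?thesis by blast
qed

text \<open>For \<open>u\<close> and the densities the extension is by nearest-point projection
  rather than by \<open>P\<close>: the pipe is convex, so the projection is 1-Lipschitz and the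
  constant 1/8 survives, whereas \<open>P\<close> may enlarge it.\<close>

abbreviation proj_Omega :: "real \<Rightarrow> vec2 \<Rightarrow> vec2" where
  "proj_Omega L \<equiv> closest_point (closure (Omega L))"

lemma proj_Omega:
  assumes "0 < L"
  shows "proj_Omega L x \<in> closure (Omega L)" "x \<in> closure (Omega L) \<Longrightarrow> proj_Omega L x = x"
    "dist (proj_Omega L x) (proj_Omega L y) \<le> dist x y" "continuous_on A (proj_Omega L)"
proof -
  have c: "convex (closure (Omega L))" "closed (closure (Omega L))" "closure (Omega L) \<noteq> {}"
    using convex_Omega Omega_ne[OF assms] by (auto intro: convex_closure)
  show "proj_Omega L x \<in> closure (Omega L)" by (rule closest_point_in_set[OF c(2,3)])
  show "x \<in> closure (Omega L) \<Longrightarrow> proj_Omega L x = x" by (rule closest_point_self)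
  show "dist (proj_Omega L x) (proj_Omega L y) \<le> dist x y" by (rule closest_point_lipschitz[OF c])
  show "continuous_on A (proj_Omega L)" by (rule continuous_on_closest_point[OF c])
qed

lemma proj_Omega_extension:
  assumes L: "0 < L" and u: "continuous_on (closure (Omega L)) u"
  shows "continuous_on A (\<lambda>x. u (proj_Omega L x))"
    "M-lipschitz_on (Omega L) u \<Longrightarrow> M-lipschitz_on UNIV (\<lambda>x. u (proj_Omega L x))"
proof -
  show "continuous_on A (\<lambda>x. u (proj_Omega L x))"
    by (rule continuous_on_compose2[OF u proj_Omega(4)[OF L]]) (use proj_Omega(1)[OF L] in auto)
  assume "M-lipschitz_on (Omega L) u"
  then have l: "M-lipschitz_on (closure (Omega L)) u" by (rule lipschitz_on_closure[OF _ u])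
  show "M-lipschitz_on UNIV (\<lambda>x. u (proj_Omega L x))"
  proof (rule lipschitz_onI)
    show M: "0 \<le> M" by (rule lipschitz_on_nonneg[OF l])
    fix x y
    have "dist (u (proj_Omega L x)) (u (proj_Omega L y)) \<le> M * dist (proj_Omega L x) (proj_Omega L y)"
      by (rule lipschitz_onD[OF l]) (rule proj_Omega(1)[OF L])+
    also have "\<dots> \<le> M * dist x y" by (intro mult_left_mono proj_Omega(3)[OF L] M)
    finally show "dist (u (proj_Omega L x)) (u (proj_Omega L y)) \<le> M * dist x y" .
  qed
qed

lemma open_Omega_UNIV: "open (Omega L \<times> (UNIV::vec2 set))"
  by (intro open_Times open_Omega open_UNIV)

lemma proj_Omega_extension_phase:
  assumes L: "0 < L" and F: "continuous_on (closure (Omega L) \<times> UNIV) (F :: phase \<Rightarrow> real)"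
  shows "continuous_on A (\<lambda>z. F (proj_Omega L (fst z), snd z))"
  by (rule continuous_on_compose2[OF F])
    (auto intro!: continuous_intros continuous_on_compose2[OF proj_Omega(4)[OF L, of UNIV]] simp: proj_Omega(1)[OF L])

lemma proj_Omega_phase_AE:
  assumes L: "0 < L" and "AE z in lebesgue_on (Omega L \<times> UNIV). f z = (F :: phase \<Rightarrow> real) z"
  shows "AE z in lebesgue_on (Omega L \<times> UNIV). f z = F (proj_Omega L (fst z), snd z)"
proof -
  have "AE z in lebesgue_on (Omega L \<times> UNIV). z \<in> Omega L \<times> UNIV"
    by (rule AE_I2) (simp add: space_restrict_space)
  with assms(2) show ?thesis
  proof eventually_elim
    case (elim z)
    then have "proj_Omega L (fst z) = fst z"
      using proj_Omega(2)[OF L] closure_subset[of "Omega L"] by (auto simp: mem_Times_iff)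
    then show ?case using elim by simp
  qed
qed

lemma lipschitz_of_weak_gradient_phase:
  assumes L: "0 < L" and f: "f \<in> borel_measurable (lebesgue_on (Omega L \<times> UNIV))"
    and G: "is_weak_gradient (Omega L \<times> UNIV) f G" "AE z in lebesgue_on (Omega L \<times> UNIV). norm (G z) \<le> l" "0 \<le> l"
    and F: "continuous_on (closure (Omega L) \<times> UNIV) (F :: phase \<Rightarrow> real)"
      "AE z in lebesgue_on (Omega L \<times> UNIV). f z = F z"
  shows "l-lipschitz_on (Omega L \<times> UNIV) (\<lambda>z. F (proj_Omega L (fst z), snd z))"
  by (rule lipschitz_of_weak_gradient[OF open_Omega_UNIV _ G f proj_Omega_extension_phase[OF L F(1)]
        proj_Omega_phase_AE[OF L F(2)]])
    (intro convex_Times convex_Omega convex_UNIV)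

lemma norm_phase_le: "norm (z :: phase) \<le> norm (fst z) + norm (snd z)"
  by (metis norm_Pair_le prod.collapse)

lemma norm_fst_snd_le: "norm (fst z) \<le> norm (z::phase)" "norm (snd z) \<le> norm z"
  by (cases z; simp add: norm_fst_le norm_snd_le)+

lemma vlasov_field_lipschitz:
  assumes "M-lipschitz_on UNIV (U :: vec2 \<Rightarrow> vec2)"
  shows "(M + 2)-lipschitz_on UNIV (\<lambda>z :: phase. (snd z, U (fst z) - snd z))"
proof (rule lipschitz_onI)
  have M: "0 \<le> M" by (rule lipschitz_on_nonneg[OF assms])
  then show "0 \<le> M + 2" by simp
  fix z y :: phase
  have "norm (U (fst z) - U (fst y)) \<le> M * norm (fst z - fst y)"
    using lipschitz_onD[OF assms] by (simp add: dist_norm)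
  also have "\<dots> \<le> M * norm (z - y)"
    using norm_fst_snd_le(1)[of "z - y"] M by (intro mult_left_mono) auto
  finally have 1: "norm (U (fst z) - U (fst y)) \<le> M * norm (z - y)" .
  have 2: "norm (snd z - snd y) \<le> norm (z - y)" using norm_fst_snd_le(2)[of "z - y"] by simp
  have "dist (snd z, U (fst z) - snd z) (snd y, U (fst y) - snd y)
     \<le> norm (snd z - snd y) + norm ((U (fst z) - U (fst y)) - (snd z - snd y))"
    using norm_phase_le[of "(snd z, U (fst z) - snd z) - (snd y, U (fst y) - snd y)"]
    by (simp add: dist_norm algebra_simps)
  also have "norm ((U (fst z) - U (fst y)) - (snd z - snd y)) \<le> norm (U (fst z) - U (fst y)) + norm (snd z - snd y)"
    by (rule norm_triangle_ineq4)
  finally show "dist (snd z, U (fst z) - snd z) (snd y, U (fst y) - snd y) \<le> (M + 2) * dist z y"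
    using 1 2 by (simp add: dist_norm algebra_simps)
qed

text \<open>\<open>transport_along_curve\<close> in phase space. The field (v, u - v) has divergence
  -2, one unit for each velocity direction, hence the weight exp(-2t). The driving velocity
  \<open>q\<close> may differ from \<open>u\<close>: this is how the density of one solution is
  followed along the characteristics of the other.\<close>

lemma vlasov_transport:
  fixes f F :: "phase \<Rightarrow> real" and u :: "vec2 \<Rightarrow> vec2"
  assumes L: "0 < L" and f: "f \<in> borel_measurable (lebesgue_on (Omega L \<times> UNIV))"
    and G: "is_weak_gradient (Omega L \<times> UNIV) f G" "AE z in lebesgue_on (Omega L \<times> UNIV). norm (G z) \<le> l" "0 \<le> l"
    and F: "continuous_on (closure (Omega L) \<times> UNIV) F" "AE z in lebesgue_on (Omega L \<times> UNIV). f z = F z"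
    and u: "continuous_on (closure (Omega L)) u" "M-lipschitz_on (Omega L) u" "vlasov L u f"
    and ab: "a < b" and X\<Omega>: "\<And>t. t \<in> {a<..b} \<Longrightarrow> X t \<in> Omega L"
    and X: "\<And>t. t \<in> {a..b} \<Longrightarrow> (X has_vector_derivative V t) (at t within {a..b})"
    and V: "\<And>t. t \<in> {a..b} \<Longrightarrow> (V has_vector_derivative q t - V t) (at t within {a..b})"
    and k: "\<And>t. t \<in> {a<..b} \<Longrightarrow> norm (q t - u (X t)) \<le> k t"
    and B: "\<And>t. t \<in> {a..b} \<Longrightarrow> (B has_vector_derivative k t) (at t within {a..b})"
  shows "\<bar>exp (- 2 * b) * F (X b, V b) - exp (- 2 * a) * F (X a, V a)\<bar> \<le> exp (- 2 * a) * (l * (B b - B a))"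
proof -
  let ?S = "Omega L \<times> (UNIV::vec2 set)"
  let ?F = "\<lambda>z. F (proj_Omega L (fst z), snd z)"
  let ?U = "\<lambda>x. u (proj_Omega L x)"
  let ?A = "\<lambda>z::phase. (snd z, ?U (fst z) - snd z)"
  note p = proj_Omega[OF L]
  note cF = proj_Omega_extension_phase[OF L F(1)]
  note FA = proj_Omega_phase_AE[OF L F(2)]
  note cU = proj_Omega_extension(1)[OF L u(1)]
  note lU = proj_Omega_extension(2)[OF L u(1,2)]
  have cA: "continuous_on UNIV ?A"
    by (intro continuous_intros continuous_on_compose2[OF cU[of UNIV]]) auto
  \<comment> \<open>Inside the pipe the extended field and the continuous representative agree with
    \<open>u\<close> and, up to a null set, with \<open>f\<close>; outside, the derivative of the
    test function vanishes. So the equation turns into an integral over the whole space.\<close>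
  have weak: "(LINT z|lborel. ?F z * frechet_derivative \<phi> (at z) (?A z)) = 0" if \<phi>: "\<phi> \<in> test_functions ?S"
    for \<phi> :: "phase \<Rightarrow> real"
  proof -
    have sm: "Ck k \<phi>" for k using \<phi> by (simp add: test_functions_def)
    let ?C = "closure (support_on UNIV \<phi>)"
    have C: "compact ?C" "?C \<subseteq> ?S" using \<phi> by (auto simp: test_functions_def)
    have D0: "frechet_derivative \<phi> (at z) = (\<lambda>h. 0)" if "z \<notin> ?C" for z
      by (rule frechet_derivative_zero_outside_support[of \<phi> ?C])
        (use that closure_subset[of "support_on UNIV \<phi>"] in \<open>auto simp: support_on_def\<close>)
    have c: "continuous_on UNIV (\<lambda>z. frechet_derivative \<phi> (at z) (?A z))"
      by (intro continuous_on_smooth_derivative[OF sm] cA continuous_intros)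
    have "(LINT z|lborel. ?F z * frechet_derivative \<phi> (at z) (?A z)) =
       (LINT z|lebesgue_on ?S. ?F z * frechet_derivative \<phi> (at z) (?A z))"
    proof (rule LINT_lebesgue_on_eq_lborel[OF open_Omega_UNIV, symmetric])
      show "(\<lambda>z. ?F z * frechet_derivative \<phi> (at z) (?A z)) \<in> borel_measurable borel"
        by (intro borel_measurable_continuous_onI continuous_intros cF c)
      show "z \<in> ?S" if "?F z * frechet_derivative \<phi> (at z) (?A z) \<noteq> 0" for z
        using that D0[of z] C(2) by (cases "z \<in> ?C") auto
    qed
    also have "\<dots> = (LINT z|lebesgue_on ?S. f z * frechet_derivative \<phi> (at z) (?A z))"
    proof (rule integral_cong_AE)
      show "(\<lambda>z. ?F z * frechet_derivative \<phi> (at z) (?A z)) \<in> borel_measurable (lebesgue_on ?S)"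
        by (intro borel_measurable_lebesgue_on_continuous continuous_intros cF c)
      show "(\<lambda>z. f z * frechet_derivative \<phi> (at z) (?A z)) \<in> borel_measurable (lebesgue_on ?S)"
        by (intro borel_measurable_times f borel_measurable_lebesgue_on_continuous c)
      show "AE z in lebesgue_on ?S. ?F z * frechet_derivative \<phi> (at z) (?A z) = f z * frechet_derivative \<phi> (at z) (?A z)"
        using FA by eventually_elim simp
    qed
    also have "\<dots> = (LINT z|lebesgue_on ?S. f z * frechet_derivative \<phi> (at z) (snd z, u (fst z) - snd z))"
    proof (rule Bochner_Integration.integral_cong[OF refl])
      fix z assume "z \<in> space (lebesgue_on ?S)"
      then have "fst z \<in> closure (Omega L)"
        using closure_subset[of "Omega L"] by (auto simp: space_restrict_space)
      then show "f z * frechet_derivative \<phi> (at z) (?A z) = f z * frechet_derivative \<phi> (at z) (snd z, u (fst z) - snd z)"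
        by (simp add: p(2))
    qed
    also have "\<dots> = 0" using u(3) \<phi> by (simp add: vlasov_def)
    finally show ?thesis .
  qed
  let ?Z = "\<lambda>t. (X t, V t)" and ?Q = "\<lambda>t. (V t, q t - V t)"
  have dZ: "(?Z has_vector_derivative ?Q t) (at t within {a..b})" if "t \<in> {a..b}" for t
    using has_vector_derivative_Pair[OF X[OF that] V[OF that]] .
  have cZ: "continuous_on {a..b} ?Z" "continuous_on {a..b} B"
    using dZ B by (meson continuous_on_eq_continuous_within has_vector_derivative_continuous)+
  \<comment> \<open>Mollifier balls need room inside the open pipe, but the curve may start on the
    boundary. The estimate is proved from any later time \<open>c\<close>, and \<open>c\<close> then
    tends to \<open>a\<close> by continuity of \<open>F\<close> up to the boundary.\<close>
  have main: "\<bar>exp (- 2 * b) * ?F (?Z b) - exp (- 2 * c) * ?F (?Z c)\<bar> \<le> exp (- 2 * c) * (l * (B b - B c))"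
    if c: "c \<in> {a<..b}" for c
  proof (rule transport_along_curve[where S="?S" and A="?A" and M="M + 2" and k=k and Q="?Q"
        and F="?F" and Z="?Z" and l=l and K=2 and B=B and a=c and b=b and \<kappa>="\<lambda>b. if fst b = 0 then 1 else 0"])
    show "open ?S" by (rule open_Omega_UNIV)
    show "l-lipschitz_on ?S ?F" by (rule lipschitz_of_weak_gradient_phase[OF L f G F])
    show "\<bar>LINT y|lborel. frechet_derivative \<eta> (at (z - y)) h *\<^sub>R ?F y\<bar> \<le> l * norm h"
      if "is_mollifier r \<eta>" "cball z r \<subseteq> ?S" for r \<eta> z h
      by (rule weak_gradient_mol_bound[OF open_Omega_UNIV G(1,2) f cF FA that])
    show "(M + 2)-lipschitz_on ?S ?A"
      by (rule lipschitz_on_subset[OF vlasov_field_lipschitz[OF lU]]) simp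
    show "?A (y + t *\<^sub>R b) \<bullet> b = ?A y \<bullet> b - t * (if fst b = 0 then 1 else 0)" if "b \<in> Basis" for b y and t :: real
      using that by (auto simp: Basis_prod_def inner_diff_left inner_add_left)
    show "(\<Sum>b\<in>(Basis::phase set). if fst b = 0 then 1 else 0) = (2::real)"
    proof -
      have "(\<Sum>b\<in>(Basis::phase set). if fst b = 0 then 1 else 0) =
         (\<Sum>b\<in>(\<lambda>i. (0::vec2, i::vec2)) ` Basis. 1::real)"
        by (rule sum.mono_neutral_cong_right) (auto simp: Basis_prod_def)
      also have "\<dots> = 2" by (subst sum.reindex) (auto simp: inj_on_def)
      finally show ?thesis .
    qed
    show "norm (?Q t - ?A (?Z t)) \<le> k t" if "t \<in> {c..b}" for t
    proof -
      have t: "t \<in> {a<..b}" using that c by auto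
      have "proj_Omega L (X t) = X t" using p(2) X\<Omega>[OF t] closure_subset by blast
      then show ?thesis using k[OF t] by (simp add: norm_Pair)
    qed
    show "(?Z has_vector_derivative ?Q t) (at t within {c..b})" if "t \<in> {c..b}" for t
      by (rule has_vector_derivative_within_subset[OF dZ]) (use that c in auto)
    show "(B has_vector_derivative k t) (at t within {c..b})" if "t \<in> {c..b}" for t
      by (rule has_vector_derivative_within_subset[OF B]) (use that c in auto)
  qed (use weak cF cA X\<Omega> c in auto)
  have "((\<lambda>c. \<bar>exp (- 2 * b) * ?F (?Z b) - exp (- 2 * c) * ?F (?Z c)\<bar>) \<longlongrightarrow>
      \<bar>exp (- 2 * b) * ?F (?Z b) - exp (- 2 * a) * ?F (?Z a)\<bar>) (at_right a)"
  proof -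
    have "continuous_on {a..b} (\<lambda>c. \<bar>exp (- 2 * b) * ?F (?Z b) - exp (- 2 * c) * ?F (?Z c)\<bar>)"
      by (intro continuous_intros continuous_on_compose2[OF cF[of UNIV] cZ(1)]) auto
    then show ?thesis using ab by (rule continuous_on_Icc_at_rightD)
  qed
  moreover have "((\<lambda>c. exp (- 2 * c) * (l * (B b - B c))) \<longlongrightarrow> exp (- 2 * a) * (l * (B b - B a))) (at_right a)"
  proof -
    have "continuous_on {a..b} (\<lambda>c. exp (- 2 * c) * (l * (B b - B c)))"
      by (intro continuous_intros cZ(2))
    then show ?thesis using ab by (rule continuous_on_Icc_at_rightD)
  qed
  moreover have "\<forall>\<^sub>F c in at_right a. \<bar>exp (- 2 * b) * ?F (?Z b) - exp (- 2 * c) * ?F (?Z c)\<bar>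
      \<le> exp (- 2 * c) * (l * (B b - B c))"
    using main ab by (auto simp: eventually_at_right[OF ab] intro!: exI[of _ b])
  ultimately have "\<bar>exp (- 2 * b) * ?F (?Z b) - exp (- 2 * a) * ?F (?Z a)\<bar> \<le> exp (- 2 * a) * (l * (B b - B a))"
    by (intro tendsto_le[of "at_right a"]) auto
  moreover have "proj_Omega L (X b) = X b" using p(2) X\<Omega>[of b] closure_subset[of "Omega L"] ab by auto
  moreover have "X a \<in> closure (Omega L)"
  proof -
    have "continuous_on {a..b} X" using X by (meson continuous_on_eq_continuous_within has_vector_derivative_continuous)
    then have "(X \<longlongrightarrow> X a) (at_right a)" using ab by (rule continuous_on_Icc_at_rightD)
    moreover have "\<forall>\<^sub>F c in at_right a. X c \<in> closure (Omega L)"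
      using X\<Omega> ab closure_subset[of "Omega L"] by (auto simp: eventually_at_right[OF ab] intro!: exI[of _ b])
    ultimately show ?thesis by (intro Lim_in_closed_set[OF closed_closure]) auto
  qed
  ultimately show ?thesis by (simp add: p(2))
qed


section \<open>Exit from the pipe\<close>

text \<open>The definite description denotes the solution because Lipschitz fields have unique
  trajectories.\<close>

lemma characteristic_eq:
  assumes "C-lipschitz_on UNIV (P u)" "Z s = z"
    "\<And>r. (Z has_vector_derivative (snd (Z r), P u (fst (Z r)) - snd (Z r))) (at r)"
  shows "characteristic P u s t z = Z t"
proof -
  have "(THE Z. Z s = z \<and>
        (\<forall>r. (Z has_vector_derivative (snd (Z r), P u (fst (Z r)) - snd (Z r))) (at r))) = Z"
  proof (rule the_equality)
    fix Y assume "Y s = z \<and> (\<forall>r. (Y has_vector_derivative (snd (Y r), P u (fst (Y r)) - snd (Y r))) (at r))"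
    then show "Y = Z"
      using ode_unique[OF vlasov_field_lipschitz[OF assms(1)], of Y s Z] assms(2,3) by auto
  qed (use assms(2,3) in auto)
  then show ?thesis by (simp add: characteristic_def)
qed

text \<open>\<open>P u\<close> agrees with \<open>u\<close> only almost everywhere in the pipe. The
  \<open>Lip\<close> bound makes \<open>P u\<close> continuous, so the agreement spreads to every
  point and then to the closure.\<close>

lemma extension_operator_Lip:
  assumes L: "0 < L" and P: "extension_operator (Omega L) P"
    and u: "u \<in> Linf (Omega L)" "u \<in> Lip (Omega L)" "continuous_on (closure (Omega L)) u"
  obtains C where "C-lipschitz_on UNIV (P u)" "\<And>x. x \<in> closure (Omega L) \<Longrightarrow> P u x = u x"
proof -
  obtain c where c: "0 \<le> c" "Lip_norm UNIV (P u) \<le> ennreal c * Lip_norm (Omega L) u"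
    using P u(2) unfolding extension_operator_def by blast
  have "Lip_norm UNIV (P u) < top"
    using c u(2) by (auto simp: Lip_def ennreal_mult_less_top intro: le_less_trans)
  then have "(INF C\<in>{C. C-lipschitz_on UNIV (P u)}. ennreal C) < top"
    unfolding Lip_norm_def by (metis add_top ennreal_add_less_top order_less_irrefl top.not_eq_extremum)
  \<comment> \<open>The infimum over the empty set is \<open>top\<close>, so finiteness yields a
    Lipschitz constant.\<close>
  then have "{C. C-lipschitz_on UNIV (P u)} \<noteq> {}"
    by (metis (mono_tags, lifting) Inf_empty image_empty less_irrefl)
  then obtain C where C: "C-lipschitz_on UNIV (P u)" by blast
  have cP: "continuous_on A (P u)" for A
    using lipschitz_on_continuous_on[OF C] continuous_on_subset by blast
  have "AE x in lebesgue_on (Omega L). P u x = u x"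
    using P u(1) unfolding extension_operator_def by blast
  then have ae: "AE x in lebesgue_on (Omega L). P u x - u x \<in> {0}" by eventually_elim simp
  have "P u x - u x \<in> {0}" if "x \<in> Omega L" for x
    by (rule AE_lebesgue_on_closed[OF open_Omega ae _ _ that])
      (intro continuous_intros cP continuous_on_subset[OF u(3) closure_subset], simp)
  then have z: "P u x - u x = 0" if "x \<in> Omega L" for x using that by blast
  have c: "continuous_on (closure (Omega L)) (\<lambda>x. P u x - u x)"
    by (intro continuous_on_diff cP u(3))
  have "P u x - u x = 0" if "x \<in> closure (Omega L)" for x
    by (rule continuous_constant_on_closure[OF c z that])
  then show ?thesis using that[OF C] by simp
qed

text \<open>A form of the exit condition that is stable under perturbation: no trajectory whose
  driving velocity \<open>q\<close> stays within \<delta> of \<open>up\<close> remains in the closed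
  pipe throughout [0, T]. Neither \<open>P\<close> nor the characteristics of a particular field
  appear, so it applies at once to every \<open>u\<close> uniformly close to
  \<open>up\<close>.\<close>

definition exits_within :: "real \<Rightarrow> (vec2 \<Rightarrow> vec2) \<Rightarrow> phase set \<Rightarrow> real \<Rightarrow> real \<Rightarrow> bool" where
  "exits_within L up K T \<delta> \<longleftrightarrow> \<not> (\<exists>X V q. (X 0, V 0) \<in> K \<and> (\<forall>t\<in>{0..T}.
     (X has_vector_derivative V t) (at t within {0..T}) \<and>
     (V has_vector_derivative q t - V t) (at t within {0..T}) \<and>
     X t \<in> closure (Omega L) \<and> norm (q t - up (X t)) \<le> \<delta>))"

text \<open>Each characteristic of \<open>up\<close> from \<open>K\<close> is, at some time before
  \<open>T1\<close>, at positive distance from the closed pipe. Gronwall carries this over to nearby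
  starting points and to perturbed driving velocities, and compactness of \<open>K\<close> makes the
  tolerance uniform.\<close>

lemma egc_exit:
  assumes L: "0 < L" and P: "extension_operator (Omega L) P"
    and up: "up \<in> Linf (Omega L)" "up \<in> Lip (Omega L)" "continuous_on (closure (Omega L)) up"
    and egc: "lateral_EGC L P up T1 K" and K: "compact K" and T1: "T1 > 0"
  obtains \<delta> where "\<delta> > 0" "exits_within L up K T1 \<delta>"
proof -
  obtain C where C: "C-lipschitz_on UNIV (P up)" and Pup: "\<And>x. x \<in> closure (Omega L) \<Longrightarrow> P up x = up x"
    using extension_operator_Lip[OF L P up] by blast
  have C0: "C \<ge> 0" using C lipschitz_on_nonneg by blast
  let ?G = "\<lambda>z::phase. (snd z, P up (fst z) - snd z)"
  note lG = vlasov_field_lipschitz[OF C]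
  have "\<forall>z. \<exists>Z. Z 0 = z \<and> (\<forall>t. (Z has_vector_derivative ?G (Z t)) (at t))"
    using ode_global[OF lG] by metis
  then obtain Y where Y: "\<And>z. Y z 0 = z" "\<And>z t. (Y z has_vector_derivative ?G (Y z t)) (at t)"
    by metis
  have "\<exists>t. 0 < t \<and> t < T1 \<and> fst (Y z t) \<notin> closure (Omega L)" if z: "z \<in> K" for z
  proof -
    \<comment> \<open>The field does not depend on time, so the starting time 0 represents all
      others.\<close>
    have "tau_plus L P up 0 z - ereal 0 \<le> (SUP (s, z)\<in>UNIV \<times> K. tau_plus L P up s z - ereal s)"
      using z by (intro SUP_upper2[of "(0, z)"]) auto
    then have "tau_plus L P up 0 z < ereal T1"
      using egc unfolding lateral_EGC_def by (auto simp flip: zero_ereal_def)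
    then obtain t where "0 < t" "t < T1" "fst (characteristic P up 0 t z) \<notin> closure (Omega L)"
      by (auto simp: tau_plus_def Inf_less_iff)
    moreover have "characteristic P up 0 t z = Y z t"
      by (rule characteristic_eq[where P=P and u=up and Z="Y z", OF C]) (use Y in auto)
    ultimately show ?thesis by auto
  qed
  then obtain t where t: "\<And>z. z \<in> K \<Longrightarrow> 0 < t z \<and> t z < T1 \<and> fst (Y z (t z)) \<notin> closure (Omega L)" by metis
  have "\<exists>d>0. ball (fst (Y z (t z))) d \<inter> closure (Omega L) = {}" if "z \<in> K" for z
  proof -
    have "open (- closure (Omega L))" "fst (Y z (t z)) \<in> - closure (Omega L)" using t[OF that] by auto
    then show ?thesis by (meson disjoint_eq_subset_Compl open_contains_ball)
  qed
  then obtain d where d: "\<And>z. z \<in> K \<Longrightarrow> d z > 0 \<and> ball (fst (Y z (t z))) (d z) \<inter> closure (Omega L) = {}" by metis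
  define E where "E = exp ((2 * (C + 2) + 1) * T1)"
  have E: "E > 0" by (simp add: E_def)
  have gr: "(norm (W \<tau> - Y z \<tau>))\<^sup>2 \<le> ((norm (W 0 - z))\<^sup>2 + e\<^sup>2 * T1) * E"
    if \<tau>: "0 \<le> \<tau>" "\<tau> \<le> T1"
      and W: "\<And>t. t \<in> {0..T1} \<Longrightarrow> (W has_vector_derivative Q t) (at t within {0..T1})"
      and Q: "\<And>t. t \<in> {0..T1} \<Longrightarrow> norm (Q t - ?G (W t)) \<le> e" for W Q e z \<tau>
  proof -
    have "(norm (W \<tau> - Y z \<tau>))\<^sup>2 \<le> ((norm (W 0 - Y z 0))\<^sup>2 + e\<^sup>2 * (\<tau> - 0)) * exp ((2 * (C + 2) + 1) * (\<tau> - 0))"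
    proof (rule gronwall_difference[OF \<tau>(1)])
      show "0 \<le> C + 2" using C0 by simp
      fix t assume t: "t \<in> {0..\<tau>}"
      show "(W has_vector_derivative Q t) (at t within {0..\<tau>})"
        by (rule has_vector_derivative_within_subset[OF W]) (use t \<tau> in auto)
      show "(Y z has_vector_derivative ?G (Y z t)) (at t within {0..\<tau>})"
        by (rule has_vector_derivative_at_within[OF Y(2)])
      have "norm (Q t - ?G (Y z t)) \<le> norm (Q t - ?G (W t)) + norm (?G (W t) - ?G (Y z t))"
        using dist_triangle[of "Q t" "?G (Y z t)" "?G (W t)"] by (simp only: dist_norm)
      also have "norm (?G (W t) - ?G (Y z t)) \<le> (C + 2) * norm (W t - Y z t)"
        using lipschitz_onD[OF lG, of "W t" "Y z t"] by (simp only: dist_norm UNIV_I)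
      finally show "norm (Q t - ?G (Y z t)) \<le> (C + 2) * norm (W t - Y z t) + e"
        using Q[of t] t \<tau> by simp
    qed
    also have "\<dots> \<le> ((norm (W 0 - z))\<^sup>2 + e\<^sup>2 * T1) * E"
      unfolding E_def Y(1) using \<tau> C0 by (intro mult_mono add_left_mono mult_left_mono) auto
    finally show ?thesis .
  qed
  \<comment> \<open>Distances grow at most by the factor sqrt E up to time \<open>T1\<close>. Half
    of \<open>d z\<close> is spent on the change of the starting point; the other half is left for
    the perturbation of the field.\<close>
  define \<rho> where "\<rho> z = d z / 2 / sqrt E" for z
  have cont: "norm (fst (Y z' (t z)) - fst (Y z (t z))) < d z / 2" if z: "z \<in> K" "norm (z' - z) < \<rho> z" for z z'
  proof -
    have "(norm (Y z' (t z) - Y z (t z)))\<^sup>2 \<le> ((norm (Y z' 0 - z))\<^sup>2 + 0\<^sup>2 * T1) * E"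
      by (rule gr[of _ _ "\<lambda>r. ?G (Y z' r)"]) (use t[OF z(1)] has_vector_derivative_at_within[OF Y(2)[of z']] in auto)
    also have "\<dots> = (norm (z' - z) * sqrt E)\<^sup>2"
      unfolding Y(1) power_mult_distrib using E by simp
    finally have "norm (Y z' (t z) - Y z (t z)) \<le> norm (z' - z) * sqrt E"
      by (rule power2_le_imp_le) (use E in simp)
    also have "\<dots> < \<rho> z * sqrt E" using z(2) E by (intro mult_strict_right_mono) auto
    also have "\<dots> = d z / 2" using E by (simp add: \<rho>_def)
    finally show ?thesis using norm_fst_snd_le(1)[of "Y z' (t z) - Y z (t z)"] by simp
  qed
  have "K \<subseteq> (\<Union>z\<in>K. ball z (\<rho> z))" using d E by (force simp: \<rho>_def)
  then obtain D where D: "D \<subseteq> K" "finite D" "K \<subseteq> (\<Union>z\<in>D. ball z (\<rho> z))"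
    using compactE_image[OF K, of K "\<lambda>z. ball z (\<rho> z)"] by auto
  obtain d0 where d0: "d0 > 0" "\<And>z. z \<in> D \<Longrightarrow> d0 \<le> d z / 2"
  proof (cases "D = {}")
    case True then show ?thesis using that[of 1] by simp
  next
    case False
    show ?thesis
    proof (rule that)
      have "d z > 0" if "z \<in> D" for z using d D(1) that by blast
      then show "Min ((\<lambda>z. d z / 2) ` D) > 0" using D(2) False by simp
      show "Min ((\<lambda>z. d z / 2) ` D) \<le> d z / 2" if "z \<in> D" for z
        using D(2) that by (intro Min_le) auto
    qed
  qed
  \<comment> \<open>A field error \<delta> causes a deviation of at most \<delta> sqrt(T1 E) = d0 /
    2, which is below d z / 2 for every centre \<open>z\<close> of the finite cover.\<close>
  define \<delta> where "\<delta> = d0 / 2 / sqrt (T1 * E)"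
  have \<delta>: "\<delta> > 0" using d0 T1 E by (simp add: \<delta>_def)
  show ?thesis
  proof (rule that[OF \<delta>], unfold exits_within_def, rule notI, elim exE conjE)
    fix X V q
    assume init: "(X 0, V 0) \<in> K" and all: "\<forall>t\<in>{0..T1}. (X has_vector_derivative V t) (at t within {0..T1}) \<and>
      (V has_vector_derivative q t - V t) (at t within {0..T1}) \<and>
      X t \<in> closure (Omega L) \<and> norm (q t - up (X t)) \<le> \<delta>"
    then have X: "\<And>t. t \<in> {0..T1} \<Longrightarrow> (X has_vector_derivative V t) (at t within {0..T1})"
      and V: "\<And>t. t \<in> {0..T1} \<Longrightarrow> (V has_vector_derivative q t - V t) (at t within {0..T1})"
      and in_\<Omega>: "\<And>t. t \<in> {0..T1} \<Longrightarrow> X t \<in> closure (Omega L)"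
      and q: "\<And>t. t \<in> {0..T1} \<Longrightarrow> norm (q t - up (X t)) \<le> \<delta>"
      by blast+
    let ?z = "(X 0, V 0)"
    obtain z where z: "z \<in> D" "?z \<in> ball z (\<rho> z)" using D(3) init by blast
    have zK: "z \<in> K" using z D by auto
    have 1: "norm (fst (Y ?z (t z)) - fst (Y z (t z))) < d z / 2"
      using cont[OF zK, of ?z] z(2) by (simp add: dist_norm norm_minus_commute)
    have "(norm ((X (t z), V (t z)) - Y ?z (t z)))\<^sup>2 \<le> ((norm ((X 0, V 0) - ?z))\<^sup>2 + \<delta>\<^sup>2 * T1) * E"
    proof (rule gr[of _ "\<lambda>t. (X t, V t)" "\<lambda>t. (V t, q t - V t)"])
      show "norm ((V t, q t - V t) - (snd (X t, V t), P up (fst (X t, V t)) - snd (X t, V t))) \<le> \<delta>" if "t \<in> {0..T1}" for t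
        using q[OF that] Pup[OF in_\<Omega>[OF that]] by (simp add: norm_Pair)
    qed (use t[OF zK] has_vector_derivative_Pair[OF X V] in auto)
    also have "\<dots> = (\<delta> * sqrt (T1 * E))\<^sup>2"
    proof -
      have "(sqrt (T1 * E))\<^sup>2 = T1 * E" using E T1 by (intro real_sqrt_pow2) simp
      then show ?thesis unfolding power_mult_distrib by simp
    qed
    also have "\<delta> * sqrt (T1 * E) = d0 / 2"
    proof -
      have "sqrt (T1 * E) \<noteq> 0" using E T1 by simp
      moreover have "a / s * s = a" if "s \<noteq> 0" for a s :: real using that by simp
      ultimately show ?thesis unfolding \<delta>_def by blast
    qed
    finally have "norm ((X (t z), V (t z)) - Y ?z (t z)) \<le> d0 / 2"
      by (rule power2_le_imp_le) (use d0(1) in simp)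
    then have "norm (X (t z) - fst (Y ?z (t z))) < d z / 2"
      using norm_fst_snd_le(1)[of "(X (t z), V (t z)) - Y ?z (t z)"] d0(1) d0(2)[OF z(1)] by simp
    moreover have "norm (X (t z) - fst (Y z (t z))) \<le>
       norm (X (t z) - fst (Y ?z (t z))) + norm (fst (Y ?z (t z)) - fst (Y z (t z)))"
      using dist_triangle[of "X (t z)" "fst (Y z (t z))" "fst (Y ?z (t z))"] by (simp only: dist_norm)
    ultimately have "norm (X (t z) - fst (Y z (t z))) < d z" using 1 by simp
    then have "X (t z) \<in> ball (fst (Y z (t z))) (d z)" by (simp add: dist_norm norm_minus_commute)
    moreover have "X (t z) \<in> closure (Omega L)" using in_\<Omega>[of "t z"] t[OF zK] by auto
    ultimately show False using d[OF zK] by auto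
  qed
qed

section \<open>Boundary values at incoming points\<close>

lemma zero_along_path:
  fixes F :: "'a::topological_space \<Rightarrow> real" and p :: "real \<Rightarrow> 'a"
  assumes F: "continuous_on D F" and p: "continuous_on {0..1/2} p" "\<And>e. e \<in> {0..1/2} \<Longrightarrow> p e \<in> D"
    and z: "\<forall>\<^sub>F e in at_right 0. F (p e) = 0"
  shows "F (p 0) = 0"
proof -
  have "continuous_on {0..1/2} (\<lambda>e. F (p e))"
    by (rule continuous_on_compose2[OF F p(1)]) (use p(2) in auto)
  then have "((\<lambda>e. F (p e)) \<longlongrightarrow> F (p 0)) (at_right 0)" by (rule continuous_on_Icc_at_rightD) simp
  moreover have "((\<lambda>e. F (p e)) \<longlongrightarrow> 0) (at_right 0)"
    by (rule tendsto_eventually[OF z])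
  ultimately show ?thesis by (intro tendsto_unique[of "at_right (0::real)"]) auto
qed

text \<open>Data are prescribed only off the corners and for strictly incoming velocities, whereas a
  characteristic may enter through a corner or tangentially. Every boundary point with a
  non-outgoing velocity is nevertheless a limit of points that carry a datum, and \<open>F\<close>
  is continuous up to the boundary.\<close>

lemma incoming_boundary_value:
  fixes F \<psi> :: "phase \<Rightarrow> real"
  assumes L: "0 < L" and F: "continuous_on (closure (Omega L) \<times> UNIV) F"
    and l: "\<And>z. z \<in> Gamma_l L \<Longrightarrow> F z = \<psi> z"
    and rud: "\<And>z. z \<in> Gamma_r L \<union> Gamma_u L \<union> Gamma_d L \<Longrightarrow> F z = 0"
    and K: "closed K" "K \<subseteq> Gamma_l L" "\<And>z. z \<in> Gamma_l L \<Longrightarrow> z \<notin> K \<Longrightarrow> \<psi> z = 0"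
    and x: "x \<in> frontier (Omega L)"
    and inc: "x$1 = - L \<Longrightarrow> v$1 \<ge> 0" "x$1 = L \<Longrightarrow> v$1 \<le> 0" "x$2 = 1 \<Longrightarrow> v$2 \<le> 0" "x$2 = - 1 \<Longrightarrow> v$2 \<ge> 0"
    and nz: "F (x, v) \<noteq> 0"
  shows "(x, v) \<in> K"
proof -
  have xc: "- L \<le> x$1" "x$1 \<le> L" "- 1 \<le> x$2" "x$2 \<le> 1"
    using x unfolding frontier_Omega[OF L] closure_Omega[OF L] by auto
  \<comment> \<open>A path towards (x, v): \<open>a\<close> and \<open>b\<close>, each 0 or 1,
    decide which coordinates are pulled towards the axis, away from the corners, and (c, d) tilts
    the velocity strictly into the pipe.\<close>
  define p where "p a b c d e = (vector [(1 - a * e) * x$1, (1 - b * e) * x$2] :: vec2, v + e *\<^sub>R (vector [c, d] :: vec2))"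
    for a b c d e :: real
  have xa: "\<bar>x$1\<bar> \<le> L" "\<bar>x$2\<bar> \<le> 1" using xc by auto
  have p0: "p a b c d 0 = (x, v)" for a b c d by (simp add: p_def vec_eq_iff forall_2)
  have pc: "continuous_on A (p a b c d)" for a b c d A
  proof -
    have "p a b c d = (\<lambda>e. (((1 - a * e) * x$1) *\<^sub>R axis 1 1 + ((1 - b * e) * x$2) *\<^sub>R axis 2 1, v + e *\<^sub>R vector [c, d]))"
      by (auto simp: p_def fun_eq_iff vec_eq_iff forall_2 axis_def)
    then show ?thesis by (simp only:) (intro continuous_intros)
  qed
  have sm: "\<bar>(1 - a * e) * y\<bar> \<le> M" if "\<bar>y\<bar> \<le> M" "a \<in> {0, 1}" "e \<in> {0..1/2}" for a e y M :: real
  proof -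
    have "\<bar>(1 - a * e) * y\<bar> \<le> 1 * M"
      unfolding abs_mult using that by (intro mult_mono) auto
    then show ?thesis by simp
  qed
  have ss: "\<bar>(1 - 1 * e) * y\<bar> < M" if "\<bar>y\<bar> \<le> M" "0 < M" "0 < e" "e < 1/2" for e y M :: real
  proof -
    have "\<bar>(1 - 1 * e) * y\<bar> \<le> (1 - e) * M"
      unfolding abs_mult using that by (intro mult_mono) auto
    also have "\<dots> < M" using that by (simp add: algebra_simps)
    finally show ?thesis .
  qed
  have pD: "p a b c d e \<in> closure (Omega L) \<times> UNIV" if "a \<in> {0, 1}" "b \<in> {0, 1}" "e \<in> {0..1/2}" for a b c d e
    using sm[OF xa(1), of a e] sm[OF xa(2), of b e] that
    by (auto simp: p_def closure_Omega[OF L] abs_le_iff)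
  have zero: "F (x, v) = 0" if "a \<in> {0, 1}" "b \<in> {0, 1}" "\<forall>\<^sub>F e in at_right 0. F (p a b c d e) = 0" for a b c d
    using zero_along_path[OF F pc pD[OF that(1,2)] that(3)] by (simp add: p0)
  have ev: "\<forall>\<^sub>F e in at_right (0::real). 0 < e \<and> e < 1/2"
    by (simp add: eventually_at_right[of 0 1]) (intro exI[of _ "1/2"], auto)
  have n3: "x$2 \<noteq> 1"
  proof
    assume 1: "x$2 = 1"
    have "\<forall>\<^sub>F e in at_right 0. F (p 1 0 0 (-1) e) = 0"
      using ev
    proof eventually_elim
      case (elim e)
      then have "p 1 0 0 (-1) e \<in> Gamma_u L"
        using ss[OF xa(1) L, of e] xc L 1 inc(3) by (auto simp: p_def Gamma_u_def abs_less_iff)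
      then show ?case using rud by blast
    qed
    then show False using zero[of 1 0 0 "-1"] nz by simp
  qed
  have n4: "x$2 \<noteq> - 1"
  proof
    assume 1: "x$2 = - 1"
    have "\<forall>\<^sub>F e in at_right 0. F (p 1 0 0 1 e) = 0"
      using ev
    proof eventually_elim
      case (elim e)
      then have "p 1 0 0 1 e \<in> Gamma_d L"
        using ss[OF xa(1) L, of e] xc L 1 inc(4) by (auto simp: p_def Gamma_d_def abs_less_iff)
      then show ?case using rud by blast
    qed
    then show False using zero[of 1 0 0 1] nz by simp
  qed
  have n2: "x$1 \<noteq> L"
  proof
    assume 1: "x$1 = L"
    have "\<forall>\<^sub>F e in at_right 0. F (p 0 1 (-1) 0 e) = 0"
      using ev
    proof eventually_elim
      case (elim e)
      then have "p 0 1 (-1) 0 e \<in> Gamma_r L"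
        using ss[OF xa(2), of e] xc L 1 inc(2) by (auto simp: p_def Gamma_r_def abs_less_iff)
      then show ?case using rud by blast
    qed
    then show False using zero[of 0 1 "-1" 0] nz by simp
  qed
  have x1: "x$1 = - L" "- 1 < x$2" "x$2 < 1"
    using x n2 n3 n4 xc unfolding frontier_Omega[OF L] by auto
  show ?thesis
  proof (rule ccontr)
    \<comment> \<open>Off \<open>K\<close> the inflow datum vanishes. As \<open>K\<close> is closed,
      the tilted path also stays off \<open>K\<close> near its end, which forces the value
      0.\<close>
    assume nK: "(x, v) \<notin> K"
    have "\<forall>\<^sub>F e in at_right 0. p 0 0 1 0 e \<in> - K"
    proof -
      have "(p 0 0 1 0 \<longlongrightarrow> p 0 0 1 0 0) (at_right 0)"
        using pc[of UNIV 0 0 1 0] by (auto simp: continuous_on_def intro: tendsto_within_subset)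
      then show ?thesis using K(1) nK p0 by (intro topological_tendstoD) auto
    qed
    then have "\<forall>\<^sub>F e in at_right 0. F (p 0 0 1 0 e) = 0"
      using ev
    proof eventually_elim
      case (elim e)
      then have "p 0 0 1 0 e \<in> Gamma_l L"
        using x1 inc(1) by (auto simp: p_def Gamma_l_def)
      then show ?case using l K(3) elim by auto
    qed
    then show False using zero[of 0 0 1 0] nz by simp
  qed
qed


section \<open>Dependence of the density on the velocity field\<close>

text \<open>The kinetic half of a stationary solution near (u_p, 0): \<open>F\<close> is the
  continuous representative of the class \<open>f\<close>, and 1/8 is the Lipschitz constant under
  which \<open>friction_backward_separation\<close> applies.\<close>

definition small_kinetic_solution :: "real \<Rightarrow> real \<Rightarrow> (vec2 \<Rightarrow> vec2) \<Rightarrow> (phase \<Rightarrow> real) \<Rightarrow> (phase \<Rightarrow> real) \<Rightarrow> bool" where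
  "small_kinetic_solution L l u f F \<longleftrightarrow>
     f \<in> borel_measurable (lebesgue_on (Omega L \<times> UNIV)) \<and>
     (\<exists>G. is_weak_gradient (Omega L \<times> UNIV) f G \<and> (AE z in lebesgue_on (Omega L \<times> UNIV). norm (G z) \<le> l)) \<and>
     continuous_on (closure (Omega L) \<times> UNIV) F \<and>
     (AE z in lebesgue_on (Omega L \<times> UNIV). f z = F z) \<and>
     continuous_on (closure (Omega L)) u \<and> (1/8)-lipschitz_on (Omega L) u \<and> vlasov L u f"

lemma small_kinetic_solution_transport:
  assumes "small_kinetic_solution L l u f F" "0 < L" "0 \<le> l"
    and "a < b" "\<And>t. t \<in> {a<..b} \<Longrightarrow> X t \<in> Omega L"
    and "\<And>t. t \<in> {a..b} \<Longrightarrow> (X has_vector_derivative V t) (at t within {a..b})"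
    and "\<And>t. t \<in> {a..b} \<Longrightarrow> (V has_vector_derivative q t - V t) (at t within {a..b})"
    and "\<And>t. t \<in> {a<..b} \<Longrightarrow> norm (q t - u (X t)) \<le> k t"
    and "\<And>t. t \<in> {a..b} \<Longrightarrow> (B has_vector_derivative k t) (at t within {a..b})"
  shows "\<bar>exp (- 2 * b) * F (X b, V b) - exp (- 2 * a) * F (X a, V a)\<bar> \<le> exp (- 2 * a) * (l * (B b - B a))"
proof -
  obtain G where "f \<in> borel_measurable (lebesgue_on (Omega L \<times> UNIV))"
     "is_weak_gradient (Omega L \<times> UNIV) f G" "AE z in lebesgue_on (Omega L \<times> UNIV). norm (G z) \<le> l"
     "continuous_on (closure (Omega L) \<times> UNIV) F"
     "AE z in lebesgue_on (Omega L \<times> UNIV). f z = F z"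
     "continuous_on (closure (Omega L)) u" "(1/8)-lipschitz_on (Omega L) u" "vlasov L u f"
    using assms(1) unfolding small_kinetic_solution_def by blast
  from vlasov_transport[OF assms(2) this(1-3) assms(3) this(4-8) assms(4-9)] show ?thesis .
qed

text \<open>Used at the entry time: there a coordinate of the position is extremal on its wall, so
  the velocity cannot point outwards; tangential entry is not excluded.\<close>

lemma derivative_nonneg_of_min_left:
  fixes f :: "real \<Rightarrow> real"
  assumes "(f has_real_derivative D) (at s)" "s < b" "\<And>t. s < t \<Longrightarrow> t \<le> b \<Longrightarrow> f s \<le> f t"
  shows "0 \<le> D"
proof (rule ccontr)
  assume "\<not> 0 \<le> D"
  then obtain d where d: "d > 0" "\<And>h. h > 0 \<Longrightarrow> h < d \<Longrightarrow> f (s + h) < f s"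
    using DERIV_neg_dec_right[OF assms(1)] by auto
  define h where "h = min (d / 2) (b - s)"
  have "h > 0" "h < d" "s + h \<le> b" using d assms(2) by (auto simp: h_def)
  then show False using d(2)[of h] assms(3)[of "s + h"] by auto
qed

lemma has_real_derivative_component:
  fixes X :: "real \<Rightarrow> real^'n"
  assumes "(X has_vector_derivative v) (at t within S)"
  shows "((\<lambda>t. X t $ i) has_real_derivative v $ i) (at t within S)"
  using bounded_linear.has_vector_derivative[OF bounded_linear_vec_nth assms]
  by (simp add: has_real_derivative_iff_has_vector_derivative)

text \<open>Follow the characteristic of \<open>u\<close> back to its last entry. \<open>F\<close>
  is transported exactly, so its mass comes from a point of \<open>K\<close>, where both densities
  equal \<psi>; forward from there \<open>F'\<close> is transported up to the error |u - u'|. In the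
  factor exp(3 T1), 2 T1 comes from the weight exp(-2s) and T1 from the lower bound on the axial
  velocity.\<close>

lemma density_difference_bound_untrapped:
  fixes X V :: "real \<Rightarrow> vec2" and F F' :: "phase \<Rightarrow> real"
  assumes L: "0 < L" and l: "0 \<le> l" and T1: "0 < T1" and c0: "0 < c0"
    and sk: "small_kinetic_solution L l u f F" and sk': "small_kinetic_solution L l u' f' F'"
    and K: "closed K" "K \<subseteq> Gamma_l L" "\<And>z. z \<in> Gamma_l L \<Longrightarrow> z \<notin> K \<Longrightarrow> \<psi> z = 0"
      "\<And>x v. (x, v) \<in> K \<Longrightarrow> c0 \<le> v$1 \<and> norm v \<le> R0"
    and Fl: "\<And>z. z \<in> Gamma_l L \<Longrightarrow> F z = \<psi> z" "\<And>z. z \<in> Gamma_l L \<Longrightarrow> F' z = \<psi> z"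
    and F0: "\<And>z. z \<in> Gamma_r L \<union> Gamma_u L \<union> Gamma_d L \<Longrightarrow> F z = 0"
    and egc: "exits_within L up K T1 \<delta>"
    and u: "\<And>x. x \<in> closure (Omega L) \<Longrightarrow> norm (u x - up x) \<le> \<delta>"
      "\<And>x. x \<in> closure (Omega L) \<Longrightarrow> 0 \<le> u x $ 1"
      "\<And>x. x \<in> closure (Omega L) \<Longrightarrow> norm (u x) \<le> 1"
    and m: "continuous_on {- L..L} m" "\<And>y. y \<in> {- L..L} \<Longrightarrow> 0 \<le> m y"
      "\<And>x. x \<in> Omega L \<Longrightarrow> norm (u x - u' x) \<le> m (x$1)"
    and X: "\<And>t. (X has_vector_derivative V t) (at t)"
    and V: "\<And>t. (V has_vector_derivative u (proj_Omega L (X t)) - V t) (at t)"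
    and x: "X 0 \<in> Omega L" and nz: "F (X 0, V 0) \<noteq> 0"
    and esc: "c \<le> 0" "X c \<notin> Omega L"
  shows "norm (V 0) \<le> R0 + 1 \<and>
     \<bar>F (X 0, V 0) - F' (X 0, V 0)\<bar> \<le> exp (3 * T1) * l / c0 * integral {- L..L} m"
proof -
  note p = proj_Omega[OF L]
  have sub: "Omega L \<subseteq> closure (Omega L)" by (rule closure_subset)
  have cX: "continuous_on A X" for A
    using X by (meson continuous_at_imp_continuous_on has_vector_derivative_continuous)
  obtain s where s: "s < 0" "X s \<in> frontier (Omega L)" "\<And>t. s < t \<Longrightarrow> t \<le> 0 \<Longrightarrow> X t \<in> Omega L"
    using last_exit_before_zero[OF cX open_Omega x esc] by metis
  have Xs: "X s \<in> closure (Omega L)" using s(2) by (simp add: frontier_def)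
  have Xcl: "X t \<in> closure (Omega L)" if "s \<le> t" "t \<le> 0" for t
    using s(3)[of t] Xs that sub by (cases "t = s") auto
  have pX: "proj_Omega L (X t) = X t" if "s \<le> t" "t \<le> 0" for t using p(2)[OF Xcl[OF that]] .
  have dX: "(X has_vector_derivative V t) (at t within A)" for t A
    using X by (rule has_vector_derivative_at_within)
  have dV: "(V has_vector_derivative u (proj_Omega L (X t)) - V t) (at t within A)" for t A
    using V by (rule has_vector_derivative_at_within)
  \<comment> \<open>With zero error and a constant \<open>B\<close>, since the driving velocity is
    \<open>u\<close> itself.\<close>
  have cons: "exp (- 2 * s) * F (X s, V s) = F (X 0, V 0)"
  proof -
    have "\<bar>exp (- 2 * 0) * F (X 0, V 0) - exp (- 2 * s) * F (X s, V s)\<bar> \<le> exp (- 2 * s) * (l * (0 - 0))"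
      by (rule small_kinetic_solution_transport[OF sk L l s(1) s(3) dX dV, of "\<lambda>t. 0" "\<lambda>t. 0"])
        (use pX in \<open>auto intro!: derivative_eq_intros\<close>)
    then show ?thesis by simp
  qed
  have in_K: "(X s, V s) \<in> K"
  proof (rule incoming_boundary_value[OF L _ Fl(1) F0 K(1-3) s(2)])
    show "continuous_on (closure (Omega L) \<times> UNIV) F" using sk by (simp add: small_kinetic_solution_def)
    show "F (X s, V s) \<noteq> 0" using cons nz by auto
    note d = has_real_derivative_component[OF X[of s]]
    show "X s $ 1 = - L \<Longrightarrow> 0 \<le> V s $ 1"
      by (rule derivative_nonneg_of_min_left[OF d s(1)]) (use s(3) in \<open>force simp: Omega_def\<close>)
    show "X s $ 2 = - 1 \<Longrightarrow> 0 \<le> V s $ 2"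
      by (rule derivative_nonneg_of_min_left[OF d s(1)]) (use s(3) in \<open>force simp: Omega_def\<close>)
    have "0 \<le> - V s $ 1" if "X s $ 1 = L"
      by (rule derivative_nonneg_of_min_left[OF DERIV_minus[OF d] s(1)]) (use s(3) that in \<open>force simp: Omega_def\<close>)
    then show "X s $ 1 = L \<Longrightarrow> V s $ 1 \<le> 0" by simp
    have "0 \<le> - V s $ 2" if "X s $ 2 = 1"
      by (rule derivative_nonneg_of_min_left[OF DERIV_minus[OF d] s(1)]) (use s(3) that in \<open>force simp: Omega_def\<close>)
    then show "X s $ 2 = 1 \<Longrightarrow> V s $ 2 \<le> 0" by simp
  qed auto
  \<comment> \<open>Shifted in time so as to start at its entry point, the curve is a trajectory of
    the kind that \<open>exits_within\<close> forbids to stay for the time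
    \<open>T1\<close>.\<close>
  have sT: "- s < T1"
  proof (rule ccontr)
    assume "\<not> - s < T1"
    then have sT: "s + T1 \<le> 0" by simp
    have sh: "((\<lambda>t. Y (s + t)) has_vector_derivative Y') (at t within A)"
      if "(Y has_vector_derivative Y') (at (s + t))" for Y :: "real \<Rightarrow> vec2" and Y' t A
    proof -
      have "((Y \<circ> (\<lambda>t. s + t)) has_vector_derivative 1 *\<^sub>R Y') (at t)"
        by (rule vector_diff_chain_at) (use that in \<open>auto intro!: derivative_eq_intros\<close>)
      then show ?thesis by (simp add: o_def has_vector_derivative_at_within)
    qed
    have "(X (s + t) \<in> closure (Omega L)) \<and> norm (u (proj_Omega L (X (s + t))) - up (X (s + t))) \<le> \<delta>"
      if "t \<in> {0..T1}" for t
      using Xcl[of "s + t"] pX[of "s + t"] u(1)[of "X (s + t)"] sT that by simp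
    then show False
      using egc in_K sh[OF X] sh[OF V] unfolding exits_within_def
      by (elim notE)
        (intro exI[of _ "\<lambda>t. X (s + t)"] exI[of _ "\<lambda>t. V (s + t)"] exI[of _ "\<lambda>t. u (proj_Omega L (X (s + t)))"], simp)
  qed
  have K4: "c0 \<le> V s $ 1" "norm (V s) \<le> R0" using K(4)[OF in_K] by auto
  \<comment> \<open>As u_1 >= 0, only friction slows the axial velocity, by at most the factor
    exp(-T1) during the stay.\<close>
  define c1 where "c1 = c0 * exp (- T1)"
  have c1: "c1 > 0" using c0 by (simp add: c1_def)
  have V1: "c1 \<le> V t $ 1" if t: "s \<le> t" "t \<le> 0" for t
  proof -
    have "exp s * V s $ 1 \<le> exp t * V t $ 1"
    proof (rule DERIV_nonneg_imp_nondecreasing[OF t(1)])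
      fix r assume r: "s \<le> r" "r \<le> t"
      have "((\<lambda>t. exp t * V t $ 1) has_real_derivative exp r * (u (X r) $ 1)) (at r)"
        using has_real_derivative_component[OF V[of r], of 1] pX[of r] r t
        by (auto intro!: derivative_eq_intros simp: algebra_simps)
      moreover have "0 \<le> exp r * (u (X r) $ 1)" using u(2)[OF Xcl[of r]] r t by simp
      ultimately show "\<exists>y. ((\<lambda>t. exp t * V t $ 1) has_real_derivative y) (at r) \<and> 0 \<le> y" by blast
    qed
    moreover have "exp s * c0 \<le> exp s * V s $ 1" using K4 by simp
    moreover have "exp (- T1) * c0 \<le> exp s * c0" using sT c0 by (intro mult_right_mono) auto
    ultimately have "c1 \<le> exp t * V t $ 1" unfolding c1_def mult.commute[of c0] by linarith
    moreover from this have "0 < V t $ 1" using c1 by (meson exp_gt_zero less_le_trans zero_less_mult_pos)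
    then have "exp t * V t $ 1 \<le> 1 * V t $ 1" using t by (intro mult_right_mono) auto
    ultimately show ?thesis by simp
  qed
  \<comment> \<open>exp(t) V has derivative exp(t) u with |u| <= 1, so velocities gain at most 1 on
    the inflow bound \<open>R0\<close>.\<close>
  have "norm (V 0) \<le> R0 + 1"
  proof -
    have "norm (exp 0 *\<^sub>R V 0 - exp s *\<^sub>R V s) \<le> exp 0 - exp s"
    proof (rule differentiable_bound_general[OF s(1)])
      have "continuous_on {s..0} V" using V by (meson continuous_at_imp_continuous_on has_vector_derivative_continuous)
      then show "continuous_on {s..0} (\<lambda>t. exp t *\<^sub>R V t)" by (intro continuous_intros)
      show "continuous_on {s..0} (exp :: real \<Rightarrow> real)" by (intro continuous_intros)
      fix r :: real assume r: "s < r" "r < 0"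
      show "((\<lambda>t. exp t *\<^sub>R V t) has_vector_derivative exp r *\<^sub>R u (X r)) (at r)"
        using has_vector_derivative_scaleR[OF DERIV_exp[of r] V[of r]] pX[of r] r by (simp add: algebra_simps)
      show "(exp has_vector_derivative exp r) (at r)"
        using DERIV_exp[of r] by (simp add: has_real_derivative_iff_has_vector_derivative)
      show "norm (exp r *\<^sub>R u (X r)) \<le> exp r" using u(3)[OF Xcl[of r]] r by simp
    qed
    moreover have "norm (exp s *\<^sub>R V s) \<le> 1 * R0"
      unfolding norm_scaleR using s(1) K4(2) by (intro mult_mono) auto
    moreover have "norm (V 0) \<le> norm (exp 0 *\<^sub>R V 0 - exp s *\<^sub>R V s) + norm (exp s *\<^sub>R V s)"
      using norm_triangle_sub[of "V 0" "exp s *\<^sub>R V s"] by simp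
    moreover have "exp s > 0" by simp
    ultimately show ?thesis unfolding exp_zero by linarith
  qed
  moreover have "\<bar>F (X 0, V 0) - F' (X 0, V 0)\<bar> \<le> exp (3 * T1) * l / c0 * integral {- L..L} m"
  proof -
    define M where "M y = integral {- L..y} m" for y
    \<comment> \<open>The change of variables from time to x_1: the derivative of \<open>B\<close>
      is m(X_1) V_1 / c1, which dominates m(X_1) because V_1 >= c1, and the increment of
      \<open>B\<close> is an integral of \<open>m\<close> over an interval of x_1.\<close>
    define B where "B t = M (X t $ 1) / c1" for t
    have X1: "X t $ 1 \<in> {- L..L}" if "s \<le> t" "t \<le> 0" for t
      using Xcl[OF that] unfolding closure_Omega[OF L] by simp
    have dB: "(B has_vector_derivative m (X t $ 1) * V t $ 1 / c1) (at t within {s..0})" if t: "t \<in> {s..0}" for t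
    proof -
      have "(M has_vector_derivative m (X t $ 1)) (at (X t $ 1) within {- L..L})"
        unfolding M_def by (rule integral_has_vector_derivative[OF m(1)]) (use X1 t in auto)
      then have "(M has_field_derivative m (X t $ 1)) (at (X t $ 1) within (\<lambda>t. X t $ 1) ` {s..0})"
        unfolding has_real_derivative_iff_has_vector_derivative
        by (rule has_vector_derivative_within_subset) (use X1 in auto)
      from DERIV_image_chain[OF this has_real_derivative_component[OF dX]]
      have "((\<lambda>t. M (X t $ 1)) has_real_derivative m (X t $ 1) * V t $ 1) (at t within {s..0})"
        by (simp add: o_def)
      from DERIV_cdivide[OF this, of c1] show ?thesis
        by (simp add: B_def[abs_def] has_real_derivative_iff_has_vector_derivative)
    qed
    have "\<bar>exp (- 2 * 0) * F' (X 0, V 0) - exp (- 2 * s) * F' (X s, V s)\<bar> \<le> exp (- 2 * s) * (l * (B 0 - B s))"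
    proof (rule small_kinetic_solution_transport[OF sk' L l s(1) s(3) dX dV _ dB])
      fix t assume t: "t \<in> {s<..0}"
      then have X\<Omega>: "X t \<in> Omega L" using s(3) by auto
      have "norm (u (X t) - u' (X t)) \<le> m (X t $ 1) * 1" using m(3)[OF X\<Omega>] by simp
      also have "\<dots> \<le> m (X t $ 1) * (V t $ 1 / c1)"
        using V1[of t] c1 t m(2)[OF X1[of t]] by (intro mult_left_mono) auto
      finally show "norm (u (proj_Omega L (X t)) - u' (X t)) \<le> m (X t $ 1) * V t $ 1 / c1"
        using pX[of t] t by simp
    qed auto
    moreover have "exp (- 2 * s) * F' (X s, V s) = F (X 0, V 0)"
      using cons Fl in_K K(2) by (metis subsetD)
    ultimately have 1: "\<bar>F (X 0, V 0) - F' (X 0, V 0)\<bar> \<le> exp (- 2 * s) * (l * (B 0 - B s))"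
      by (simp add: abs_minus_commute)
    have int: "m integrable_on {a..b}" if "- L \<le> a" "b \<le> L" for a b
      using m(1) that by (intro integrable_continuous_real continuous_on_subset[OF m(1)]) auto
    have "M (X 0 $ 1) \<le> integral {- L..L} m"
      unfolding M_def using X1[of 0] s(1) m(2) by (intro integral_subset_le int) auto
    moreover have "0 \<le> M (X s $ 1)"
      unfolding M_def using X1[of s] s(1) m(2)
      by (intro Henstock_Kurzweil_Integration.integral_nonneg int) auto
    ultimately have "B 0 - B s \<le> integral {- L..L} m / c1"
      using c1 by (simp add: B_def diff_divide_distrib[symmetric] divide_right_mono)
    moreover have I0: "0 \<le> integral {- L..L} m / c1"
      using c1 m(2) by (intro divide_nonneg_pos Henstock_Kurzweil_Integration.integral_nonneg int) auto
    ultimately have "exp (- 2 * s) * (l * (B 0 - B s)) \<le> exp (2 * T1) * (l * (integral {- L..L} m / c1))"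
    proof -
      have "exp (- 2 * s) * (l * (B 0 - B s)) \<le> exp (- 2 * s) * (l * (integral {- L..L} m / c1))"
        using \<open>B 0 - B s \<le> _\<close> l by (intro mult_left_mono) auto
      also have "\<dots> \<le> exp (2 * T1) * (l * (integral {- L..L} m / c1))"
        by (intro mult_right_mono mult_nonneg_nonneg l I0) (use sT in simp)
      finally show ?thesis .
    qed
    also have "\<dots> = exp (3 * T1) * l / c0 * integral {- L..L} m"
    proof -
      have "exp (3 * T1) = exp (2 * T1) * exp T1" by (simp flip: exp_add)
      then show ?thesis using c0 by (simp add: c1_def exp_minus field_simps)
    qed
    finally show ?thesis using 1 by simp
  qed
  ultimately show ?thesis ..
qed

text \<open>If the backward characteristic of (x, v) is trapped, those of all other velocities over
  x escape. \<open>F\<close> stays nonzero for velocities near v, so the untrapped bounds hold there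
  and pass to the limit.\<close>

lemma density_difference_bound:
  fixes F F' :: "phase \<Rightarrow> real"
  assumes L: "0 < L" and l: "0 \<le> l" and T1: "0 < T1" and c0: "0 < c0"
    and sk: "small_kinetic_solution L l u f F" and sk': "small_kinetic_solution L l u' f' F'"
    and K: "closed K" "K \<subseteq> Gamma_l L" "\<And>z. z \<in> Gamma_l L \<Longrightarrow> z \<notin> K \<Longrightarrow> \<psi> z = 0"
      "\<And>x v. (x, v) \<in> K \<Longrightarrow> c0 \<le> v$1 \<and> norm v \<le> R0"
    and Fl: "\<And>z. z \<in> Gamma_l L \<Longrightarrow> F z = \<psi> z" "\<And>z. z \<in> Gamma_l L \<Longrightarrow> F' z = \<psi> z"
    and F0: "\<And>z. z \<in> Gamma_r L \<union> Gamma_u L \<union> Gamma_d L \<Longrightarrow> F z = 0"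
    and egc: "exits_within L up K T1 \<delta>"
    and u: "\<And>x. x \<in> closure (Omega L) \<Longrightarrow> norm (u x - up x) \<le> \<delta>"
      "\<And>x. x \<in> closure (Omega L) \<Longrightarrow> 0 \<le> u x $ 1"
      "\<And>x. x \<in> closure (Omega L) \<Longrightarrow> norm (u x) \<le> 1"
    and m: "continuous_on {- L..L} m" "\<And>y. y \<in> {- L..L} \<Longrightarrow> 0 \<le> m y"
      "\<And>x. x \<in> Omega L \<Longrightarrow> norm (u x - u' x) \<le> m (x$1)"
    and x: "x \<in> Omega L" and nz: "F (x, v) \<noteq> 0"
  shows "norm v \<le> R0 + 1 \<and> \<bar>F (x, v) - F' (x, v)\<bar> \<le> exp (3 * T1) * l / c0 * integral {- L..L} m"
proof -
  let ?E = "exp (3 * T1) * l / c0 * integral {- L..L} m"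
  let ?U = "\<lambda>x. u (proj_Omega L x)"
  have lU: "(1/8)-lipschitz_on UNIV ?U"
    by (rule proj_Omega_extension(2)[OF L]) (use sk in \<open>auto simp: small_kinetic_solution_def\<close>)
  have "\<exists>Z. Z 0 = (x, w) \<and> (\<forall>t. (Z has_vector_derivative (snd (Z t), ?U (fst (Z t)) - snd (Z t))) (at t))" for w
    using ode_global[OF vlasov_field_lipschitz[OF lU]] by metis
  then obtain Z where Z: "\<And>w. Z w 0 = (x, w)"
    "\<And>w t. (Z w has_vector_derivative (snd (Z w t), ?U (fst (Z w t)) - snd (Z w t))) (at t)" by metis
  define X where "X w t = fst (Z w t)" for w t
  define V where "V w t = snd (Z w t)" for w t
  have X: "(X w has_vector_derivative V w t) (at t)" for w t
    using bounded_linear.has_vector_derivative[OF bounded_linear_fst Z(2)[of w t]]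
    by (simp add: X_def[abs_def] V_def)
  have V: "(V w has_vector_derivative ?U (X w t) - V w t) (at t)" for w t
    using bounded_linear.has_vector_derivative[OF bounded_linear_snd Z(2)[of w t]]
    by (simp add: X_def V_def[abs_def])
  have init: "X w 0 = x" "V w 0 = w" for w using Z(1) by (simp_all add: X_def V_def)
  have esc: "norm w \<le> R0 + 1 \<and> \<bar>F (x, w) - F' (x, w)\<bar> \<le> ?E"
    if "F (x, w) \<noteq> 0" "c \<le> 0" "X w c \<notin> Omega L" for w c
    using density_difference_bound_untrapped[OF L l T1 c0 sk sk' K Fl F0 egc u m X V _ _ that(2,3)] x that(1) init by auto
  show ?thesis
  proof (cases "\<exists>c\<le>0. X v c \<notin> Omega L")
    case True
    then show ?thesis using esc nz by blast
  next
    case False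
    \<comment> \<open>Two trapped trajectories over the same point stay at bounded distance for all
      negative times; the separation lemma then identifies their velocities.\<close>
    have esc': "\<exists>c\<le>0. X w c \<notin> Omega L" if "w \<noteq> v" for w
    proof (rule ccontr)
      assume a: "\<not> (\<exists>c\<le>0. X w c \<notin> Omega L)"
      have "V w 0 = V v 0"
      proof (rule friction_backward_separation[OF _ X X V V])
        show "norm (?U x - ?U y) \<le> 1 / 8 * norm (x - y)" for x y
          using lipschitz_onD[OF lU] by (simp add: dist_norm)
        show "X w 0 = X v 0" by (simp add: init)
        fix t :: real assume "t \<le> 0"
        then have "X w t \<in> Omega L" "X v t \<in> Omega L" using a False by auto
        then have "\<bar>(X w t - X v t) $ i\<bar> \<le> 2 * L + 2" for i
          using L exhaust_2[of i] by (auto simp: Omega_def)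
        then show "norm (X w t - X v t) \<le> (\<Sum>i\<in>(UNIV::2 set). 2 * L + 2)"
          by (intro order_trans[OF norm_le_l1_cart] sum_mono)
      qed
      then show False using that init by simp
    qed
    have cF: "continuous_on (closure (Omega L) \<times> UNIV) F" "continuous_on (closure (Omega L) \<times> UNIV) F'"
      using sk sk' by (auto simp: small_kinetic_solution_def)
    have xc: "x \<in> closure (Omega L)" using x closure_subset by blast
    \<comment> \<open>The punctured filter at \<open>v\<close> is the right one: only velocities
      other than \<open>v\<close> are known to escape.\<close>
    have tend: "((\<lambda>w. H (x, w)) \<longlongrightarrow> H (x, v)) (at v)"
      if "continuous_on (closure (Omega L) \<times> UNIV) H" for H :: "phase \<Rightarrow> real"
    proof -
      have "continuous_on UNIV (\<lambda>w. H (x, w))"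
        by (rule continuous_on_compose2[OF that]) (use xc in \<open>auto intro!: continuous_intros\<close>)
      then show ?thesis by (simp add: continuous_on_def)
    qed
    have "\<forall>\<^sub>F w in at v. F (x, w) \<noteq> 0"
      using tendsto_imp_eventually_ne[OF tend[OF cF(1)] nz] .
    moreover have "\<forall>\<^sub>F w in at v. w \<noteq> v" by (simp add: eventually_at_filter)
    ultimately have ev: "\<forall>\<^sub>F w in at v. norm w \<le> R0 + 1 \<and> \<bar>F (x, w) - F' (x, w)\<bar> \<le> ?E"
    proof eventually_elim
      case (elim w)
      then show ?case using esc esc' by blast
    qed
    have "norm v \<le> R0 + 1"
      by (rule tendsto_upperbound[of norm _ "at v"])
        (use ev in \<open>auto elim: eventually_mono intro!: tendsto_intros\<close>)
    moreover have "\<bar>F (x, v) - F' (x, v)\<bar> \<le> ?E"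
      by (rule tendsto_upperbound[of "\<lambda>w. \<bar>F (x, w) - F' (x, w)\<bar>" _ "at v"])
        (use ev tend cF in \<open>auto elim: eventually_mono intro!: tendsto_intros\<close>)
    ultimately show ?thesis ..
  qed
qed


section \<open>Poincare inequalities in the pipe\<close>

lemma Basis_vec2: "(Basis :: vec2 set) = {axis 1 1, axis 2 1}" "axis 1 (1::real) \<noteq> (axis 2 1 :: vec2)"
  by (auto simp: Basis_vec_def UNIV_2 axis_eq_axis)

lemma vector_2_eq: "(vector [y, s] :: vec2) = y *\<^sub>R axis 1 1 + s *\<^sub>R axis 2 1"
  by (simp add: vec_eq_iff forall_2 axis_def)

lemma continuous_on_vector_2: "continuous_on A (\<lambda>p :: real \<times> real. vector [fst p, snd p] :: vec2)"
  unfolding vector_2_eq by (intro continuous_intros)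

lemma borel_measurable_vector_2: "(\<lambda>(y, s). vector [y, s] :: vec2) \<in> borel_measurable lborel"
  unfolding split_beta measurable_lborel2
  by (rule borel_measurable_continuous_onI[OF continuous_on_vector_2])

text \<open>Identifies Lebesgue measure on \<open>real^2\<close> with that on pairs by comparing
  volumes of boxes; this gives access to iterated integrals.\<close>

lemma lborel_vec2: "(lborel :: vec2 measure) = distr lborel borel (\<lambda>(y, s). vector [y, s])"
proof (rule lborel_eqI)
  let ?T = "\<lambda>(y, s). vector [y, s] :: vec2"
  note T = borel_measurable_vector_2
  show "sets (distr lborel borel ?T) = sets borel" by simp
  fix l u :: vec2 assume lu: "\<And>b. b \<in> Basis \<Longrightarrow> l \<bullet> b \<le> u \<bullet> b"
  have le: "l$1 \<le> u$1" "l$2 \<le> u$2"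
    using lu[of "axis 1 1"] lu[of "axis 2 1"] Basis_vec2 by (auto simp: inner_axis)
  have "?T -` box l u \<inter> space lborel = box (l$1, l$2) (u$1, u$2)"
    by (auto simp: mem_box_cart forall_2 box_prod mem_box)
  then have "emeasure (distr lborel borel ?T) (box l u) = emeasure lborel (box (l$1, l$2) (u$1, u$2))"
    using T by (simp add: emeasure_distr)
  also have "\<dots> = (\<Prod>b\<in>Basis. ((u$1, u$2) - (l$1, l$2)) \<bullet> b)"
    by (rule emeasure_lborel_box) (use le in \<open>auto simp: Basis_prod_def\<close>)
  also have "\<dots> = (\<Prod>b\<in>Basis. (u - l) \<bullet> b)"
  proof -
    have "(\<Prod>b\<in>Basis. ((u$1, u$2) - (l$1, l$2)) \<bullet> b) = (u$1 - l$1) * (u$2 - l$2)"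
      by (simp add: Basis_prod_def image_Un)
    moreover have "(\<Prod>b\<in>Basis. (u - l) \<bullet> b) = (u$1 - l$1) * (u$2 - l$2)"
      unfolding Basis_vec2(1) by (subst prod.insert) (use Basis_vec2(2) in \<open>auto simp: inner_axis\<close>)
    ultimately show ?thesis by simp
  qed
  finally show "emeasure (distr lborel borel ?T) (box l u) = (\<Prod>b\<in>Basis. (u - l) \<bullet> b)" .
qed

lemma closure_Omega_cbox:
  assumes "0 < L" shows "closure (Omega L) = cbox (vector [- L, - 1]) (vector [L, 1])"
  unfolding closure_Omega[OF assms] by (auto simp: mem_box_cart forall_2)

lemma compact_closure_Omega: "0 < L \<Longrightarrow> compact (closure (Omega L))"
  by (simp add: closure_Omega_cbox)

lemma bounded_lebesgue_on_integrable:
  fixes h :: "vec2 \<Rightarrow> 'b::euclidean_space"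
  assumes L: "0 < L" and h: "h \<in> borel_measurable (lebesgue_on (Omega L))" and b: "\<And>x. x \<in> Omega L \<Longrightarrow> norm (h x) \<le> B"
  shows "integrable (lebesgue_on (Omega L)) h"
proof (rule finite_measure.integrable_const_bound[OF _ _ h])
  show "finite_measure (lebesgue_on (Omega L))"
  proof
    have "Omega L \<in> lmeasurable"
      by (intro lmeasurable_open open_Omega) (simp add: Omega_eq_box bounded_box)
    from fmeasurableD2[OF this] show "emeasure (lebesgue_on (Omega L)) (space (lebesgue_on (Omega L))) \<noteq> \<infinity>"
      using open_Omega by (simp add: space_restrict_space emeasure_restrict_space)
  qed
  show "AE x in lebesgue_on (Omega L). norm (h x) \<le> B"
    by (rule AE_I2) (use b in \<open>simp add: space_restrict_space\<close>)
qed

lemma continuous_on_closure_Omega_measurable: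
  fixes h :: "vec2 \<Rightarrow> 'b::euclidean_space"
  assumes "continuous_on (closure (Omega L)) h"
  shows "h \<in> borel_measurable (lebesgue_on (Omega L))"
  using continuous_on_subset[OF assms closure_subset] open_Omega
  by (intro continuous_imp_measurable_on_sets_lebesgue) auto

lemma continuous_on_closure_Omega_bounded:
  fixes h :: "vec2 \<Rightarrow> 'b::euclidean_space"
  assumes "0 < L" "continuous_on (closure (Omega L)) h"
  obtains B where "B \<ge> 0" "\<And>x. x \<in> closure (Omega L) \<Longrightarrow> norm (h x) \<le> B"
proof -
  have "bounded (h ` closure (Omega L))"
    by (intro compact_imp_bounded compact_continuous_image assms compact_closure_Omega)
  then obtain B where "\<And>x. x \<in> closure (Omega L) \<Longrightarrow> norm (h x) \<le> B"
    by (auto simp: bounded_iff)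
  then show ?thesis using that[of "max B 0"] by fastforce
qed

lemma continuous_on_closure_Omega_integrable:
  fixes h :: "vec2 \<Rightarrow> 'b::euclidean_space"
  assumes L: "0 < L" and h: "continuous_on (closure (Omega L)) h"
  shows "integrable (lebesgue_on (Omega L)) h"
proof -
  obtain B where "\<And>x. x \<in> closure (Omega L) \<Longrightarrow> norm (h x) \<le> B"
    using continuous_on_closure_Omega_bounded[OF assms] by blast
  then show ?thesis
    using closure_subset by (intro bounded_lebesgue_on_integrable[OF L continuous_on_closure_Omega_measurable[OF h], of B]) blast
qed

lemma continuous_on_slice:
  assumes L: "0 < L" and h: "continuous_on (closure (Omega L)) h"
  shows "continuous_on ({- L..L} \<times> {- 1..1}) (\<lambda>(y, s). h (vector [y, s]))"
  unfolding split_beta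
  by (rule continuous_on_compose2[OF h continuous_on_vector_2]) (auto simp: closure_Omega[OF L])

text \<open>The frontier of a convex set is negligible, so the open pipe may be replaced by its
  closure, a compact rectangle on which \<open>h\<close> is continuous.\<close>

lemma fubini_Omega:
  fixes h :: "vec2 \<Rightarrow> real"
  assumes L: "0 < L" and h: "continuous_on (closure (Omega L)) h"
  shows "(LINT x|lebesgue_on (Omega L). h x) = integral {- L..L} (\<lambda>y. integral {- 1..1} (\<lambda>s. h (vector [y, s])))"
proof -
  let ?C = "closure (Omega L)"
  let ?T = "\<lambda>(y, s). vector [y, s] :: vec2"
  have hi: "integrable lborel (\<lambda>x. indicator ?C x *\<^sub>R h x)"
    by (rule borel_integrable_compact[OF compact_closure_Omega[OF L] h])
  have "(LINT x|lebesgue_on (Omega L). h x) = (LINT x|lebesgue. indicator (Omega L) x *\<^sub>R h x)"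
    using open_Omega by (subst integral_restrict_space) auto
  also have "\<dots> = (LINT x|lebesgue. indicator ?C x *\<^sub>R h x)"
  proof (rule integral_cong_AE)
    show m: "(\<lambda>x. indicator ?C x *\<^sub>R h x) \<in> borel_measurable lebesgue"
      using borel_measurable_integrable[OF hi] measurable_completion by blast
    have "(\<lambda>x. indicator (Omega L) x *\<^sub>R (indicator ?C x *\<^sub>R h x)) \<in> borel_measurable lebesgue"
      using open_Omega by (intro borel_measurable_scaleR m borel_measurable_indicator) auto
    moreover have "(\<lambda>x. indicator (Omega L) x *\<^sub>R (indicator ?C x *\<^sub>R h x)) = (\<lambda>x. indicator (Omega L) x *\<^sub>R h x)"
      using closure_subset[of "Omega L"] by (auto simp: indicator_def fun_eq_iff)
    ultimately show "(\<lambda>x. indicator (Omega L) x *\<^sub>R h x) \<in> borel_measurable lebesgue" by simp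
    have "AE x in lebesgue. x \<notin> frontier (Omega L)"
      using negligible_convex_frontier[OF convex_Omega] by (intro AE_not_in) (simp add: negligible_iff_null_sets)
    then show "AE x in lebesgue. indicator (Omega L) x *\<^sub>R h x = indicator ?C x *\<^sub>R h x"
      by eventually_elim (auto simp: indicator_def frontier_def interior_open[OF open_Omega] dest: subsetD[OF closure_subset])
  qed
  also have "\<dots> = (LINT x|lborel. indicator ?C x *\<^sub>R h x)"
    by (rule integral_completion) (use hi in auto)
  also have "\<dots> = (LINT p|lborel. indicator ?C (?T p) *\<^sub>R h (?T p))"
  proof (subst lborel_vec2, rule integral_distr)
    show "?T \<in> borel_measurable lborel" by (rule borel_measurable_vector_2)
    show "(\<lambda>x. indicator ?C x *\<^sub>R h x) \<in> borel_measurable borel"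
      using borel_measurable_integrable[OF hi] by simp
  qed
  also have "(\<lambda>p. indicator ?C (?T p) *\<^sub>R h (?T p)) = (\<lambda>p. indicator (cbox (- L, - 1) (L, 1)) p *\<^sub>R h (?T p))"
    by (auto simp: fun_eq_iff indicator_def closure_Omega[OF L])
  also have "(LINT p|lborel. indicator (cbox (- L, - 1) (L, 1)) p *\<^sub>R h (?T p)) = integral (cbox (- L, - 1) (L, 1)) (\<lambda>p. h (?T p))"
  proof -
    have c: "continuous_on (cbox (- L, - 1) (L, 1)) (\<lambda>p. h (?T p))"
      using continuous_on_slice[OF L h] by (simp add: cbox_Pair_eq split_beta)
    have i: "integrable lborel (\<lambda>p. indicator (cbox (- L, - 1) (L, 1)) p *\<^sub>R h (?T p))"
      by (rule borel_integrable_compact[OF compact_cbox c])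
    have "(LINT p|lborel. indicator (cbox (- L, - 1) (L, 1)) p *\<^sub>R h (?T p)) =
       integral (cbox (- L, - 1) (L, 1)) (\<lambda>p. indicator (cbox (- L, - 1) (L, 1)) p *\<^sub>R h (?T p))"
      by (rule LINT_eq_integral_cbox[OF i]) (auto simp: indicator_def split: if_splits)
    also have "\<dots> = integral (cbox (- L, - 1) (L, 1)) (\<lambda>p. h (?T p))"
      by (rule Henstock_Kurzweil_Integration.integral_cong) simp
    finally show ?thesis .
  qed
  also have "\<dots> = integral (cbox (- L) L) (\<lambda>y. integral (cbox (- 1) 1) (\<lambda>s. h (?T (y, s))))"
    by (rule integral_prod_continuous) (use continuous_on_slice[OF L h] in \<open>simp add: cbox_Pair_eq split_beta\<close>)
  finally show ?thesis by simp
qed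

text \<open>The integral of (f - \<mu>)^2 is nonnegative for the mean value \<mu> of
  \<open>f\<close>.\<close>

lemma integral_cauchy_schwarz_1d:
  fixes f :: "real \<Rightarrow> real"
  assumes f: "continuous_on {a..b} f" and ab: "a < b"
  shows "(integral {a..b} f)\<^sup>2 \<le> (b - a) * integral {a..b} (\<lambda>x. (f x)\<^sup>2)"
proof -
  define \<mu> where "\<mu> = integral {a..b} f / (b - a)"
  have i: "f integrable_on {a..b}" "(\<lambda>x. (f x)\<^sup>2) integrable_on {a..b}"
    by (intro integrable_continuous_real continuous_intros f)+
  have "((\<lambda>x. (f x)\<^sup>2 - (2 * \<mu>) * f x + \<mu>\<^sup>2) has_integral
      integral {a..b} (\<lambda>x. (f x)\<^sup>2) - (2 * \<mu>) * integral {a..b} f + (b - a) *\<^sub>R \<mu>\<^sup>2) {a..b}"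
    using i ab by (intro has_integral_add has_integral_diff has_integral_mult_right has_integral_const_real[THEN has_integral_eq_rhs] integrable_integral) auto
  then have "0 \<le> integral {a..b} (\<lambda>x. (f x)\<^sup>2) - (2 * \<mu>) * integral {a..b} f + (b - a) *\<^sub>R \<mu>\<^sup>2"
  proof (rule has_integral_nonneg)
    fix x
    have "(f x)\<^sup>2 - (2 * \<mu>) * f x + \<mu>\<^sup>2 = (f x - \<mu>)\<^sup>2" by (simp add: power2_diff)
    then show "0 \<le> (f x)\<^sup>2 - (2 * \<mu>) * f x + \<mu>\<^sup>2" by simp
  qed
  moreover have I: "integral {a..b} f = \<mu> * (b - a)" using ab by (simp add: \<mu>_def)
  ultimately have "\<mu>\<^sup>2 * (b - a) \<le> integral {a..b} (\<lambda>x. (f x)\<^sup>2)"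
    by (simp add: power2_eq_square algebra_simps)
  from mult_left_mono[OF this, of "b - a"] show ?thesis
    using ab by (simp add: I power2_eq_square mult_ac)
qed

text \<open>The norm of this matrix type is the Frobenius norm, so this is Cauchy-Schwarz row by
  row.\<close>

lemma norm_matrix_vector_le: "norm (A *v x) \<le> norm (A :: real^'n^'m) * norm x"
proof -
  have "(norm (A *v x))\<^sup>2 = (\<Sum>i\<in>UNIV. (A $ i \<bullet> x)\<^sup>2)"
    by (simp add: norm_vec_def L2_set_def sum_nonneg matrix_vector_mult_def inner_vec_def)
  also have "\<dots> \<le> (\<Sum>i\<in>UNIV. (norm (A $ i))\<^sup>2 * (norm x)\<^sup>2)"
    by (intro sum_mono) (metis Cauchy_Schwarz_ineq2 abs_ge_zero power2_abs power_mono power_mult_distrib)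
  also have "\<dots> = (norm A * norm x)\<^sup>2"
    by (simp add: norm_vec_def[of A] L2_set_def sum_nonneg power_mult_distrib sum_distrib_right)
  finally show ?thesis by (rule power2_le_imp_le) simp
qed

text \<open>With \<open>H\<close> the gradient of w, this bounds |w| on the cross-section x_1 = y.
  That it depends on x_1 alone is what turns integrals along characteristics into integrals over the
  length of the pipe.\<close>

definition wall_bound :: "(vec2 \<Rightarrow> real^2^2) \<Rightarrow> real \<Rightarrow> real" where
  "wall_bound H y = integral {- 1..1} (\<lambda>s. norm (H (vector [y, s])))"

lemma wall_bound:
  assumes L: "0 < L" and H: "continuous_on (closure (Omega L)) H"
  shows "continuous_on {- L..L} (wall_bound H)" "y \<in> {- L..L} \<Longrightarrow> 0 \<le> wall_bound H y"
    and "integral {- L..L} (\<lambda>y. (wall_bound H y)\<^sup>2) \<le> 2 * (LINT x|lebesgue_on (Omega L). (norm (H x))\<^sup>2)"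
proof -
  have c: "continuous_on ({- L..L} \<times> {- 1..1}) (\<lambda>(y, s). norm (H (vector [y, s])))"
    by (rule continuous_on_slice[OF L]) (intro continuous_intros H)
  show cw: "continuous_on {- L..L} (wall_bound H)"
    unfolding wall_bound_def[abs_def]
    using integral_continuous_on_param[of "{- L..L}" "- 1" "1::real" "\<lambda>y s. norm (H (vector [y, s]))"] c by simp
  have cy: "continuous_on {- 1..1} (\<lambda>s. norm (H (vector [y, s])))" if "y \<in> {- L..L}" for y
  proof -
    have "continuous_on {- 1..1} (\<lambda>s. case (y, s) of (y, s) \<Rightarrow> norm (H (vector [y, s])))"
      by (rule continuous_on_compose2[OF c, of _ "Pair y"]) (use that in \<open>auto intro!: continuous_intros\<close>)
    then show ?thesis by simp
  qed
  show "y \<in> {- L..L} \<Longrightarrow> 0 \<le> wall_bound H y"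
    unfolding wall_bound_def
    by (intro Henstock_Kurzweil_Integration.integral_nonneg integrable_continuous_real cy) auto
  have c2: "continuous_on (closure (Omega L)) (\<lambda>x. (norm (H x))\<^sup>2)" by (intro continuous_intros H)
  have "(wall_bound H y)\<^sup>2 \<le> 2 * integral {- 1..1} (\<lambda>s. (norm (H (vector [y, s])))\<^sup>2)" if "y \<in> {- L..L}" for y
    unfolding wall_bound_def using integral_cauchy_schwarz_1d[OF cy[OF that]] by simp
  then have "integral {- L..L} (\<lambda>y. (wall_bound H y)\<^sup>2) \<le>
      integral {- L..L} (\<lambda>y. 2 * integral {- 1..1} (\<lambda>s. (norm (H (vector [y, s])))\<^sup>2))"
  proof (intro integral_le integrable_continuous_real)
    show "continuous_on {- L..L} (\<lambda>y. (wall_bound H y)\<^sup>2)" by (intro continuous_intros cw)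
    show "continuous_on {- L..L} (\<lambda>y. 2 * integral {- 1..1} (\<lambda>s. (norm (H (vector [y, s])))\<^sup>2))"
      using integral_continuous_on_param[of "{- L..L}" "- 1" "1::real" "\<lambda>y s. (norm (H (vector [y, s])))\<^sup>2"]
        continuous_on_slice[OF L c2] by (intro continuous_intros) simp
  qed auto
  then show "integral {- L..L} (\<lambda>y. (wall_bound H y)\<^sup>2) \<le> 2 * (LINT x|lebesgue_on (Omega L). (norm (H x))\<^sup>2)"
    unfolding fubini_Omega[OF L c2] by simp
qed

text \<open>Cauchy-Schwarz along the length 2 L, after the one across the height 2 that is already
  contained in \<open>wall_bound\<close>.\<close>

lemma wall_bound_integral:
  assumes L: "0 < L" and H: "continuous_on (closure (Omega L)) H"
  shows "(integral {- L..L} (wall_bound H))\<^sup>2 \<le> 4 * L * (LINT x|lebesgue_on (Omega L). (norm (H x))\<^sup>2)"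
proof -
  have "(integral {- L..L} (wall_bound H))\<^sup>2 \<le> (L - - L) * integral {- L..L} (\<lambda>y. (wall_bound H y)\<^sup>2)"
    using L by (intro integral_cauchy_schwarz_1d wall_bound[OF L H]) auto
  also have "\<dots> \<le> (L - - L) * (2 * (LINT x|lebesgue_on (Omega L). (norm (H x))\<^sup>2))"
    using L by (intro mult_left_mono wall_bound[OF L H]) auto
  finally show ?thesis by simp
qed

text \<open>Integrate the gradient upwards from the lower wall, where \<open>w\<close> vanishes, and
  extend the integral to the full height.\<close>

lemma norm_le_wall_bound:
  fixes w :: "vec2 \<Rightarrow> vec2"
  assumes L: "0 < L" and H: "continuous_on (closure (Omega L)) H"
    and w: "continuous_on (closure (Omega L)) w" "\<And>x. x \<in> frontier (Omega L) \<Longrightarrow> w x = 0"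
    and d: "\<And>x. x \<in> Omega L \<Longrightarrow> (w has_derivative (\<lambda>h. H x *v h)) (at x)"
    and x: "x \<in> Omega L"
  shows "norm (w x) \<le> wall_bound H (x$1)"
proof -
  let ?p = "\<lambda>s. vector [x$1, s] :: vec2"
  have x': "- L < x$1" "x$1 < L" "- 1 < x$2" "x$2 < 1" using x by (auto simp: Omega_def)
  have pe: "?p = (\<lambda>s. x$1 *\<^sub>R axis 1 1 + s *\<^sub>R axis 2 1)"
    by (auto simp: fun_eq_iff vec_eq_iff forall_2 axis_def)
  have cp: "continuous_on A ?p" for A unfolding pe by (intro continuous_intros)
  have pC: "?p s \<in> closure (Omega L)" if "s \<in> {- 1..1}" for s
    using that x' by (auto simp: closure_Omega[OF L])
  have cH: "continuous_on {- 1..1} (\<lambda>s. H (?p s))"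
    by (rule continuous_on_compose2[OF H cp]) (use pC in auto)
  have cn: "continuous_on {- 1..1} (\<lambda>s. norm (H (?p s)))" by (intro continuous_intros cH)
  have px: "?p (x$2) = x" by (simp add: vec_eq_iff forall_2)
  have "norm (w (?p (x$2)) - w (?p (- 1))) \<le> integral {- 1..x$2} (\<lambda>s. norm (H (?p s))) - integral {- 1..- 1} (\<lambda>s. norm (H (?p s)))"
  proof (rule differentiable_bound_general[OF x'(3)])
    have "continuous_on {- 1..1} (\<lambda>t. integral {- 1..t} (\<lambda>s. norm (H (?p s))))"
      by (rule indefinite_integral_continuous_1[OF integrable_continuous_real[OF cn]])
    then show "continuous_on {- 1..x$2} (\<lambda>t. integral {- 1..t} (\<lambda>s. norm (H (?p s))))"
      by (rule continuous_on_subset) (use x' in auto)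
    show "continuous_on {- 1..x$2} (\<lambda>s. w (?p s))"
      by (rule continuous_on_compose2[OF w(1) cp]) (use pC x' in auto)
    fix s assume s: "- 1 < s" "s < x$2"
    have p\<Omega>: "?p s \<in> Omega L" using s x' by (auto simp: Omega_def)
    have "(?p has_derivative (\<lambda>h. h *\<^sub>R axis 2 1)) (at s)"
      unfolding pe by (auto intro!: derivative_eq_intros)
    from has_derivative_compose[OF this d[OF p\<Omega>]]
    have "((\<lambda>s. w (?p s)) has_derivative (\<lambda>h. H (?p s) *v (h *\<^sub>R axis 2 1))) (at s)" .
    then show "((\<lambda>s. w (?p s)) has_vector_derivative H (?p s) *v axis 2 1) (at s)"
      by (simp add: has_vector_derivative_def matrix_vector_mult_scaleR)
    have "((\<lambda>t. integral {- 1..t} (\<lambda>s. norm (H (?p s)))) has_vector_derivative norm (H (?p s))) (at s within {- 1..1})"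
      by (rule integral_has_vector_derivative[OF cn]) (use s x' in auto)
    then show "((\<lambda>t. integral {- 1..t} (\<lambda>s. norm (H (?p s)))) has_vector_derivative norm (H (?p s))) (at s)"
      using s x' at_within_Icc_at[of "- 1" s 1] by simp
    show "norm (H (?p s) *v axis 2 1) \<le> norm (H (?p s))"
      using norm_matrix_vector_le[of "H (?p s)" "axis 2 1"] by simp
  qed
  moreover have "w (?p (- 1)) = 0"
    using x' by (intro w(2)) (auto simp: frontier_Omega[OF L] closure_Omega[OF L])
  ultimately have "norm (w x) \<le> integral {- 1..x$2} (\<lambda>s. norm (H (?p s)))" by (simp add: px)
  also have "\<dots> \<le> wall_bound H (x$1)"
    unfolding wall_bound_def
    by (intro integral_subset_le integrable_continuous_real continuous_on_subset[OF cn]) (use x' in auto)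
  finally show ?thesis .
qed

text \<open>Both follow from the bound by \<open>wall_bound\<close>, which is constant on sections
  of height 2. The L^1 estimate is kept in terms of the integral of \<open>wall_bound\<close>, the
  quantity that also controls the difference of the densities.\<close>

lemma poincare_Omega:
  fixes w :: "vec2 \<Rightarrow> vec2"
  assumes L: "0 < L" and H: "continuous_on (closure (Omega L)) H"
    and w: "continuous_on (closure (Omega L)) w" "\<And>x. x \<in> frontier (Omega L) \<Longrightarrow> w x = 0"
    and d: "\<And>x. x \<in> Omega L \<Longrightarrow> (w has_derivative (\<lambda>h. H x *v h)) (at x)"
  shows "(LINT x|lebesgue_on (Omega L). (norm (w x))\<^sup>2) \<le> 4 * (LINT x|lebesgue_on (Omega L). (norm (H x))\<^sup>2)"
    and "(LINT x|lebesgue_on (Omega L). norm (w x)) \<le> 2 * integral {- L..L} (wall_bound H)"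
proof -
  note wb = wall_bound[OF L H]
  have c1: "continuous_on (closure (Omega L)) (\<lambda>x. wall_bound H (x$1))"
    by (rule continuous_on_compose2[OF wb(1)]) (auto intro!: continuous_intros simp: closure_Omega[OF L])
  note n = norm_le_wall_bound[OF L H w d]
  have "(LINT x|lebesgue_on (Omega L). (norm (w x))\<^sup>2) \<le> (LINT x|lebesgue_on (Omega L). (wall_bound H (x$1))\<^sup>2)"
  proof (rule integral_mono)
    fix x assume "x \<in> space (lebesgue_on (Omega L))"
    then show "(norm (w x))\<^sup>2 \<le> (wall_bound H (x$1))\<^sup>2"
      using n by (intro power_mono) (auto simp: space_restrict_space)
  qed (intro continuous_on_closure_Omega_integrable[OF L] continuous_intros w c1)+
  also have "\<dots> = 2 * integral {- L..L} (\<lambda>y. (wall_bound H y)\<^sup>2)"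
    by (subst fubini_Omega[OF L]) (auto intro!: continuous_intros c1)
  finally show "(LINT x|lebesgue_on (Omega L). (norm (w x))\<^sup>2) \<le> 4 * (LINT x|lebesgue_on (Omega L). (norm (H x))\<^sup>2)"
    using wb(3) by simp
  have "(LINT x|lebesgue_on (Omega L). norm (w x)) \<le> (LINT x|lebesgue_on (Omega L). wall_bound H (x$1))"
  proof (rule integral_mono)
    fix x assume "x \<in> space (lebesgue_on (Omega L))"
    then show "norm (w x) \<le> wall_bound H (x$1)" using n by (auto simp: space_restrict_space)
  qed (intro continuous_on_closure_Omega_integrable[OF L] continuous_intros w c1)+
  also have "\<dots> = 2 * integral {- L..L} (wall_bound H)"
    by (subst fubini_Omega[OF L c1]) simp
  finally show "(LINT x|lebesgue_on (Omega L). norm (w x)) \<le> 2 * integral {- L..L} (wall_bound H)" .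
qed


section \<open>Divergence-free test functions\<close>

text \<open>A segment from a point of \<open>S\<close> to a point outside meets the frontier, where
  \<open>w\<close> is zero; only its part up to the crossing contributes.\<close>

lemma zero_extension_lipschitz:
  fixes w :: "'a::euclidean_space \<Rightarrow> 'b::real_normed_vector"
  assumes w: "B-lipschitz_on (closure S) w" "\<And>x. x \<in> frontier S \<Longrightarrow> w x = 0"
  shows "B-lipschitz_on UNIV (\<lambda>x. if x \<in> S then w x else 0)"
proof (rule lipschitz_onI)
  show B: "0 \<le> B" by (rule lipschitz_on_nonneg[OF w(1)])
  have *: "norm (w x) \<le> B * norm (x - y)" if "x \<in> S" "y \<notin> S" for x y
  proof -
    have "closed_segment x y \<inter> frontier S \<noteq> {}"
      by (rule connected_Int_frontier) (use that in auto)
    then obtain z where z: "z \<in> closed_segment x y" "z \<in> frontier S" by blast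
    have "dist (w x) (w z) \<le> B * dist x z"
      by (rule lipschitz_onD[OF w(1)]) (use that z closure_subset in \<open>auto simp: frontier_def\<close>)
    also have "\<dots> \<le> B * norm (x - y)"
      using segment_bound1[OF z(1)] B by (intro mult_left_mono) (auto simp: dist_norm norm_minus_commute)
    finally show ?thesis using w(2)[OF z(2)] by simp
  qed
  fix x y
  have "dist (w x) (w y) \<le> B * dist x y" if "x \<in> S" "y \<in> S"
    by (rule lipschitz_onD[OF w(1)]) (use that closure_subset in auto)
  then show "dist (if x \<in> S then w x else 0) (if y \<in> S then w y else 0) \<le> B * dist x y"
    using *[of x y] *[of y x] B by (auto simp: dist_norm norm_minus_commute)
qed

text \<open>A directional derivative as the limit of a sequence, the form in which dominated
  convergence can use it.\<close>

lemma has_derivative_difference_quotient_seq: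
  fixes f :: "'a::real_normed_vector \<Rightarrow> 'b::real_normed_vector"
  assumes "(f has_derivative f') (at x)"
  shows "(\<lambda>n. real (Suc n) *\<^sub>R (f (x + (1 / real (Suc n)) *\<^sub>R h) - f x)) \<longlonglongrightarrow> f' h"
proof -
  have lin: "linear f'" using assms by (rule has_derivative_linear)
  have "((\<lambda>t. x + t *\<^sub>R h) has_derivative (\<lambda>t. t *\<^sub>R h)) (at (0::real))"
    by (auto intro!: derivative_eq_intros)
  moreover have "(f has_derivative f') (at (x + 0 *\<^sub>R h))" using assms by simp
  ultimately have "((\<lambda>t. f (x + t *\<^sub>R h)) has_derivative (\<lambda>t. f' (t *\<^sub>R h))) (at 0)"
    by (rule has_derivative_compose)
  then have "((\<lambda>t. norm (f (x + (0 + t) *\<^sub>R h) - f (x + 0 *\<^sub>R h) - f' (t *\<^sub>R h)) / norm t) \<longlongrightarrow> 0) (at 0)"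
    unfolding has_derivative_at by blast
  then have l: "((\<lambda>t. norm (f (x + t *\<^sub>R h) - f x - f' (t *\<^sub>R h)) / norm t) \<longlongrightarrow> 0) (at 0)" by simp
  have "filterlim (\<lambda>n. 1 / real (Suc n)) (at 0) sequentially"
    unfolding filterlim_at using LIMSEQ_Suc[OF lim_1_over_n] by auto
  from filterlim_compose[OF l this]
  have "(\<lambda>n. norm (f (x + (1 / real (Suc n)) *\<^sub>R h) - f x - f' ((1 / real (Suc n)) *\<^sub>R h)) / norm (1 / real (Suc n))) \<longlonglongrightarrow> 0" .
  moreover have "norm (f (x + (1 / real (Suc n)) *\<^sub>R h) - f x - f' ((1 / real (Suc n)) *\<^sub>R h)) / norm (1 / real (Suc n)) =
     norm (real (Suc n) *\<^sub>R (f (x + (1 / real (Suc n)) *\<^sub>R h) - f x) - f' h)" for n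
  proof -
    have "real (Suc n) *\<^sub>R (f (x + (1 / real (Suc n)) *\<^sub>R h) - f x) - f' h =
      real (Suc n) *\<^sub>R (f (x + (1 / real (Suc n)) *\<^sub>R h) - f x - f' ((1 / real (Suc n)) *\<^sub>R h))"
      by (simp add: linear_scale[OF lin] scaleR_diff_right del: of_nat_Suc)
    then show ?thesis by (simp del: of_nat_Suc)
  qed
  ultimately have "(\<lambda>n. norm (real (Suc n) *\<^sub>R (f (x + (1 / real (Suc n)) *\<^sub>R h) - f x) - f' h)) \<longlonglongrightarrow> 0"
    by simp
  then show ?thesis
    by (simp only: tendsto_norm_zero_iff LIM_zero_iff)
qed

lemma integrable_mollifier_times:
  fixes g :: "'a::euclidean_space \<Rightarrow> 'b::euclidean_space"
  assumes \<eta>: "is_mollifier r \<eta>" and g: "g \<in> borel_measurable borel" "\<And>y. norm (g y) \<le> C"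
  shows "integrable lborel (\<lambda>y. \<eta> (z - y) *\<^sub>R g y)"
proof (rule Bochner_Integration.integrable_bound)
  note d = is_mollifierD[OF \<eta>]
  show "integrable lborel (\<lambda>y. \<eta> (z - y) * C)" using d(5) by simp
  show "(\<lambda>y. \<eta> (z - y) *\<^sub>R g y) \<in> borel_measurable lborel"
    using borel_measurable_integrable[OF d(5)] g(1) by (intro borel_measurable_scaleR) auto
  show "AE y in lborel. norm (\<eta> (z - y) *\<^sub>R g y) \<le> norm (\<eta> (z - y) * C)"
  proof (rule AE_I2)
    fix y
    have "norm (\<eta> (z - y) *\<^sub>R g y) \<le> \<bar>\<eta> (z - y)\<bar> * C"
      using g(2)[of y] by (simp add: mult_left_mono)
    also have "\<dots> \<le> norm (\<eta> (z - y) * C)"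
      unfolding real_norm_def abs_mult by (intro mult_left_mono) auto
    finally show "norm (\<eta> (z - y) *\<^sub>R g y) \<le> norm (\<eta> (z - y) * C)" .
  qed
qed

text \<open>Here the derivative falls on \<open>W\<close> and not on the kernel. \<open>W\<close>
  may fail to be differentiable on a negligible set, but its difference quotients are bounded by the
  Lipschitz constant, and dominated convergence applies.\<close>

lemma mol_derivative_lipschitz:
  fixes W :: "'a::euclidean_space \<Rightarrow> 'b::euclidean_space"
  assumes \<eta>: "is_mollifier r \<eta>" and W: "B-lipschitz_on UNIV W" and N: "negligible N"
    and D: "\<And>z. z \<notin> N \<Longrightarrow> (W has_derivative D z) (at z)"
    and Dm: "(\<lambda>z. D z h) \<in> borel_measurable borel"
  shows "frechet_derivative (mol \<eta> W) (at x) h = (LINT y|lborel. \<eta> (x - y) *\<^sub>R D y h)"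
proof -
  note d = is_mollifierD[OF \<eta>]
  have cW: "continuous_on UNIV W" by (rule lipschitz_on_continuous_on[OF W])
  have B: "0 \<le> B" by (rule lipschitz_on_nonneg[OF W])
  note MD = mol_has_derivative[OF d(1) d(3) cW]
  have "(mol \<eta> W has_derivative frechet_derivative (mol \<eta> W) (at x)) (at x)"
    using MD differentiableI frechet_derivative_works by blast
  from has_derivative_difference_quotient_seq[OF this]
  have 1: "(\<lambda>n. real (Suc n) *\<^sub>R (mol \<eta> W (x + (1 / real (Suc n)) *\<^sub>R h) - mol \<eta> W x)) \<longlonglongrightarrow>
     frechet_derivative (mol \<eta> W) (at x) h" .
  let ?q = "\<lambda>n y. real (Suc n) *\<^sub>R (W (y + (1 / real (Suc n)) *\<^sub>R h) - W y)"
  have shift: "mol \<eta> W (x + t *\<^sub>R h) = (LINT y|lborel. \<eta> (x - y) *\<^sub>R W (y + t *\<^sub>R h))"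
    and ishift: "integrable lborel (\<lambda>y. \<eta> (x - y) *\<^sub>R W (y + t *\<^sub>R h))" for t
  proof -
    have i: "integrable lborel (\<lambda>y. \<eta> (x + t *\<^sub>R h - y) *\<^sub>R W y)"
      by (rule integrable_mol[OF d(7) d(3) cW])
    have "mol \<eta> W (x + t *\<^sub>R h) = (LINT y|lborel. \<eta> (x + t *\<^sub>R h - (t *\<^sub>R h + y)) *\<^sub>R W (t *\<^sub>R h + y))"
      unfolding mol_def
      by (rule lborel_integral_translate[symmetric]) (use i in \<open>simp add: borel_measurable_integrable\<close>)
    then show "mol \<eta> W (x + t *\<^sub>R h) = (LINT y|lborel. \<eta> (x - y) *\<^sub>R W (y + t *\<^sub>R h))"
      by (simp add: add.commute)
    have cWt: "continuous_on UNIV (\<lambda>y. W (y + t *\<^sub>R h))"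
      by (rule continuous_on_compose2[OF cW]) (auto intro!: continuous_intros)
    show "integrable lborel (\<lambda>y. \<eta> (x - y) *\<^sub>R W (y + t *\<^sub>R h))"
      by (rule integrable_mol[OF d(7) d(3) cWt])
  qed
  have 2: "real (Suc n) *\<^sub>R (mol \<eta> W (x + (1 / real (Suc n)) *\<^sub>R h) - mol \<eta> W x) =
      (LINT y|lborel. \<eta> (x - y) *\<^sub>R ?q n y)" for n
  proof -
    have "mol \<eta> W (x + (1 / real (Suc n)) *\<^sub>R h) - mol \<eta> W x =
      (LINT y|lborel. \<eta> (x - y) *\<^sub>R W (y + (1 / real (Suc n)) *\<^sub>R h) - \<eta> (x - y) *\<^sub>R W (y + 0 *\<^sub>R h))"
      using Bochner_Integration.integral_diff[OF ishift ishift, of "1 / real (Suc n)" 0] shift[of "1 / real (Suc n)"] shift[of 0]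
      by simp
    then have "real (Suc n) *\<^sub>R (mol \<eta> W (x + (1 / real (Suc n)) *\<^sub>R h) - mol \<eta> W x) =
      (LINT y|lborel. real (Suc n) *\<^sub>R (\<eta> (x - y) *\<^sub>R W (y + (1 / real (Suc n)) *\<^sub>R h) - \<eta> (x - y) *\<^sub>R W (y + 0 *\<^sub>R h)))"
      by (simp del: of_nat_Suc)
    then show ?thesis by (simp add: scaleR_diff_right mult.commute del: of_nat_Suc)
  qed
  have "(\<lambda>n. LINT y|lborel. \<eta> (x - y) *\<^sub>R ?q n y) \<longlonglongrightarrow> (LINT y|lborel. \<eta> (x - y) *\<^sub>R D y h)"
  proof (rule integral_dominated_convergence[where w="\<lambda>y. \<eta> (x - y) * (B * norm h)"])
    have m\<eta>: "(\<lambda>y. \<eta> (x - y)) \<in> borel_measurable lborel" by (rule borel_measurable_integrable[OF d(5)])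
    show "(\<lambda>y. \<eta> (x - y) *\<^sub>R D y h) \<in> borel_measurable lborel"
      using Dm by (intro borel_measurable_scaleR m\<eta>) simp
    show "(\<lambda>y. \<eta> (x - y) *\<^sub>R ?q n y) \<in> borel_measurable lborel" for n
    proof -
      have "continuous_on UNIV (?q n)"
        by (intro continuous_intros cW continuous_on_compose2[OF cW]) auto
      then have "?q n \<in> borel_measurable lborel"
        unfolding measurable_lborel2 by (rule borel_measurable_continuous_onI)
      then show ?thesis by (rule borel_measurable_scaleR[OF m\<eta>])
    qed
    show "integrable lborel (\<lambda>y. \<eta> (x - y) * (B * norm h))" using d(5) by simp
    have "AE y in lborel. y \<notin> N"
      using AE_not_in[OF N[unfolded negligible_iff_null_sets]] unfolding AE_completion_iff .
    then show "AE y in lborel. (\<lambda>n. \<eta> (x - y) *\<^sub>R ?q n y) \<longlonglongrightarrow> \<eta> (x - y) *\<^sub>R D y h"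
    proof eventually_elim
      case (elim y)
      show ?case
        by (intro tendsto_intros has_derivative_difference_quotient_seq[OF D[OF elim]])
    qed
    show "AE y in lborel. norm (\<eta> (x - y) *\<^sub>R ?q n y) \<le> \<eta> (x - y) * (B * norm h)" for n
    proof (rule AE_I2)
      fix y
      have "norm (W (y + (1 / real (Suc n)) *\<^sub>R h) - W y) \<le> B * norm ((1 / real (Suc n)) *\<^sub>R h)"
        using lipschitz_onD[OF W, of "y + (1 / real (Suc n)) *\<^sub>R h" y] by (simp add: dist_norm)
      then have "real (Suc n) * norm (W (y + (1 / real (Suc n)) *\<^sub>R h) - W y) \<le> real (Suc n) * (B * norm ((1 / real (Suc n)) *\<^sub>R h))"
        by (rule mult_left_mono) simp
      also have "\<dots> = B * norm h" by (simp del: of_nat_Suc)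
      finally have "norm (?q n y) \<le> B * norm h" by (simp del: of_nat_Suc)
      then have "\<eta> (x - y) * norm (?q n y) \<le> \<eta> (x - y) * (B * norm h)"
        by (rule mult_left_mono) (rule d(2))
      then show "norm (\<eta> (x - y) *\<^sub>R ?q n y) \<le> \<eta> (x - y) * (B * norm h)"
        by (simp only: norm_scaleR[of "\<eta> (x - y)"] abs_of_nonneg[OF d(2)])
    qed
  qed
  with 1[unfolded 2] show ?thesis by (rule LIMSEQ_unique)
qed

lemma bounded_linear_trace: "bounded_linear (trace :: real^'n^'n \<Rightarrow> real)"
  unfolding linear_conv_bounded_linear[symmetric]
  by (simp add: linear_iff trace_def sum.distrib sum_distrib_left)

text \<open>The pipe is star-shaped about the origin: shrinking the argument, which preserves vanishing
  divergence, makes room for the mollification.\<close>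

lemma divergence_free_approximation:
  fixes w :: "vec2 \<Rightarrow> vec2"
  assumes L: "0 < L" and H: "continuous_on (closure (Omega L)) H"
    and w: "continuous_on (closure (Omega L)) w" "\<And>x. x \<in> frontier (Omega L) \<Longrightarrow> w x = 0"
    and d: "\<And>x. x \<in> Omega L \<Longrightarrow> (w has_derivative (\<lambda>h. H x *v h)) (at x)"
    and tr: "\<And>x. x \<in> Omega L \<Longrightarrow> trace (H x) = 0"
  obtains \<phi> :: "nat \<Rightarrow> vec2 \<Rightarrow> vec2" and B where
    "\<And>n. \<phi> n \<in> test_functions (Omega L)" "\<And>n x. trace (jacobian (\<phi> n) (at x)) = 0"
    "\<And>x. x \<in> Omega L \<Longrightarrow> (\<lambda>n. \<phi> n x) \<longlonglongrightarrow> w x"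
    "\<And>x. x \<in> Omega L \<Longrightarrow> (\<lambda>n. jacobian (\<phi> n) (at x)) \<longlonglongrightarrow> H x"
    "\<And>n x. norm (\<phi> n x) \<le> B" "\<And>n x. norm (jacobian (\<phi> n) (at x)) \<le> B"
proof -
  let ?O = "Omega L"
  have sub: "?O \<subseteq> closure ?O" by (rule closure_subset)
  obtain B0 where B0: "B0 \<ge> 0" "\<And>x. x \<in> closure ?O \<Longrightarrow> norm (w x) \<le> B0"
    using continuous_on_closure_Omega_bounded[OF L w(1)] by blast
  obtain B where B: "B \<ge> 0" "\<And>x. x \<in> closure ?O \<Longrightarrow> norm (H x) \<le> B"
    using continuous_on_closure_Omega_bounded[OF L H] by blast
  have "B-lipschitz_on ?O w"
  proof (rule lipschitz_onI[OF _ B(1)])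
    fix x y assume xy: "x \<in> ?O" "y \<in> ?O"
    have "norm (w x - w y) \<le> B * norm (x - y)"
    proof (rule differentiable_bound[OF convex_Omega _ _ xy])
      fix z assume z: "z \<in> ?O"
      show "(w has_derivative (\<lambda>h. H z *v h)) (at z within ?O)" using d[OF z] by (rule has_derivative_at_withinI)
      show "onorm (\<lambda>h. H z *v h) \<le> B"
        using norm_matrix_vector_le[of "H z"] B(2)[of z] z sub
        by (intro onorm_le) (meson mult_right_mono norm_ge_zero order_trans subsetD)
    qed
    then show "dist (w x) (w y) \<le> B * dist x y" by (simp add: dist_norm)
  qed
  then have "B-lipschitz_on (closure ?O) w" by (rule lipschitz_on_closure[OF _ w(1)])
  from zero_extension_lipschitz[OF this w(2)]
  have lw: "B-lipschitz_on UNIV (\<lambda>x. if x \<in> ?O then w x else 0)" (is "B-lipschitz_on UNIV ?w") .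
  define H0 where "H0 x = (if x \<in> ?O then H x else 0)" for x
  have H0m: "H0 \<in> borel_measurable borel"
  proof -
    have m: "(\<lambda>x. indicator (closure ?O) x *\<^sub>R H x) \<in> borel_measurable borel"
      using borel_measurable_integrable[OF borel_integrable_compact[OF compact_closure_Omega[OF L] H]] by simp
    have "(\<lambda>x. indicator ?O x *\<^sub>R (indicator (closure ?O) x *\<^sub>R H x)) \<in> borel_measurable borel"
      by (rule borel_measurable_scaleR[OF borel_measurable_indicator m]) (simp add: open_Omega)
    moreover have "(\<lambda>x. indicator ?O x *\<^sub>R (indicator (closure ?O) x *\<^sub>R H x)) = H0"
      using sub by (auto simp: H0_def indicator_def fun_eq_iff)
    ultimately show ?thesis by simp
  qed
  have H0B: "norm (H0 x) \<le> B" for x using B sub by (auto simp: H0_def)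
  define \<delta> where "\<delta> n = 1 / (real n + 2)" for n
  have \<delta>: "0 < \<delta> n" "\<delta> n \<le> 1/2" for n by (auto simp: \<delta>_def field_simps)
  have \<delta>0: "\<delta> \<longlonglongrightarrow> 0"
    unfolding \<delta>_def[abs_def] by real_asymp
  \<comment> \<open>Enlarging the argument by 1 / (1 - \<delta>) squeezes the support into the pipe
    scaled by 1 - \<delta>.\<close>
  define c where "c n = 1 / (1 - \<delta> n)" for n
  have c: "1 \<le> c n" "c n \<le> 2" "c n - 1 \<le> 2 * \<delta> n" "c n * (1 - \<delta> n) = 1" for n
    using \<delta>[of n] by (auto simp: c_def field_simps)
  \<comment> \<open>The squeeze frees a margin of \<delta> L at the ends and \<delta> at the walls;
    the mollifier uses at most half of the smaller one.\<close>
  define r where "r n = \<delta> n * min L 1 / 2" for n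
  have r: "0 < r n" "r n \<le> \<delta> n" "r n \<le> \<delta> n * L / 2" "r n \<le> \<delta> n / 2" for n
    using \<delta>[of n] L by (auto simp: r_def mult_left_mono)
  have "\<exists>\<eta>::vec2 \<Rightarrow> real. is_mollifier (r n) \<eta>" for n
    using ex_mollifier r(1)[of n] by blast
  then obtain \<eta> :: "nat \<Rightarrow> vec2 \<Rightarrow> real" where \<eta>: "\<And>n. is_mollifier (r n) (\<eta> n)" by metis
  define W where "W n y = ?w (c n *\<^sub>R y)" for n y
  define J where "J n y = c n *\<^sub>R H0 (c n *\<^sub>R y)" for n y
  have lW: "(B * 2)-lipschitz_on UNIV (W n)" for n
  proof (rule lipschitz_onI)
    show "0 \<le> B * 2" using B by simp
    fix x y
    have "dist (W n x) (W n y) \<le> B * dist (c n *\<^sub>R x) (c n *\<^sub>R y)"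
      unfolding W_def by (rule lipschitz_onD[OF lw]) auto
    also have "\<dots> = B * (c n * dist x y)" using c(1)[of n] by (simp add: dist_norm scaleR_diff_right[symmetric])
    also have "\<dots> \<le> B * (2 * dist x y)" using c(2)[of n] B(1) by (intro mult_left_mono mult_right_mono) auto
    finally show "dist (W n x) (W n y) \<le> B * 2 * dist x y" by simp
  qed
  have cW: "continuous_on UNIV (W n)" for n by (rule lipschitz_on_continuous_on[OF lW])
  have Jm: "J n \<in> borel_measurable borel" for n
  proof -
    have "(\<lambda>y::vec2. c n *\<^sub>R y) \<in> borel_measurable borel"
      by (intro borel_measurable_continuous_onI continuous_intros)
    from measurable_compose[OF this H0m] show ?thesis
      unfolding J_def[abs_def] by (intro borel_measurable_scaleR) auto
  qed
  have JB: "norm (J n y) \<le> 2 * B" for n y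
    using c(1,2)[of n] H0B[of "c n *\<^sub>R y"] B(1) by (simp add: J_def) (intro mult_mono, auto)
  \<comment> \<open>The frontier of the squeezed pipe, the only place where the extension by zero
    may fail to be differentiable; it is negligible as the frontier of a convex set.\<close>
  define N where "N n = frontier ((\<lambda>x. (1 - \<delta> n) *\<^sub>R x) ` ?O)" for n
  have N: "negligible (N n)" for n
    unfolding N_def by (intro negligible_convex_frontier convex_scaling convex_Omega)
  have DW: "(W n has_derivative (\<lambda>h. J n z *v h)) (at z)" if z: "z \<notin> N n" for n z
  proof -
    let ?S = "(\<lambda>x. (1 - \<delta> n) *\<^sub>R x) ` ?O"
    have iff: "y \<in> ?S \<longleftrightarrow> c n *\<^sub>R y \<in> ?O" for y
    proof
      assume "y \<in> ?S" then show "c n *\<^sub>R y \<in> ?O" using c(4)[of n] by auto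
    next
      assume "c n *\<^sub>R y \<in> ?O"
      moreover have "y = (1 - \<delta> n) *\<^sub>R (c n *\<^sub>R y)" using c(4)[of n] by (simp add: mult.commute)
      ultimately show "y \<in> ?S" by blast
    qed
    have oS: "open ?S" using \<delta>(2)[of n] by (intro open_scaling open_Omega) simp
    have sc: "((\<lambda>y. c n *\<^sub>R y) has_derivative (\<lambda>h. c n *\<^sub>R h)) (at z)"
      by (auto intro!: derivative_eq_intros)
    show ?thesis
    proof (cases "z \<in> ?S")
      case True
      then have z\<Omega>: "c n *\<^sub>R z \<in> ?O" using iff by blast
      have "((\<lambda>y. w (c n *\<^sub>R y)) has_derivative (\<lambda>h. H (c n *\<^sub>R z) *v (c n *\<^sub>R h))) (at z)"
        by (rule has_derivative_compose[OF sc d[OF z\<Omega>]])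
      then have "((\<lambda>y. w (c n *\<^sub>R y)) has_derivative (\<lambda>h. J n z *v h)) (at z)"
        using z\<Omega> by (simp add: J_def H0_def matrix_vector_mult_scaleR scaleR_matrix_vector_assoc)
      then show ?thesis
        by (rule has_derivative_transform_within_open[OF _ oS True]) (use iff in \<open>auto simp: W_def\<close>)
    next
      case False
      then have "z \<in> - closure ?S" using z by (auto simp: N_def frontier_def interior_open[OF oS])
      moreover have "J n z = 0" using False iff by (simp add: J_def H0_def)
      ultimately show ?thesis
        by (intro has_derivative_transform_within_open[of "\<lambda>y. 0" "\<lambda>h. J n z *v h" z UNIV "- closure ?S" "W n"])
          (use iff closure_subset[of ?S] in \<open>auto simp: W_def\<close>)
    qed
  qed
  define \<phi> where "\<phi> n = mol (\<eta> n) (W n)" for n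
  have iJ: "integrable lborel (\<lambda>y. \<eta> n (x - y) *\<^sub>R J n y)" for n x
    by (rule integrable_mollifier_times[OF \<eta> Jm JB])
  have jac: "jacobian (\<phi> n) (at x) = (LINT y|lborel. \<eta> n (x - y) *\<^sub>R J n y)" for n x
  proof -
    have "frechet_derivative (\<phi> n) (at x) h = (LINT y|lborel. \<eta> n (x - y) *\<^sub>R J n y) *v h" for h
    proof -
      have bl: "bounded_linear (\<lambda>A :: real^2^2. A *v h)"
        unfolding linear_conv_bounded_linear[symmetric]
        by (simp add: linear_iff matrix_vector_mult_add_rdistrib scaleR_matrix_vector_assoc)
      have "(\<lambda>z. J n z *v h) \<in> borel_measurable borel"
        using measurable_compose[OF Jm borel_measurable_continuous_onI[OF linear_continuous_on[OF bl]]] .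
      then have "frechet_derivative (\<phi> n) (at x) h = (LINT y|lborel. \<eta> n (x - y) *\<^sub>R (J n y *v h))"
        unfolding \<phi>_def by (intro mol_derivative_lipschitz[OF \<eta> lW N DW])
      also have "\<dots> = (LINT y|lborel. (\<eta> n (x - y) *\<^sub>R J n y) *v h)"
        by (simp add: scaleR_matrix_vector_assoc)
      also have "\<dots> = (LINT y|lborel. \<eta> n (x - y) *\<^sub>R J n y) *v h"
        by (rule integral_bounded_linear[OF bl iJ])
      finally show ?thesis .
    qed
    then have "frechet_derivative (\<phi> n) (at x) = (\<lambda>h. (LINT y|lborel. \<eta> n (x - y) *\<^sub>R J n y) *v h)" by auto
    then show ?thesis by (simp add: jacobian_def)
  qed
  have near: "norm (c n *\<^sub>R y - x) \<le> 2 * \<delta> n * (1 + norm x)" if "norm (x - y) \<le> r n" for n x y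
  proof -
    have "c n *\<^sub>R y - x = c n *\<^sub>R (y - x) + (c n - 1) *\<^sub>R x" by (simp add: algebra_simps)
    then have "norm (c n *\<^sub>R y - x) \<le> norm (c n *\<^sub>R (y - x)) + norm ((c n - 1) *\<^sub>R x)"
      by (metis norm_triangle_ineq)
    also have "\<dots> = c n * norm (y - x) + (c n - 1) * norm x" using c(1)[of n] by simp
    also have "\<dots> \<le> 2 * \<delta> n + (2 * \<delta> n) * norm x"
      using c(1-3)[of n] that r(2)[of n] \<delta>(1)[of n]
      by (intro add_mono mult_mono mult_right_mono) (auto simp: norm_minus_commute)
    finally show ?thesis by (simp add: algebra_simps)
  qed
  have near0: "(\<lambda>n. 2 * \<delta> n * (1 + norm x)) \<longlonglongrightarrow> 0" for x :: vec2
    using tendsto_mult_right[OF tendsto_mult_left[OF \<delta>0, of 2], of "1 + norm x"] by simp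
  have wB0: "norm (?w x) \<le> B0" for x using B0 sub by auto
  show ?thesis
  proof (rule that[of \<phi> "max B0 (2 * B)"])
    fix n
    show "\<phi> n \<in> test_functions ?O"
    proof (rule test_functionsI)
      show "Ck k (\<phi> n)" for k
        unfolding \<phi>_def by (rule Ck_mol[OF is_mollifierD(1,3)[OF \<eta>] cW])
      \<comment> \<open>The squeezed pipe enlarged by the mollification radius: half of the margin
        remains free.\<close>
      let ?C = "cbox (vector [- (L - \<delta> n * L / 2), - (1 - \<delta> n / 2)]) (vector [L - \<delta> n * L / 2, 1 - \<delta> n / 2]) :: vec2 set"
      show "compact ?C" by simp
      have "\<delta> n * L > 0" using \<delta>(1) L by simp
      then show "?C \<subseteq> ?O" using \<delta>[of n] by (auto simp: mem_box_cart forall_2 Omega_def)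
      fix x assume "\<phi> n x \<noteq> 0"
      then obtain y where y: "\<eta> n (x - y) *\<^sub>R W n y \<noteq> 0"
        unfolding \<phi>_def mol_def by (metis (no_types, lifting) Bochner_Integration.integral_cong integral_zero)
      then have "norm (x - y) \<le> r n" "c n *\<^sub>R y \<in> ?O"
        using is_mollifierD(3)[OF \<eta>, of n "x - y"] by (auto simp: W_def split: if_splits)
      then have xy: "\<bar>(x - y)$i\<bar> \<le> r n" for i
        using component_le_norm_cart order_trans by blast
      have "c n * \<bar>y$1\<bar> \<le> L" "c n * \<bar>y$2\<bar> \<le> 1"
        using \<open>c n *\<^sub>R y \<in> ?O\<close> c(1)[of n] by (auto simp: Omega_def abs_if)
      from mult_left_mono[OF this(1), of "1 - \<delta> n"] mult_left_mono[OF this(2), of "1 - \<delta> n"]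
      have "\<bar>y$1\<bar> \<le> (1 - \<delta> n) * L" "\<bar>y$2\<bar> \<le> 1 - \<delta> n"
        using c(4)[of n] \<delta>[of n] by (auto simp: mult.assoc[symmetric] mult.commute)
      then show "x \<in> ?C"
        using xy[of 1] xy[of 2] r(3,4)[of n] by (auto simp: mem_box_cart forall_2 algebra_simps abs_le_iff)
    qed
    fix x
    show "trace (jacobian (\<phi> n) (at x)) = 0"
    proof -
      have "trace (J n y) = 0" for y
        using tr by (simp add: J_def H0_def linear_scale[OF bounded_linear.linear[OF bounded_linear_trace]]
            linear_0[OF bounded_linear.linear[OF bounded_linear_trace]])
      then have "(LINT y|lborel. trace (\<eta> n (x - y) *\<^sub>R J n y)) = 0"
        by (simp add: linear_scale[OF bounded_linear.linear[OF bounded_linear_trace]])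
      then show ?thesis
        unfolding jac integral_bounded_linear[OF bounded_linear_trace iJ] .
    qed
    have "norm (\<phi> n x - 0) \<le> B0"
      unfolding \<phi>_def by (rule mol_close[OF \<eta> cW]) (use wB0 in \<open>simp add: W_def\<close>)
    then show "norm (\<phi> n x) \<le> max B0 (2 * B)" by simp
    have "norm (jacobian (\<phi> n) (at x) - 0) \<le> 2 * B"
      unfolding jac by (rule mollifier_average_close[OF \<eta> iJ]) (use JB in simp)
    then show "norm (jacobian (\<phi> n) (at x)) \<le> max B0 (2 * B)" by simp
  next
    fix x assume x: "x \<in> ?O"
    have close: "norm (\<phi> n x - w x) \<le> B * (2 * \<delta> n * (1 + norm x))" for n
      unfolding \<phi>_def
    proof (rule mol_close[OF \<eta> cW])
      fix y assume y: "norm (x - y) \<le> r n"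
      have "norm (W n y - w x) = dist (?w (c n *\<^sub>R y)) (?w x)" using x by (simp add: W_def dist_norm)
      also have "\<dots> \<le> B * dist (c n *\<^sub>R y) x" by (rule lipschitz_onD[OF lw]) auto
      also have "\<dots> \<le> B * (2 * \<delta> n * (1 + norm x))"
        using near[OF y] B(1) by (intro mult_left_mono) (simp_all add: dist_norm)
      finally show "norm (W n y - w x) \<le> B * (2 * \<delta> n * (1 + norm x))" .
    qed
    have "(\<lambda>n. B * (2 * \<delta> n * (1 + norm x))) \<longlonglongrightarrow> B * 0"
      by (rule tendsto_mult_left[OF near0])
    then have "(\<lambda>n. B * (2 * \<delta> n * (1 + norm x))) \<longlonglongrightarrow> 0" by simp
    then have "(\<lambda>n. \<phi> n x - w x) \<longlonglongrightarrow> 0"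
      by (rule Lim_null_comparison[rotated]) (simp add: close)
    then show "(\<lambda>n. \<phi> n x) \<longlonglongrightarrow> w x" by (simp add: LIM_zero_iff)
    show "(\<lambda>n. jacobian (\<phi> n) (at x)) \<longlonglongrightarrow> H x"
    proof (rule metric_LIMSEQ_I)
      fix e :: real assume e: "e > 0"
      obtain s where s: "s > 0" "ball x s \<subseteq> ?O" using open_Omega x open_contains_ball by blast
      have "continuous (at x) H"
        using H x sub open_Omega by (metis continuous_on_eq_continuous_at continuous_on_subset)
      then obtain t where t: "t > 0" "\<And>z. dist z x < t \<Longrightarrow> dist (H z) (H x) < e / 3"
        using e unfolding continuous_at_eps_delta by (metis zero_less_divide_iff zero_less_numeral)
      have "\<forall>\<^sub>F n in sequentially. 2 * \<delta> n * (1 + norm x) < min s t"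
        using near0[of x] s t by (intro order_tendstoD) auto
      moreover have "\<forall>\<^sub>F n in sequentially. 2 * \<delta> n * B < e / 3"
      proof -
        have "(\<lambda>n. 2 * \<delta> n * B) \<longlonglongrightarrow> 0"
          using tendsto_mult_right[OF tendsto_mult_left[OF \<delta>0, of 2], of B] by simp
        then show ?thesis using e by (intro order_tendstoD) auto
      qed
      ultimately have "\<forall>\<^sub>F n in sequentially. dist (jacobian (\<phi> n) (at x)) (H x) < e"
      proof eventually_elim
        case (elim n)
        have "norm (jacobian (\<phi> n) (at x) - H x) \<le> 2 * (e / 3)"
          unfolding jac
        proof (rule mollifier_average_close[OF \<eta> iJ])
          fix y assume "norm (x - y) \<le> r n"
          from near[OF this] elim have z: "dist (c n *\<^sub>R y) x < s" "dist (c n *\<^sub>R y) x < t"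
            by (auto simp: dist_norm)
          then have z\<Omega>: "c n *\<^sub>R y \<in> ?O" using s by (auto simp: dist_commute)
          have "J n y - H x = (c n - 1) *\<^sub>R H (c n *\<^sub>R y) + (H (c n *\<^sub>R y) - H x)"
            using z\<Omega> by (simp add: J_def H0_def algebra_simps)
          then have "norm (J n y - H x) \<le> norm ((c n - 1) *\<^sub>R H (c n *\<^sub>R y)) + norm (H (c n *\<^sub>R y) - H x)"
            by (metis norm_triangle_ineq)
          also have "\<dots> \<le> 2 * \<delta> n * B + e / 3"
          proof (rule add_mono)
            have "norm ((c n - 1) *\<^sub>R H (c n *\<^sub>R y)) = (c n - 1) * norm (H (c n *\<^sub>R y))" using c(1)[of n] by simp
            also have "\<dots> \<le> 2 * \<delta> n * B"
              using c(1,3)[of n] B(2)[of "c n *\<^sub>R y"] z\<Omega> sub \<delta>(1)[of n] by (intro mult_mono) auto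
            finally show "norm ((c n - 1) *\<^sub>R H (c n *\<^sub>R y)) \<le> 2 * \<delta> n * B" .
            show "norm (H (c n *\<^sub>R y) - H x) \<le> e / 3" using t(2)[OF z(2)] by (simp add: dist_norm)
          qed
          finally show "norm (J n y - H x) \<le> 2 * (e / 3)" using elim(2) by simp
        qed
        then show ?case using e by (simp add: dist_norm)
      qed
      then show "\<exists>no. \<forall>n\<ge>no. dist (jacobian (\<phi> n) (at x)) (H x) < e"
        by (simp add: eventually_sequentially)
    qed
  qed
qed


section \<open>The energy estimate\<close>

lemma test_function_smooth:
  assumes "\<phi> \<in> test_functions S"
  shows "continuous_on A \<phi>" "\<phi> differentiable (at x)" "continuous_on A (\<lambda>x. frechet_derivative \<phi> (at x) h)"
proof -
  have Ck: "Ck k \<phi>" for k using assms by (simp add: test_functions_def)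
  show "continuous_on A \<phi>" using Ck[of 0] continuous_on_subset by auto
  show d: "\<phi> differentiable (at x)" for x using Ck[of 1] by simp
  have c: "continuous_on A (\<lambda>x. frechet_derivative \<phi> (at x) b)" if "b \<in> Basis" for b
  proof -
    have "continuous_on UNIV (\<lambda>x. frechet_derivative \<phi> (at x) b)" using Ck[of "Suc 0"] that by simp
    then show ?thesis by (rule continuous_on_subset) simp
  qed
  have "frechet_derivative \<phi> (at x) h = (\<Sum>b\<in>Basis. (h \<bullet> b) *\<^sub>R frechet_derivative \<phi> (at x) b)" for x
  proof -
    have l: "linear (frechet_derivative \<phi> (at x))" by (rule linear_frechet_derivative[OF d])
    have "frechet_derivative \<phi> (at x) h = frechet_derivative \<phi> (at x) (\<Sum>b\<in>Basis. (h \<bullet> b) *\<^sub>R b)"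
      by (simp add: euclidean_representation)
    then show ?thesis by (simp add: linear_sum[OF l] linear_scale[OF l])
  qed
  then show "continuous_on A (\<lambda>x. frechet_derivative \<phi> (at x) h)"
    by (simp only:) (intro continuous_intros c)
qed

lemma test_function_jacobian_continuous:
  fixes \<phi> :: "real^'n \<Rightarrow> real^'m"
  assumes "\<phi> \<in> test_functions S"
  shows "continuous_on A (\<lambda>x. jacobian \<phi> (at x))"
  unfolding jacobian_def matrix_def
  by (intro continuous_on_vec_lambda continuous_on_component test_function_smooth[OF assms])

text \<open>On solenoidal test functions the pressure drops out, and with it the fact that two
  solutions have unrelated pressures.\<close>

lemma navier_stokes_divfree:
  assumes ns: "navier_stokes L u f" and \<phi>: "\<phi> \<in> test_functions (Omega L)"
    and tr: "\<And>x. trace (jacobian \<phi> (at x)) = 0"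
  shows "(LINT x|lebesgue_on (Omega L). (jacobian u (at x) *v u x) \<bullet> \<phi> x + jacobian u (at x) \<bullet> jacobian \<phi> (at x)) =
      (LINT x|lebesgue_on (Omega L). drag u f x \<bullet> \<phi> x)"
    and "integrable (lebesgue_on (Omega L)) (\<lambda>x. drag u f x \<bullet> \<phi> x)"
proof -
  obtain p where "(LINT x|lebesgue_on (Omega L).
             (jacobian u (at x) *v u x) \<bullet> \<phi> x + jacobian u (at x) \<bullet> jacobian \<phi> (at x)
             - p x * trace (jacobian \<phi> (at x)))
          = (LINT x|lebesgue_on (Omega L). drag u f x \<bullet> \<phi> x)"
    using ns \<phi> unfolding navier_stokes_def by blast
  then show "(LINT x|lebesgue_on (Omega L). (jacobian u (at x) *v u x) \<bullet> \<phi> x + jacobian u (at x) \<bullet> jacobian \<phi> (at x)) =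
      (LINT x|lebesgue_on (Omega L). drag u f x \<bullet> \<phi> x)"
    by (simp add: tr)
  show "integrable (lebesgue_on (Omega L)) (\<lambda>x. drag u f x \<bullet> \<phi> x)"
  proof (rule integrable_locally_inner[OF open_Omega])
    show "locally_integrable_on (drag u f) (Omega L)" using ns by (simp add: navier_stokes_def)
    show "compact (closure (support_on UNIV \<phi>))" "closure (support_on UNIV \<phi>) \<subseteq> Omega L"
      using \<phi> by (auto simp: test_functions_def)
    show "continuous_on UNIV \<phi>" by (rule test_function_smooth[OF \<phi>])
    show "y \<in> closure (support_on UNIV \<phi>)" if "\<phi> y \<noteq> 0" for y
      using that closure_subset[of "support_on UNIV \<phi>"] by (auto simp: support_on_def)
  qed
qed

lemma continuous_on_matrix_vector_mult:
  assumes "continuous_on A G" "continuous_on A (v :: 'a::topological_space \<Rightarrow> real^'n)"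
  shows "continuous_on A (\<lambda>x. (G x :: real^'n^'m) *v v x)"
  unfolding matrix_vector_mult_def
  by (intro continuous_on_vec_lambda continuous_on_sum continuous_on_mult continuous_on_component assms)

text \<open>The difference of the momentum equations is tested with solenoidal approximations of w =
  u' - u, followed by dominated convergence. The drags are only locally integrable, so no limit is
  taken in them: their difference is first bounded by the continuous \<open>Dg\<close>, and the
  limit is taken in the inequality.\<close>

lemma navier_stokes_energy:
  fixes u u' :: "vec2 \<Rightarrow> vec2"
  assumes L: "0 < L"
    and G: "continuous_on (closure (Omega L)) G" "\<And>x. x \<in> Omega L \<Longrightarrow> G x = jacobian u (at x)"
    and G': "continuous_on (closure (Omega L)) G'" "\<And>x. x \<in> Omega L \<Longrightarrow> G' x = jacobian u' (at x)"
    and u: "continuous_on (closure (Omega L)) u" "\<And>x. x \<in> Omega L \<Longrightarrow> u differentiable (at x)"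
    and u': "continuous_on (closure (Omega L)) u'" "\<And>x. x \<in> Omega L \<Longrightarrow> u' differentiable (at x)"
    and bd: "\<And>x. x \<in> frontier (Omega L) \<Longrightarrow> u' x = u x"
    and ns: "navier_stokes L u f" and ns': "navier_stokes L u' f'"
    and Dg: "continuous_on (closure (Omega L)) Dg"
      "AE x in lebesgue_on (Omega L). norm (drag u' f' x - drag u f x) \<le> Dg x"
  shows "(LINT x|lebesgue_on (Omega L). (G' x *v u' x - G x *v u x) \<bullet> (u' x - u x) + (norm (G' x - G x))\<^sup>2)
     \<le> (LINT x|lebesgue_on (Omega L). Dg x * norm (u' x - u x))"
proof -
  let ?M = "lebesgue_on (Omega L)"
  let ?w = "\<lambda>x. u' x - u x" and ?H = "\<lambda>x. G' x - G x" and ?N = "\<lambda>x. G' x *v u' x - G x *v u x"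
  have cH: "continuous_on (closure (Omega L)) ?H" and cw: "continuous_on (closure (Omega L)) ?w"
    and cN: "continuous_on (closure (Omega L)) ?N"
    by (intro continuous_on_diff G G' u u' continuous_on_matrix_vector_mult)+
  have dw: "(?w has_derivative (\<lambda>h. ?H x *v h)) (at x)" if x: "x \<in> Omega L" for x
  proof -
    have "(u' has_derivative (\<lambda>h. G' x *v h)) (at x)" "(u has_derivative (\<lambda>h. G x *v h)) (at x)"
      using u(2)[OF x] u'(2)[OF x] jacobian_works[of u "at x"] jacobian_works[of u' "at x"] G(2)[OF x] G'(2)[OF x] by auto
    from has_derivative_diff[OF this] show ?thesis by (simp add: matrix_vector_mult_diff_rdistrib)
  qed
  have tr: "trace (?H x) = 0" if x: "x \<in> Omega L" for x
    using ns ns' G(2)[OF x] G'(2)[OF x] x bounded_linear.linear[OF bounded_linear_trace, THEN linear_diff, of "G' x" "G x"]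
    by (simp add: navier_stokes_def)
  obtain \<phi> B where \<phi>: "\<And>n. \<phi> n \<in> test_functions (Omega L)" "\<And>n x. trace (jacobian (\<phi> n) (at x)) = 0"
    "\<And>x. x \<in> Omega L \<Longrightarrow> (\<lambda>n. \<phi> n x) \<longlonglongrightarrow> ?w x"
    "\<And>x. x \<in> Omega L \<Longrightarrow> (\<lambda>n. jacobian (\<phi> n) (at x)) \<longlonglongrightarrow> ?H x"
    "\<And>n x. norm (\<phi> n x) \<le> B" "\<And>n x. norm (jacobian (\<phi> n) (at x)) \<le> B"
    using divergence_free_approximation[OF L cH cw _ dw tr] bd by auto
  have B: "0 \<le> B" using \<phi>(5) norm_ge_zero order_trans by blast
  note c\<phi> = test_function_smooth(1)[OF \<phi>(1)] and cJ = test_function_jacobian_continuous[OF \<phi>(1)]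
  obtain b1 where b1: "b1 \<ge> 0" "\<And>x. x \<in> closure (Omega L) \<Longrightarrow> norm (?N x) \<le> b1"
    using continuous_on_closure_Omega_bounded[OF L cN] by blast
  obtain b2 where b2: "b2 \<ge> 0" "\<And>x. x \<in> closure (Omega L) \<Longrightarrow> norm (?H x) \<le> b2"
    using continuous_on_closure_Omega_bounded[OF L cH] by blast
  obtain b3 where b3: "b3 \<ge> 0" "\<And>x. x \<in> closure (Omega L) \<Longrightarrow> norm (Dg x) \<le> b3"
    using continuous_on_closure_Omega_bounded[OF L Dg(1)] by blast
  have in_closure: "x \<in> closure (Omega L)" and in_\<Omega>: "x \<in> Omega L" if "x \<in> space ?M" for x
    using that closure_subset[of "Omega L"] by (auto simp: space_restrict_space)
  note intgr = continuous_on_closure_Omega_integrable[OF L]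
  have step: "(LINT x|?M. ?N x \<bullet> \<phi> n x + ?H x \<bullet> jacobian (\<phi> n) (at x)) \<le> (LINT x|?M. Dg x * norm (\<phi> n x))" for n
  proof -
    have e: "(LINT x|?M. (v x) \<bullet> \<phi> n x + Gv x \<bullet> jacobian (\<phi> n) (at x)) = (LINT x|?M. drag y g x \<bullet> \<phi> n x)"
      if "\<And>x. x \<in> Omega L \<Longrightarrow> Gv x = jacobian y (at x)" "\<And>x. v x = Gv x *v y x" "navier_stokes L y g" for v Gv y g
    proof -
      have "(LINT x|?M. (v x) \<bullet> \<phi> n x + Gv x \<bullet> jacobian (\<phi> n) (at x)) =
         (LINT x|?M. (jacobian y (at x) *v y x) \<bullet> \<phi> n x + jacobian y (at x) \<bullet> jacobian (\<phi> n) (at x))"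
        by (rule Bochner_Integration.integral_cong[OF refl]) (use that(1,2) in_\<Omega> in simp)
      then show ?thesis using navier_stokes_divfree(1)[OF that(3) \<phi>(1,2)] by simp
    qed
    have i: "integrable ?M (\<lambda>x. (G' x *v u' x) \<bullet> \<phi> n x + G' x \<bullet> jacobian (\<phi> n) (at x))"
       "integrable ?M (\<lambda>x. (G x *v u x) \<bullet> \<phi> n x + G x \<bullet> jacobian (\<phi> n) (at x))"
      by (intro intgr continuous_on_add continuous_on_inner continuous_on_matrix_vector_mult G G' u u' c\<phi> cJ)+
    have j: "integrable ?M (\<lambda>x. drag u' f' x \<bullet> \<phi> n x)" "integrable ?M (\<lambda>x. drag u f x \<bullet> \<phi> n x)"
      by (rule navier_stokes_divfree(2)[OF ns' \<phi>(1,2)], rule navier_stokes_divfree(2)[OF ns \<phi>(1,2)])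
    have "(LINT x|?M. ?N x \<bullet> \<phi> n x + ?H x \<bullet> jacobian (\<phi> n) (at x)) =
      (LINT x|?M. ((G' x *v u' x) \<bullet> \<phi> n x + G' x \<bullet> jacobian (\<phi> n) (at x))
        - ((G x *v u x) \<bullet> \<phi> n x + G x \<bullet> jacobian (\<phi> n) (at x)))"
      by (simp add: inner_diff_left algebra_simps)
    also have "\<dots> = (LINT x|?M. drag u' f' x \<bullet> \<phi> n x) - (LINT x|?M. drag u f x \<bullet> \<phi> n x)"
      unfolding Bochner_Integration.integral_diff[OF i]
      by (simp only: e[OF G'(2) refl ns'] e[OF G(2) refl ns])
    also have "\<dots> = (LINT x|?M. drag u' f' x \<bullet> \<phi> n x - drag u f x \<bullet> \<phi> n x)"
      by (rule Bochner_Integration.integral_diff[OF j, symmetric])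
    also have "\<dots> \<le> (LINT x|?M. Dg x * norm (\<phi> n x))"
    proof (rule integral_mono_AE)
      show "integrable ?M (\<lambda>x. drag u' f' x \<bullet> \<phi> n x - drag u f x \<bullet> \<phi> n x)"
        by (rule Bochner_Integration.integrable_diff[OF j])
      show "integrable ?M (\<lambda>x. Dg x * norm (\<phi> n x))"
        by (intro intgr continuous_on_mult continuous_on_norm c\<phi> Dg)
      show "AE x in ?M. drag u' f' x \<bullet> \<phi> n x - drag u f x \<bullet> \<phi> n x \<le> Dg x * norm (\<phi> n x)"
        using Dg(2)
      proof eventually_elim
        case (elim x)
        have "drag u' f' x \<bullet> \<phi> n x - drag u f x \<bullet> \<phi> n x \<le> norm (drag u' f' x - drag u f x) * norm (\<phi> n x)"
          using norm_cauchy_schwarz[of "drag u' f' x - drag u f x" "\<phi> n x"] by (simp add: inner_diff_left)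
        also have "\<dots> \<le> Dg x * norm (\<phi> n x)" using elim by (intro mult_right_mono) auto
        finally show ?case .
      qed
    qed
    finally show ?thesis .
  qed
  have ci: "integrable ?M (\<lambda>x. c)" for c :: real
    by (intro intgr continuous_on_const)
  have "(\<lambda>n. LINT x|?M. ?N x \<bullet> \<phi> n x + ?H x \<bullet> jacobian (\<phi> n) (at x)) \<longlonglongrightarrow> (LINT x|?M. ?N x \<bullet> ?w x + ?H x \<bullet> ?H x)"
  proof (rule integral_dominated_convergence[where w="\<lambda>x. b1 * B + b2 * B"])
    show "(\<lambda>x. ?N x \<bullet> ?w x + ?H x \<bullet> ?H x) \<in> borel_measurable ?M"
      by (intro borel_measurable_integrable intgr continuous_on_add continuous_on_inner cN cw cH)
    show "(\<lambda>x. ?N x \<bullet> \<phi> n x + ?H x \<bullet> jacobian (\<phi> n) (at x)) \<in> borel_measurable ?M" for n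
      by (intro borel_measurable_integrable intgr continuous_on_add continuous_on_inner cN c\<phi> cH cJ)
    show "integrable ?M (\<lambda>x. b1 * B + b2 * B)" by (rule ci)
    show "AE x in ?M. (\<lambda>n. ?N x \<bullet> \<phi> n x + ?H x \<bullet> jacobian (\<phi> n) (at x)) \<longlonglongrightarrow> ?N x \<bullet> ?w x + ?H x \<bullet> ?H x"
    proof (rule AE_I2)
      fix x assume "x \<in> space ?M"
      from in_\<Omega>[OF this] show "(\<lambda>n. ?N x \<bullet> \<phi> n x + ?H x \<bullet> jacobian (\<phi> n) (at x)) \<longlonglongrightarrow> ?N x \<bullet> ?w x + ?H x \<bullet> ?H x"
        by (intro tendsto_add tendsto_inner tendsto_const \<phi>(3,4))
    qed
    show "AE x in ?M. norm (?N x \<bullet> \<phi> n x + ?H x \<bullet> jacobian (\<phi> n) (at x)) \<le> b1 * B + b2 * B" for n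
    proof (rule AE_I2)
      fix x assume "x \<in> space ?M"
      note x = in_closure[OF this]
      have "norm (?N x \<bullet> \<phi> n x + ?H x \<bullet> jacobian (\<phi> n) (at x)) \<le> norm (?N x) * norm (\<phi> n x) + norm (?H x) * norm (jacobian (\<phi> n) (at x))"
        unfolding real_norm_def
        by (rule order_trans[OF abs_triangle_ineq]) (intro add_mono Cauchy_Schwarz_ineq2)
      also have "\<dots> \<le> b1 * B + b2 * B"
        by (intro add_mono mult_mono b1 b2 \<phi>(5,6) x norm_ge_zero)
      finally show "norm (?N x \<bullet> \<phi> n x + ?H x \<bullet> jacobian (\<phi> n) (at x)) \<le> b1 * B + b2 * B" .
    qed
  qed
  moreover have "(\<lambda>n. LINT x|?M. Dg x * norm (\<phi> n x)) \<longlonglongrightarrow> (LINT x|?M. Dg x * norm (?w x))"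
  proof (rule integral_dominated_convergence[where w="\<lambda>x. b3 * B"])
    show "(\<lambda>x. Dg x * norm (?w x)) \<in> borel_measurable ?M"
      by (intro borel_measurable_integrable intgr continuous_on_mult continuous_on_norm Dg cw)
    show "(\<lambda>x. Dg x * norm (\<phi> n x)) \<in> borel_measurable ?M" for n
      by (intro borel_measurable_integrable intgr continuous_on_mult continuous_on_norm Dg c\<phi>)
    show "integrable ?M (\<lambda>x. b3 * B)" by (rule ci)
    show "AE x in ?M. (\<lambda>n. Dg x * norm (\<phi> n x)) \<longlonglongrightarrow> Dg x * norm (?w x)"
    proof (rule AE_I2)
      fix x assume "x \<in> space ?M"
      from in_\<Omega>[OF this] show "(\<lambda>n. Dg x * norm (\<phi> n x)) \<longlonglongrightarrow> Dg x * norm (?w x)"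
        by (intro tendsto_mult tendsto_norm tendsto_const \<phi>(3))
    qed
    show "AE x in ?M. norm (Dg x * norm (\<phi> n x)) \<le> b3 * B" for n
    proof (rule AE_I2)
      fix x assume "x \<in> space ?M"
      note x = in_closure[OF this]
      have "norm (Dg x * norm (\<phi> n x)) = norm (Dg x) * norm (\<phi> n x)" by (simp add: abs_mult)
      also have "\<dots> \<le> b3 * B" by (intro mult_mono b3 \<phi>(5) x norm_ge_zero)
      finally show "norm (Dg x * norm (\<phi> n x)) \<le> b3 * B" .
    qed
  qed
  ultimately have "(LINT x|?M. ?N x \<bullet> ?w x + ?H x \<bullet> ?H x) \<le> (LINT x|?M. Dg x * norm (?w x))"
    by (rule LIMSEQ_le) (use step in blast)
  then show ?thesis by (simp only: power2_norm_eq_inner)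
qed

section \<open>The drag forces of two nearby solutions\<close>

lemma AE_slices_phase:
  assumes "AE z in lebesgue_on (Omega L \<times> (UNIV::vec2 set)). Q z"
  shows "AE x in lebesgue_on (Omega L). AE v in (lebesgue :: vec2 measure). Q (x, v)"
proof -
  have "AE z in (lebesgue :: phase measure). z \<in> Omega L \<times> UNIV \<longrightarrow> Q z"
    using assms open_Omega_UNIV[of L] by (simp add: AE_restrict_space_iff)
  then have "AE z in (lborel :: phase measure). z \<in> Omega L \<times> UNIV \<longrightarrow> Q z"
    unfolding AE_completion_iff .
  then have "AE z in lborel \<Otimes>\<^sub>M lborel. z \<in> Omega L \<times> UNIV \<longrightarrow> Q z"
    unfolding lborel_prod .
  then have "AE x in lborel. AE v in lborel. (x, v) \<in> Omega L \<times> UNIV \<longrightarrow> Q (x, v)"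
    by (rule lborel_pair.AE_pair)
  then have "AE x in lborel. x \<in> Omega L \<longrightarrow> (AE v in lebesgue. Q (x, v))"
  proof eventually_elim
    case (elim x)
    then show ?case unfolding AE_completion_iff by auto
  qed
  then have "AE x in lebesgue. x \<in> Omega L \<longrightarrow> (AE v in lebesgue. Q (x, v))"
    by (rule AE_completion)
  then show ?thesis using open_Omega[of L] by (simp add: AE_restrict_space_iff)
qed

lemma drag_eq_continuous:
  assumes x: "x \<in> Omega L" and F: "continuous_on (closure (Omega L) \<times> UNIV) (F :: phase \<Rightarrow> real)"
    and ae: "AE v in lebesgue. f (x, v) = F (x, v)"
    and i: "integrable lebesgue (\<lambda>v. f (x, v) *\<^sub>R (v - u x))"
  shows "drag u f x = (LINT v|lborel. F (x, v) *\<^sub>R (v - u x))"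
proof -
  have xc: "x \<in> closure (Omega L)" using x closure_subset by blast
  have "continuous_on UNIV (\<lambda>v. F (x, v))"
    by (rule continuous_on_compose2[OF F]) (use xc in \<open>auto intro!: continuous_intros\<close>)
  then have m: "(\<lambda>v. F (x, v) *\<^sub>R (v - u x)) \<in> borel_measurable borel"
    by (intro borel_measurable_continuous_onI continuous_intros)
  have "drag u f x = (LINT v|lebesgue. F (x, v) *\<^sub>R (v - u x))"
    unfolding drag_def
  proof (rule integral_cong_AE)
    show "(\<lambda>v. f (x, v) *\<^sub>R (v - u x)) \<in> borel_measurable lebesgue" using i by (rule borel_measurable_integrable)
    show "(\<lambda>v. F (x, v) *\<^sub>R (v - u x)) \<in> borel_measurable lebesgue"
      by (rule measurable_completion) (use m in simp)
    show "AE v in lebesgue. f (x, v) *\<^sub>R (v - u x) = F (x, v) *\<^sub>R (v - u x)"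
      using ae by eventually_elim simp
  qed
  also have "\<dots> = (LINT v|lborel. F (x, v) *\<^sub>R (v - u x))"
    by (rule integral_completion) (use m in simp)
  finally show ?thesis .
qed

text \<open>F' (v - u') - F (v - u) = (F' - F)(v - u') - F (u' - u): the first part is bounded by
  \<open>E\<close> on velocities of size at most \<open>R\<close>, the second by the smallness of
  \<open>F\<close> itself.\<close>

lemma drag_difference:
  fixes F F' :: "phase \<Rightarrow> real"
  assumes L: "0 < L" and F: "continuous_on (closure (Omega L) \<times> UNIV) F" "AE z in lebesgue_on (Omega L \<times> UNIV). f z = F z"
    and F': "continuous_on (closure (Omega L) \<times> UNIV) F'" "AE z in lebesgue_on (Omega L \<times> UNIV). f' z = F' z"
    and ns: "navier_stokes L u f" "navier_stokes L u' f'"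
    and R: "0 \<le> R" "0 \<le> E" "0 \<le> e"
    and supp: "\<And>x v. x \<in> Omega L \<Longrightarrow> F (x, v) \<noteq> 0 \<or> F' (x, v) \<noteq> 0 \<Longrightarrow> norm v \<le> R \<and> \<bar>F (x, v) - F' (x, v)\<bar> \<le> E"
    and Fe: "\<And>x v. x \<in> Omega L \<Longrightarrow> \<bar>F (x, v)\<bar> \<le> e"
    and u': "\<And>x. x \<in> Omega L \<Longrightarrow> norm (u' x) \<le> 1"
  shows "AE x in lebesgue_on (Omega L). norm (drag u' f' x - drag u f x)
     \<le> measure lborel (cball (0::vec2) R) * (E * (R + 1) + e * norm (u' x - u x))"
proof -
  have "AE x in lebesgue_on (Omega L). x \<in> Omega L"
    by (rule AE_I2) (simp add: space_restrict_space)
  moreover have "AE x in lebesgue_on (Omega L). integrable lebesgue (\<lambda>v. f (x, v) *\<^sub>R (v - u x))"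
    "AE x in lebesgue_on (Omega L). integrable lebesgue (\<lambda>v. f' (x, v) *\<^sub>R (v - u' x))"
    using ns by (auto simp: navier_stokes_def)
  ultimately show ?thesis using AE_slices_phase[OF F(2)] AE_slices_phase[OF F'(2)]
  proof eventually_elim
    case (elim x)
    have xc: "x \<in> closure (Omega L)" using elim(1) closure_subset by blast
    have c: "continuous_on UNIV (\<lambda>v. F (x, v))" "continuous_on UNIV (\<lambda>v. F' (x, v))"
      by (rule continuous_on_compose2[OF F(1)], use xc in \<open>auto intro!: continuous_intros\<close>)
        (rule continuous_on_compose2[OF F'(1)], use xc in \<open>auto intro!: continuous_intros\<close>)
    have i: "integrable lborel (\<lambda>v. F (x, v) *\<^sub>R (v - u x))" "integrable lborel (\<lambda>v. F' (x, v) *\<^sub>R (v - u' x))"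
      by (rule integrable_continuous_bounded_support[of _ R], intro continuous_intros c, use supp[OF elim(1)] in auto)+
    have "drag u' f' x - drag u f x = (LINT v|lborel. F' (x, v) *\<^sub>R (v - u' x)) - (LINT v|lborel. F (x, v) *\<^sub>R (v - u x))"
      using drag_eq_continuous[where u=u and f=f, OF elim(1) F(1) elim(4,2)]
        drag_eq_continuous[where u=u' and f=f', OF elim(1) F'(1) elim(5,3)] by simp
    also have "\<dots> = (LINT v|lborel. F' (x, v) *\<^sub>R (v - u' x) - F (x, v) *\<^sub>R (v - u x))"
      by (rule Bochner_Integration.integral_diff[OF i(2,1), symmetric])
    also have "norm \<dots> \<le> (LINT v|lborel. indicator (cball (0::vec2) R) v * (E * (R + 1) + e * norm (u' x - u x)))"
    proof (rule Bochner_Integration.integral_norm_bound_integral)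
      show "integrable lborel (\<lambda>v. F' (x, v) *\<^sub>R (v - u' x) - F (x, v) *\<^sub>R (v - u x))"
        by (rule Bochner_Integration.integrable_diff[OF i(2,1)])
      show "integrable lborel (\<lambda>v. indicator (cball (0::vec2) R) v * (E * (R + 1) + e * norm (u' x - u x)))"
        by (intro integrable_mult_left integrable_real_indicator)
          (use emeasure_bounded_finite[OF bounded_cball, of "0::vec2" R] in auto)
      fix v
      show "norm (F' (x, v) *\<^sub>R (v - u' x) - F (x, v) *\<^sub>R (v - u x))
        \<le> indicator (cball (0::vec2) R) v * (E * (R + 1) + e * norm (u' x - u x))"
      proof (cases "F (x, v) \<noteq> 0 \<or> F' (x, v) \<noteq> 0")
        case True
        from supp[OF elim(1) this] have v: "norm v \<le> R" "\<bar>F (x, v) - F' (x, v)\<bar> \<le> E" by auto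
        have "F' (x, v) *\<^sub>R (v - u' x) - F (x, v) *\<^sub>R (v - u x) =
          (F' (x, v) - F (x, v)) *\<^sub>R (v - u' x) - F (x, v) *\<^sub>R (u' x - u x)"
          by (simp add: algebra_simps)
        then have "norm (F' (x, v) *\<^sub>R (v - u' x) - F (x, v) *\<^sub>R (v - u x)) \<le>
          norm ((F' (x, v) - F (x, v)) *\<^sub>R (v - u' x)) + norm (F (x, v) *\<^sub>R (u' x - u x))"
          by (metis norm_triangle_ineq4)
        also have "\<dots> = \<bar>F (x, v) - F' (x, v)\<bar> * norm (v - u' x) + \<bar>F (x, v)\<bar> * norm (u' x - u x)"
          by (simp add: abs_minus_commute)
        also have "\<dots> \<le> E * (R + 1) + e * norm (u' x - u x)"
        proof (intro add_mono mult_mono)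
          show "norm (v - u' x) \<le> R + 1"
            using norm_triangle_ineq4[of v "u' x"] v(1) u'[OF elim(1)] by simp
        qed (use v Fe[OF elim(1)] R in auto)
        finally show ?thesis using v(1) by simp
      next
        case False
        then show ?thesis using R by simp
      qed
    qed
    also have "\<dots> = measure lborel (cball (0::vec2) R) * (E * (R + 1) + e * norm (u' x - u x))"
      by simp
    finally show ?case .
  qed
qed


section \<open>Solutions near the Poiseuille flow\<close>

lemma Linf_norm_lessD:
  assumes "Linf_norm S g < ennreal e"
  shows "AE x in lebesgue_on S. norm (g x) \<le> e"
proof -
  have "AE x in lebesgue_on S. ennreal (norm (g x)) \<le> Linf_norm S g"
    unfolding Linf_norm_def by (rule esssup_AE)
  then show ?thesis
  proof eventually_elim
    case (elim x)
    then have "ennreal (norm (g x)) < ennreal e" using assms by (rule le_less_trans)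
    then show ?case by (simp add: ennreal_less_iff)
  qed
qed

lemma Linf_norm_bound_continuous:
  fixes g :: "'a::euclidean_space \<Rightarrow> 'b::real_normed_vector"
  assumes "Linf_norm S g < ennreal e" "open S" "continuous_on S g" "x \<in> S"
  shows "norm (g x) \<le> e"
proof -
  have "AE x in lebesgue_on S. norm (g x) \<in> {..e}" using Linf_norm_lessD[OF assms(1)] by simp
  then have "norm (g x) \<in> {..e}"
    by (rule AE_lebesgue_on_closed[OF assms(2) _ continuous_on_norm[OF assms(3)] _ assms(4)]) simp
  then show ?thesis by simp
qed

lemma W1inf_norm_lessD:
  assumes "W1inf_norm S f < ennreal e"
  shows "AE x in lebesgue_on S. norm (f x) \<le> e"
    and "\<exists>G. is_weak_gradient S f G \<and> (AE x in lebesgue_on S. norm (G x) \<le> e)"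
proof -
  have 1: "Linf_norm S f < ennreal e" and 2: "(INF G\<in>{G. is_weak_gradient S f G}. Linf_norm S G) < ennreal e"
    using assms unfolding W1inf_norm_def by (auto intro: le_less_trans[rotated])
  show "AE x in lebesgue_on S. norm (f x) \<le> e" by (rule Linf_norm_lessD[OF 1])
  obtain G where "is_weak_gradient S f G" "Linf_norm S G < ennreal e" using 2 by (auto simp: INF_less_iff)
  then show "\<exists>G. is_weak_gradient S f G \<and> (AE x in lebesgue_on S. norm (G x) \<le> e)"
    using Linf_norm_lessD by blast
qed

lemma locally_integrable_on_add:
  assumes "locally_integrable_on f S" "locally_integrable_on g S"
  shows "locally_integrable_on (\<lambda>x. f x + g x) S"
  using assms unfolding locally_integrable_on_def by (auto intro: set_integral_add(1))

text \<open>Closeness is assumed for f' - f; adding a gradient of f yields a bounded weak gradient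
  of f'.\<close>

lemma is_weak_gradient_add:
  assumes S: "open S" and f: "is_weak_gradient S f F" and g: "is_weak_gradient S g G"
  shows "is_weak_gradient S (\<lambda>x. f x + g x) (\<lambda>x. F x + G x)"
  unfolding is_weak_gradient_def
proof (intro conjI ballI)
  show "locally_integrable_on (\<lambda>x. f x + g x) S" "locally_integrable_on (\<lambda>x. F x + G x) S"
    using f g by (auto simp: is_weak_gradient_def intro: locally_integrable_on_add)
  fix \<phi> :: "'a \<Rightarrow> real" and b :: 'a assume \<phi>: "\<phi> \<in> test_functions S" and b: "b \<in> Basis"
  let ?C = "closure (support_on UNIV \<phi>)"
  have C: "compact ?C" "?C \<subseteq> S" using \<phi> by (auto simp: test_functions_def)
  have z: "y \<in> ?C" if "\<phi> y \<noteq> 0" for y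
    using that closure_subset[of "support_on UNIV \<phi>"] by (auto simp: support_on_def)
  have zd: "y \<in> ?C" if "frechet_derivative \<phi> (at y) b \<noteq> 0" for y
    using frechet_derivative_zero_outside_support[of \<phi> ?C y, OF z closed_closure] that by fastforce
  have 1: "integrable (lebesgue_on S) (\<lambda>x. h x * frechet_derivative \<phi> (at x) b)" if "locally_integrable_on h S" for h
    using integrable_locally_inner[OF S that C test_function_smooth(3)[OF \<phi>] zd] by simp
  have 2: "integrable (lebesgue_on S) (\<lambda>x. (H x \<bullet> b) * \<phi> x)" if "locally_integrable_on H S" for H
  proof -
    have "integrable (lebesgue_on S) (\<lambda>x. H x \<bullet> (\<phi> x *\<^sub>R b))"
    proof (rule integrable_locally_inner[OF S that C])
      show "continuous_on UNIV (\<lambda>x. \<phi> x *\<^sub>R b)" by (intro continuous_intros test_function_smooth[OF \<phi>])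
    qed (use z in auto)
    then show ?thesis by (simp add: mult.commute)
  qed
  show "(LINT x|lebesgue_on S. (f x + g x) * frechet_derivative \<phi> (at x) b) =
      - (LINT x|lebesgue_on S. ((F x + G x) \<bullet> b) * \<phi> x)"
    using f g \<phi> b by (simp add: is_weak_gradient_def distrib_right inner_add_left 1 2)
qed

lemma C1_closureD:
  assumes "u \<in> C1_closure S"
  obtains G where "continuous_on (closure S) u" "\<And>x. x \<in> S \<Longrightarrow> u differentiable (at x)"
    "continuous_on (closure S) G" "\<And>x. x \<in> S \<Longrightarrow> G x = jacobian u (at x)"
  using assms unfolding C1_closure_def by blast

lemma jacobian_unique:
  fixes u :: "real^'n \<Rightarrow> real^'m"
  assumes "(u has_derivative (\<lambda>h. A *v h)) (at x)"
  shows "jacobian u (at x) = A"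
  unfolding jacobian_def frechet_derivative_at[OF assms, symmetric] by (rule matrix_of_matrix_vector_mul)

lemma jacobian_diff:
  fixes u w :: "real^'n \<Rightarrow> real^'m"
  assumes "u differentiable (at x)" "w differentiable (at x)"
  shows "jacobian (\<lambda>x. u x - w x) (at x) = jacobian u (at x) - jacobian w (at x)"
proof (rule jacobian_unique)
  show "((\<lambda>x. u x - w x) has_derivative (\<lambda>h. (jacobian u (at x) - jacobian w (at x)) *v h)) (at x)"
    using has_derivative_diff[OF assms(1)[unfolded jacobian_works] assms(2)[unfolded jacobian_works]]
    by (simp add: matrix_vector_mult_diff_rdistrib)
qed

lemma gam_pos: "x \<in> Omega L \<Longrightarrow> 0 < gam x" "x \<in> Omega L \<Longrightarrow> gam x \<le> 1"
  by (auto simp: Omega_def gam_def abs_square_less_1)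

text \<open>Each of the three essential suprema is that of a function continuous in the open pipe,
  hence a bound at every point. The weighted one is what fixes the sign of the axial velocity next
  to the walls.\<close>

lemma E_norm_lessD:
  assumes "E_norm L (\<lambda>x. u x - w x) < ennreal e" and u: "u \<in> C1_closure (Omega L)" and w: "w \<in> C1_closure (Omega L)"
    and x: "x \<in> Omega L"
  shows "norm (u x - w x) \<le> e" "norm (jacobian u (at x) - jacobian w (at x)) \<le> e" "norm (u x - w x) \<le> e * gam x"
proof -
  let ?d = "\<lambda>x. u x - w x"
  obtain G where G: "continuous_on (closure (Omega L)) u" "\<And>x. x \<in> Omega L \<Longrightarrow> u differentiable (at x)"
    "continuous_on (closure (Omega L)) G" "\<And>x. x \<in> Omega L \<Longrightarrow> G x = jacobian u (at x)"
    using C1_closureD[OF u] by blast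
  obtain H where H: "continuous_on (closure (Omega L)) w" "\<And>x. x \<in> Omega L \<Longrightarrow> w differentiable (at x)"
    "continuous_on (closure (Omega L)) H" "\<And>x. x \<in> Omega L \<Longrightarrow> H x = jacobian w (at x)"
    using C1_closureD[OF w] by blast
  have j: "jacobian ?d (at x) = G x - H x" if "x \<in> Omega L" for x
    using jacobian_diff[OF G(2)[OF that] H(2)[OF that]] G(4)[OF that] H(4)[OF that] by simp
  have cd: "continuous_on (Omega L) ?d"
    by (intro continuous_on_diff continuous_on_subset[OF G(1) closure_subset] continuous_on_subset[OF H(1) closure_subset])
  have "continuous_on (Omega L) (\<lambda>x. G x - H x)"
    by (intro continuous_on_diff continuous_on_subset[OF G(3) closure_subset] continuous_on_subset[OF H(3) closure_subset])
  then have cj: "continuous_on (Omega L) (\<lambda>x. jacobian ?d (at x))"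
    by (rule continuous_on_eq) (use j in simp)
  have cg: "continuous_on (Omega L) (\<lambda>x. ?d x /\<^sub>R gam x)"
  proof (intro continuous_on_scaleR continuous_on_inverse cd ballI)
    show "continuous_on (Omega L) gam" unfolding gam_def[abs_def] by (intro continuous_intros)
    show "gam x \<noteq> 0" if "x \<in> Omega L" for x using gam_pos[OF that] by simp
  qed
  have n: "Linf_norm (Omega L) ?d < ennreal e" "Linf_norm (Omega L) (\<lambda>x. jacobian ?d (at x)) < ennreal e"
    "Linf_norm (Omega L) (\<lambda>x. ?d x /\<^sub>R gam x) < ennreal e"
    using assms(1) unfolding E_norm_def by (auto intro: le_less_trans[rotated] simp: add_increasing add_increasing2)
  show "norm (u x - w x) \<le> e" by (rule Linf_norm_bound_continuous[OF n(1) open_Omega cd x])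
  show "norm (jacobian u (at x) - jacobian w (at x)) \<le> e"
    using Linf_norm_bound_continuous[OF n(2) open_Omega cj x] j[OF x] G(4)[OF x] H(4)[OF x] by simp
  have g: "gam x > 0" by (rule gam_pos[OF x])
  have "norm (?d x /\<^sub>R gam x) \<le> e" by (rule Linf_norm_bound_continuous[OF n(3) open_Omega cg x])
  then have "gam x * norm (?d x /\<^sub>R gam x) \<le> gam x * e" using g by (intro mult_left_mono) auto
  moreover have "gam x * norm (?d x /\<^sub>R gam x) = norm (?d x)" unfolding norm_scaleR using g by simp
  ultimately show "norm (u x - w x) \<le> e * gam x" by (simp only: mult.commute)
qed

section \<open>The Poiseuille flow and its perturbations\<close>

definition poiseuille_gradient :: "real \<Rightarrow> vec2 \<Rightarrow> real^2^2" where
  "poiseuille_gradient umax x = (\<chi> i j. if i = 1 \<and> j = 2 then - 2 * x$2 * umax else 0)"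

lemma poiseuille_has_derivative:
  "(poiseuille umax has_derivative (\<lambda>h. poiseuille_gradient umax x *v h)) (at x)"
proof -
  have "(poiseuille umax has_derivative (\<lambda>h. (- 2 * x$2 * umax * h$2) *\<^sub>R axis 1 1)) (at x)"
    unfolding poiseuille_def[abs_def]
    by (auto intro!: derivative_eq_intros bounded_linear_imp_has_derivative[OF bounded_linear_vec_nth]
        simp: power2_eq_square algebra_simps)
  moreover have "(- 2 * x$2 * umax * h$2) *\<^sub>R axis 1 1 = poiseuille_gradient umax x *v h" for h
    by (simp add: vec_eq_iff forall_2 poiseuille_gradient_def matrix_vector_mult_def axis_def sum_2)
  ultimately show ?thesis by simp
qed

lemma norm_poiseuille_gradient: "norm (poiseuille_gradient umax x) = 2 * \<bar>x$2\<bar> * \<bar>umax\<bar>"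
  by (simp add: norm_vec_def L2_set_def UNIV_2 poiseuille_gradient_def abs_mult)

lemma continuous_poiseuille: "continuous_on A (poiseuille umax)" "continuous_on A (poiseuille_gradient umax)"
proof -
  show "continuous_on A (poiseuille umax)"
    using has_derivative_continuous[OF poiseuille_has_derivative] by (simp add: continuous_at_imp_continuous_on)
  show "continuous_on A (poiseuille_gradient umax)"
    unfolding poiseuille_gradient_def[abs_def]
  proof (intro continuous_on_vec_lambda)
    fix i j :: 2
    show "continuous_on A (\<lambda>x::vec2. if i = 1 \<and> j = 2 then - 2 * x$2 * umax else 0)"
      by (cases "i = 1 \<and> j = 2") (auto intro!: continuous_intros)
  qed
qed

lemma poiseuille_C1: "poiseuille umax \<in> C1_closure S"
  unfolding C1_closure_def
proof (intro CollectI conjI ballI exI[of _ "poiseuille_gradient umax"] continuous_poiseuille)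
  fix x
  show "poiseuille umax differentiable (at x)"
    by (rule differentiableI[OF poiseuille_has_derivative])
  show "poiseuille_gradient umax x = jacobian (poiseuille umax) (at x)"
    by (rule jacobian_unique[OF poiseuille_has_derivative, symmetric])
qed

lemma poiseuille_bounds:
  assumes "0 \<le> umax" "x \<in> Omega L"
  shows "norm (poiseuille umax x) \<le> umax" "poiseuille umax x $ 1 = umax * gam x"
proof -
  show "poiseuille umax x $ 1 = umax * gam x" by (simp add: poiseuille_def gam_def)
  have "norm (poiseuille umax x) = gam x * umax"
    using assms(1) gam_pos(1)[OF assms(2)] by (simp add: poiseuille_def gam_def abs_mult)
  also have "\<dots> \<le> 1 * umax" using gam_pos(2)[OF assms(2)] assms(1) by (intro mult_right_mono) auto
  finally show "norm (poiseuille umax x) \<le> umax" by simp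
qed

lemma C1_lipschitz:
  assumes "u \<in> C1_closure (Omega L)" "\<And>x. x \<in> Omega L \<Longrightarrow> norm (jacobian u (at x)) \<le> B" "0 \<le> B"
  shows "B-lipschitz_on (Omega L) u"
proof (rule lipschitz_onI[OF _ assms(3)])
  fix x y assume xy: "x \<in> Omega L" "y \<in> Omega L"
  have "norm (u x - u y) \<le> B * norm (x - y)"
  proof (rule differentiable_bound[OF convex_Omega _ _ xy])
    fix z assume z: "z \<in> Omega L"
    have "u differentiable (at z)" using assms(1) z by (simp add: C1_closure_def)
    then show "(u has_derivative (\<lambda>h. jacobian u (at z) *v h)) (at z within Omega L)"
      using jacobian_works has_derivative_at_withinI by blast
    show "onorm (\<lambda>h. jacobian u (at z) *v h) \<le> B"
      using norm_matrix_vector_le[of "jacobian u (at z)"] assms(2)[OF z]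
      by (intro onorm_le) (meson mult_right_mono norm_ge_zero order_trans)
  qed
  then show "dist (u x) (u y) \<le> B * dist x y" by (simp add: dist_norm)
qed

lemma poiseuille_Lip:
  assumes L: "0 < L"
  shows "poiseuille umax \<in> Linf (Omega L)" "poiseuille umax \<in> Lip (Omega L)"
proof -
  let ?u = "poiseuille umax"
  have m: "?u \<in> borel_measurable (lebesgue_on (Omega L))"
    by (rule continuous_on_closure_Omega_measurable[OF continuous_poiseuille(1)])
  obtain B where B: "B \<ge> 0" "\<And>x. x \<in> closure (Omega L) \<Longrightarrow> norm (?u x) \<le> B"
    using continuous_on_closure_Omega_bounded[OF L continuous_poiseuille(1)] by blast
  have "Linf_norm (Omega L) ?u \<le> ennreal B"
    unfolding Linf_norm_def
  proof (rule esssup_I)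
    show "(\<lambda>x. ennreal (norm (?u x))) \<in> borel_measurable (lebesgue_on (Omega L))" using m by simp
    show "AE x in lebesgue_on (Omega L). ennreal (norm (?u x)) \<le> ennreal B"
      by (rule AE_I2) (use B closure_subset[of "Omega L"] in \<open>auto simp: space_restrict_space intro!: ennreal_leI\<close>)
  qed
  then have 1: "Linf_norm (Omega L) ?u < top" by (simp add: le_less_trans)
  then show "?u \<in> Linf (Omega L)" using m by (simp add: Linf_def)
  have "(2 * \<bar>umax\<bar>)-lipschitz_on (Omega L) ?u"
  proof (rule C1_lipschitz[OF poiseuille_C1])
    fix x assume "x \<in> Omega L"
    then have "\<bar>x$2\<bar> \<le> 1" by (auto simp: Omega_def)
    then have "2 * \<bar>x$2\<bar> * \<bar>umax\<bar> \<le> 2 * 1 * \<bar>umax\<bar>" by (intro mult_right_mono mult_left_mono) auto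
    then show "norm (jacobian ?u (at x)) \<le> 2 * \<bar>umax\<bar>"
      by (simp add: jacobian_unique[OF poiseuille_has_derivative] norm_poiseuille_gradient)
  qed simp
  then have "(INF C\<in>{C. C-lipschitz_on (Omega L) ?u}. ennreal C) \<le> ennreal (2 * \<bar>umax\<bar>)"
    by (intro INF_lower) simp
  then have "(INF C\<in>{C. C-lipschitz_on (Omega L) ?u}. ennreal C) < top" by (rule le_less_trans) simp
  then show "?u \<in> Lip (Omega L)" using 1 by (simp add: Lip_def Lip_norm_def)
qed

text \<open>The gradient has norm 2 |x_2| u_max, whose supremum is approached only at the walls; it
  is evaluated at interior points (0, s) with s close to 1.\<close>

lemma poiseuille_umax_bound:
  assumes L: "0 < L" and umax: "0 < umax"
    and K: "Linf_norm (Omega L) (\<lambda>x. jacobian (poiseuille umax) (at x)) \<le> ennreal K"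
  shows "2 * umax \<le> K"
proof (rule field_le_epsilon)
  fix e :: real assume e: "e > 0"
  have j: "(\<lambda>x. jacobian (poiseuille umax) (at x)) = poiseuille_gradient umax"
    by (simp add: fun_eq_iff jacobian_unique[OF poiseuille_has_derivative])
  \<comment> \<open>\<open>ennreal\<close> sends a negative number to 0. The gradient would then
    vanish, which (0, 1/2) refutes: there its norm is u_max.\<close>
  have K0: "0 \<le> K"
  proof (rule ccontr)
    assume "\<not> 0 \<le> K"
    then have "Linf_norm (Omega L) (poiseuille_gradient umax) < ennreal (umax / 2)"
      using K umax by (auto simp: j ennreal_neg)
    from Linf_norm_bound_continuous[OF this open_Omega continuous_poiseuille(2), of "vector [0, 1/2]"]
    show False using L umax by (simp add: Omega_def norm_poiseuille_gradient)
  qed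
  \<comment> \<open>Chosen so that 2 s u_max is at least 2 u_max - e / 2.\<close>
  define s where "s = max 0 (1 - e / (4 * umax))"
  have s: "0 \<le> s" "s < 1" "1 - e / (4 * umax) \<le> s" using e umax by (auto simp: s_def)
  have "ennreal K < ennreal (K + e / 2)" using K0 e by (simp add: ennreal_less_iff)
  then have "Linf_norm (Omega L) (poiseuille_gradient umax) < ennreal (K + e / 2)"
    using K unfolding j by (rule le_less_trans[rotated])
  from Linf_norm_bound_continuous[OF this open_Omega continuous_poiseuille(2), of "vector [0, s]"]
  have "2 * s * umax \<le> K + e / 2"
    using L umax s by (simp add: Omega_def norm_poiseuille_gradient)
  moreover have "2 * (1 - e / (4 * umax)) * umax \<le> 2 * s * umax" using s umax by (intro mult_right_mono mult_left_mono) auto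
  moreover have "2 * (1 - e / (4 * umax)) * umax = 2 * umax - e / 2" using umax by (simp add: field_simps)
  ultimately show "2 * umax \<le> K + e" by linarith
qed

text \<open>The sign of the axial component: |y - u_p| <= e gamma <= u_max gamma, which is the axial
  component of u_p, up to the walls where it vanishes. The numbers: 1/40 + 1/50 <= 1/20 for the
  velocity and 1/20 + 1/50 <= 1/10 <= 1/8 for the gradient.\<close>

lemma near_poiseuille:
  assumes L: "0 < L" and umax: "0 < umax" "2 * umax \<le> 1/20" and e: "0 \<le> e" "e \<le> 1/50" "e \<le> umax" "e \<le> \<delta>"
    and y: "y \<in> C1_closure (Omega L)"
    and near: "\<forall>x\<in>Omega L. norm (y x - poiseuille umax x) \<le> e \<and>
      norm (jacobian y (at x) - jacobian (poiseuille umax) (at x)) \<le> e \<and>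
      norm (y x - poiseuille umax x) \<le> e * gam x"
  shows "x \<in> closure (Omega L) \<Longrightarrow> norm (y x - poiseuille umax x) \<le> \<delta>"
    "x \<in> closure (Omega L) \<Longrightarrow> 0 \<le> y x $ 1" "x \<in> closure (Omega L) \<Longrightarrow> norm (y x) \<le> 1/20"
    "x \<in> Omega L \<Longrightarrow> norm (jacobian y (at x)) \<le> 1/10" "(1/8)-lipschitz_on (Omega L) y"
proof -
  have b: "norm (y x - poiseuille umax x) \<le> e"
      "norm (jacobian y (at x) - jacobian (poiseuille umax) (at x)) \<le> e"
      "norm (y x - poiseuille umax x) \<le> e * gam x" if "x \<in> Omega L" for x
    using near that by blast+
  have cy: "continuous_on (closure (Omega L)) y" using y by (simp add: C1_closure_def)
  have ext: "g x \<in> C" if "continuous_on (closure (Omega L)) g" "closed C" "\<And>x. x \<in> Omega L \<Longrightarrow> g x \<in> C" "x \<in> closure (Omega L)"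
    for g :: "vec2 \<Rightarrow> real" and C x
    using image_closure_subset[OF that(1,2)] that(3,4) by blast
  show "norm (y x - poiseuille umax x) \<le> \<delta>" if "x \<in> closure (Omega L)" for x
  proof -
    have "norm (y x - poiseuille umax x) \<in> {..\<delta>}"
      by (rule ext[OF _ _ _ that]) (use b(1) e in \<open>force intro!: continuous_on_norm continuous_on_diff cy continuous_poiseuille\<close>)+
    then show ?thesis by simp
  qed
  show "0 \<le> y x $ 1" if "x \<in> closure (Omega L)" for x
  proof -
    have "y x $ 1 \<in> {0..}"
    proof (rule ext[OF _ _ _ that])
      show "continuous_on (closure (Omega L)) (\<lambda>x. y x $ 1)" by (intro continuous_intros cy)
      fix x assume x: "x \<in> Omega L"
      have "\<bar>(y x - poiseuille umax x) $ 1\<bar> \<le> e * gam x" using b(3)[OF x] component_le_norm_cart order_trans by blast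
      moreover have "e * gam x \<le> umax * gam x" using e gam_pos[OF x] by (intro mult_right_mono) auto
      ultimately show "y x $ 1 \<in> {0..}" using poiseuille_bounds(2)[OF _ x, of umax] umax by simp
    qed simp
    then show ?thesis by simp
  qed
  show "norm (y x) \<le> 1/20" if "x \<in> closure (Omega L)" for x
  proof -
    have "norm (y x) \<in> {..1/20}"
    proof (rule ext[OF _ _ _ that])
      show "continuous_on (closure (Omega L)) (\<lambda>x. norm (y x))" by (intro continuous_intros cy)
      fix x assume x: "x \<in> Omega L"
      have "norm (y x) \<le> norm (poiseuille umax x) + norm (y x - poiseuille umax x)"
        using norm_triangle_ineq[of "poiseuille umax x" "y x - poiseuille umax x"] by simp
      then show "norm (y x) \<in> {..1/20}" using poiseuille_bounds(1)[OF _ x, of umax] b(1)[OF x] umax e by simp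
    qed simp
    then show ?thesis by simp
  qed
  have j: "norm (jacobian y (at x)) \<le> 1/10" if x: "x \<in> Omega L" for x
  proof -
    have "\<bar>x$2\<bar> \<le> 1" using x by (auto simp: Omega_def)
    then have "2 * \<bar>x$2\<bar> * \<bar>umax\<bar> \<le> 2 * 1 * \<bar>umax\<bar>" by (intro mult_right_mono mult_left_mono) auto
    then have "norm (jacobian (poiseuille umax) (at x)) \<le> 1/20"
      unfolding jacobian_unique[OF poiseuille_has_derivative] norm_poiseuille_gradient using umax by linarith
    moreover have "norm (jacobian y (at x)) \<le> norm (jacobian (poiseuille umax) (at x)) + norm (jacobian y (at x) - jacobian (poiseuille umax) (at x))"
      using norm_triangle_ineq[of "jacobian (poiseuille umax) (at x)" "jacobian y (at x) - jacobian (poiseuille umax) (at x)"] by simp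
    ultimately show ?thesis using b(2)[OF x] e by linarith
  qed
  then show "x \<in> Omega L \<Longrightarrow> norm (jacobian y (at x)) \<le> 1/10" .
  show "(1/8)-lipschitz_on (Omega L) y"
    by (rule C1_lipschitz[OF y order_trans[OF j]]) auto
qed

text \<open>The support is a compact subset of \<open>Gamma_l\<close>, where v_1 is positive, so v_1
  has a positive minimum on it: mass never enters at grazing velocity.\<close>

lemma inflow_support:
  assumes "inflow_data L \<psi>"
  obtains c0 R0 where "0 < c0" "0 \<le> R0" "\<And>x v. (x, v) \<in> Supp L \<psi> \<Longrightarrow> c0 \<le> v$1 \<and> norm v \<le> R0"
proof -
  let ?K = "Supp L \<psi>"
  have K: "compact ?K" "?K \<subseteq> Gamma_l L" using assms by (auto simp: inflow_data_def)
  obtain R where R: "\<And>z. z \<in> ?K \<Longrightarrow> norm z \<le> R"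
    using compact_imp_bounded[OF K(1)] by (auto simp: bounded_iff)
  have "norm v \<le> max R 0" if "(x, v) \<in> ?K" for x v
    using norm_fst_snd_le(2)[of "(x, v)"] R[OF that] by simp
  moreover have "\<exists>c0>0. \<forall>(x, v)\<in>?K. c0 \<le> v$1"
  proof (cases "?K = {}")
    case True then show ?thesis by (intro exI[of _ 1]) auto
  next
    case False
    have "continuous_on ?K (\<lambda>z. snd z $ 1)" by (intro continuous_intros)
    from continuous_attains_inf[OF K(1) False this]
    obtain z where z: "z \<in> ?K" "\<And>y. y \<in> ?K \<Longrightarrow> snd z $ 1 \<le> snd y $ 1" by blast
    then show ?thesis using K(2) by (intro exI[of _ "snd z $ 1"]) (force simp: Gamma_l_def)
  qed
  ultimately show ?thesis using that[of _ "max R 0"] by fastforce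
qed


section \<open>Local uniqueness\<close>

text \<open>With H = grad(u' - u) and G = grad u, the difference of the convective terms is H u' + G
  w. The cross term uses |H| |w| <= |H|^2 + |w|^2 / 4, which gives 1/20 for |H|^2 and 1/80 + 1/10 =
  9/80 for |w|^2.\<close>

lemma nonlinear_term_lower_bound:
  fixes H G :: "real^'n^'n" and u' w :: "real^'n"
  assumes "norm u' \<le> 1/20" "norm G \<le> 1/10"
  shows "19/20 * (norm H)\<^sup>2 - 9/80 * (norm w)\<^sup>2 \<le> (H *v u' + G *v w) \<bullet> w + (norm H)\<^sup>2"
proof -
  have "\<bar>(H *v u') \<bullet> w\<bar> \<le> norm (H *v u') * norm w" by (rule Cauchy_Schwarz_ineq2)
  also have "\<dots> \<le> (norm H * (1/20)) * norm w"
    by (intro mult_right_mono order_trans[OF norm_matrix_vector_le] mult_left_mono assms) auto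
  finally have 1: "\<bar>(H *v u') \<bullet> w\<bar> \<le> 1/20 * (norm H * norm w)" by simp
  have "\<bar>(G *v w) \<bullet> w\<bar> \<le> norm (G *v w) * norm w" by (rule Cauchy_Schwarz_ineq2)
  also have "\<dots> \<le> (1/10 * norm w) * norm w"
    by (intro mult_right_mono order_trans[OF norm_matrix_vector_le] assms) auto
  finally have 2: "\<bar>(G *v w) \<bullet> w\<bar> \<le> 1/10 * (norm w)\<^sup>2" by (simp add: power2_eq_square)
  have "norm H * norm w \<le> (norm H)\<^sup>2 + (norm w)\<^sup>2 / 4"
    using zero_le_power2[of "norm H - norm w / 2"] by (simp add: power2_eq_square algebra_simps)
  then show ?thesis using 1 2 unfolding inner_add_left by linarith
qed

text \<open>The energy inequality leaves half of \<open>A\<close> on the left after convection and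
  Poincare, while the drag contributes at most \<epsilon> C A <= A / 4. Hence A = 0, then I = 0, and
  both the velocities and the densities agree.\<close>

lemma small_solutions_unique:
  assumes L: "0 < L" and P: "extension_operator (Omega L) P"
    and umax: "0 < umax" "2 * umax \<le> 1/20" and T1: "0 < T1"
    and \<psi>: "inflow_data L \<psi>" and egc: "lateral_EGC L P (poiseuille umax) T1 (Supp L \<psi>)"
  obtains \<epsilon> where "0 < \<epsilon>"
    "\<And>u f u' f'. stationary_solution L (poiseuille umax) \<psi> u f \<Longrightarrow>
       stationary_solution L (poiseuille umax) \<psi> u' f' \<Longrightarrow>
       E_norm L (\<lambda>x. u x - poiseuille umax x) < ennreal \<epsilon> \<Longrightarrow> W1inf_norm (Omega L \<times> UNIV) f < ennreal \<epsilon> \<Longrightarrow>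
       E_norm L (\<lambda>x. u' x - u x) < ennreal \<epsilon> \<Longrightarrow> W1inf_norm (Omega L \<times> UNIV) (\<lambda>z. f' z - f z) < ennreal \<epsilon> \<Longrightarrow>
       (\<forall>x\<in>closure (Omega L). u' x = u x) \<and> (AE z in lebesgue_on (Omega L \<times> UNIV). f' z = f z)"
proof -
  let ?up = "poiseuille umax" and ?K = "Supp L \<psi>" and ?S = "Omega L \<times> (UNIV::vec2 set)"
  let ?M = "lebesgue_on (Omega L)"
  have K: "compact ?K" "?K \<subseteq> Gamma_l L" "closed ?K" using \<psi> by (auto simp: inflow_data_def compact_imp_closed)
  have K\<psi>: "\<psi> z = 0" if "z \<in> Gamma_l L" "z \<notin> ?K" for z
    using that closure_subset[of "support_on (Gamma_l L) \<psi>"] by (auto simp: Supp_def support_on_def)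
  obtain c0 R0 where c0: "0 < c0" and R0: "0 \<le> R0" and K0: "\<And>x v. (x, v) \<in> ?K \<Longrightarrow> c0 \<le> v$1 \<and> norm v \<le> R0"
    using inflow_support[OF \<psi>] by blast
  obtain \<delta> where \<delta>: "\<delta> > 0" and exits: "exits_within L ?up ?K T1 \<delta>"
    using egc_exit[OF L P poiseuille_Lip[OF L] continuous_poiseuille(1) egc K(1) T1] by blast
  define V where "V = measure lborel (cball (0::vec2) (R0 + 1))"
  have V: "V \<ge> 0" by (simp add: V_def)
  define Q where "Q = V * (R0 + 2) * exp (3 * T1) / c0"
  have Q: "Q \<ge> 0" using V R0 c0 by (simp add: Q_def)
  \<comment> \<open>From the final count: 4 Q \<epsilon> I^2 with I^2 <= 4 L A gives 16 L Q, and the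
    part of the drag proportional to |w| gives 4 V through Poincare.\<close>
  define C where "C = 16 * L * Q + 4 * V"
  have C: "C \<ge> 0" using L Q V by (simp add: C_def)
  \<comment> \<open>As u' is close to u and u to u_p, the velocity u' is only within 2 \<epsilon> of
    u_p; the first three bounds are halved for this reason. The last one makes \<epsilon> C at most
    1/4.\<close>
  define \<epsilon> where "\<epsilon> = min (min (1/100) (umax / 2)) (min (\<delta> / 2) (1 / (4 * (C + 1))))"
  have "\<epsilon> \<le> 1/100" "\<epsilon> \<le> umax / 2" "\<epsilon> \<le> \<delta> / 2"
    unfolding \<epsilon>_def by linarith+
  moreover have "\<epsilon> > 0" using umax \<delta> C by (simp add: \<epsilon>_def)
  ultimately have \<epsilon>: "\<epsilon> > 0" "2 * \<epsilon> \<le> 1/50" "2 * \<epsilon> \<le> umax" "2 * \<epsilon> \<le> \<delta>" by auto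
  have \<epsilon>C: "\<epsilon> * C \<le> 1/4"
  proof -
    have "\<epsilon> * (C + 1) \<le> 1 / (4 * (C + 1)) * (C + 1)"
      using C by (intro mult_right_mono) (auto simp: \<epsilon>_def)
    also have "\<dots> = 1/4" using C by simp
    finally show ?thesis using \<epsilon>(1) by (simp add: distrib_left)
  qed
  show ?thesis
  proof (rule that[OF \<epsilon>(1)])
    fix u f u' f'
    assume sol: "stationary_solution L ?up \<psi> u f" and sol': "stationary_solution L ?up \<psi> u' f'"
      and un: "E_norm L (\<lambda>x. u x - ?up x) < ennreal \<epsilon>" and fn: "W1inf_norm ?S f < ennreal \<epsilon>"
      and un': "E_norm L (\<lambda>x. u' x - u x) < ennreal \<epsilon>" and fn': "W1inf_norm ?S (\<lambda>z. f' z - f z) < ennreal \<epsilon>"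
    have C1: "u \<in> C1_closure (Omega L)" "u' \<in> C1_closure (Omega L)"
      using sol sol' by (auto simp: stationary_solution_def E_space_def)
    have fm: "f \<in> borel_measurable (lebesgue_on ?S)" "f' \<in> borel_measurable (lebesgue_on ?S)"
      using sol sol' by (auto simp: stationary_solution_def W1inf_def)
    have vl: "vlasov L u f" "vlasov L u' f'" and ns: "navier_stokes L u f" "navier_stokes L u' f'"
      using sol sol' by (auto simp: stationary_solution_def)
    have bd: "\<And>x. x \<in> frontier (Omega L) \<Longrightarrow> u' x = u x"
      using sol sol' by (auto simp: stationary_solution_def)
    obtain F where F: "continuous_on (closure (Omega L) \<times> UNIV) F" "AE z in lebesgue_on ?S. f z = F z"
      "\<And>z. z \<in> Gamma_l L \<Longrightarrow> F z = \<psi> z" "\<And>z. z \<in> Gamma_r L \<union> Gamma_u L \<union> Gamma_d L \<Longrightarrow> F z = 0"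
      using sol unfolding stationary_solution_def kinetic_boundary_def by blast
    obtain F' where F': "continuous_on (closure (Omega L) \<times> UNIV) F'" "AE z in lebesgue_on ?S. f' z = F' z"
      "\<And>z. z \<in> Gamma_l L \<Longrightarrow> F' z = \<psi> z" "\<And>z. z \<in> Gamma_r L \<union> Gamma_u L \<union> Gamma_d L \<Longrightarrow> F' z = 0"
      using sol' unfolding stationary_solution_def kinetic_boundary_def by blast
    obtain G where G: "continuous_on (closure (Omega L)) u" "\<And>x. x \<in> Omega L \<Longrightarrow> u differentiable (at x)"
      "continuous_on (closure (Omega L)) G" "\<And>x. x \<in> Omega L \<Longrightarrow> G x = jacobian u (at x)"
      using C1_closureD[OF C1(1)] by blast
    obtain G' where G': "continuous_on (closure (Omega L)) u'" "\<And>x. x \<in> Omega L \<Longrightarrow> u' differentiable (at x)"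
      "continuous_on (closure (Omega L)) G'" "\<And>x. x \<in> Omega L \<Longrightarrow> G' x = jacobian u' (at x)"
      using C1_closureD[OF C1(2)] by blast
    note e1 = E_norm_lessD[OF un C1(1) poiseuille_C1] and e2 = E_norm_lessD[OF un' C1(2,1)]
    have near: "\<forall>x\<in>Omega L. norm (u x - ?up x) \<le> \<epsilon> \<and> norm (jacobian u (at x) - jacobian ?up (at x)) \<le> \<epsilon> \<and>
        norm (u x - ?up x) \<le> \<epsilon> * gam x"
      using e1 by blast
    have "0 \<le> \<epsilon>" "\<epsilon> \<le> 1/50" "\<epsilon> \<le> umax" "\<epsilon> \<le> \<delta>" using \<epsilon> by auto
    note nu = near_poiseuille[OF L umax this C1(1) near]
    have e3: "norm (u' x - ?up x) \<le> 2 * \<epsilon>" "norm (jacobian u' (at x) - jacobian ?up (at x)) \<le> 2 * \<epsilon>"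
        "norm (u' x - ?up x) \<le> 2 * \<epsilon> * gam x" if x: "x \<in> Omega L" for x
    proof -
      have t: "norm (a - c) \<le> norm (a - b) + norm (b - c)" for a b c :: "'z::real_normed_vector"
        using dist_triangle[of a c b] by (simp add: dist_norm)
      show "norm (u' x - ?up x) \<le> 2 * \<epsilon>"
        using t[of "u' x" "?up x" "u x"] e1(1)[OF x] e2(1)[OF x] by simp
      show "norm (jacobian u' (at x) - jacobian ?up (at x)) \<le> 2 * \<epsilon>"
        using norm_triangle_ineq[of "jacobian u' (at x) - jacobian u (at x)" "jacobian u (at x) - jacobian ?up (at x)"]
          e1(2)[OF x] e2(2)[OF x] by simp
      show "norm (u' x - ?up x) \<le> 2 * \<epsilon> * gam x"
        using t[of "u' x" "?up x" "u x"] e1(3)[OF x] e2(3)[OF x] by simp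
    qed
    then have near': "\<forall>x\<in>Omega L. norm (u' x - ?up x) \<le> 2 * \<epsilon> \<and>
        norm (jacobian u' (at x) - jacobian ?up (at x)) \<le> 2 * \<epsilon> \<and> norm (u' x - ?up x) \<le> 2 * \<epsilon> * gam x"
      by blast
    have "0 \<le> 2 * \<epsilon>" using \<epsilon> by auto
    note nu' = near_poiseuille[OF L umax this \<epsilon>(2-4) C1(2) near']
    have sk: "small_kinetic_solution L (2 * \<epsilon>) u f F"
    proof -
      obtain D where "is_weak_gradient ?S f D" "AE z in lebesgue_on ?S. norm (D z) \<le> \<epsilon>"
        using W1inf_norm_lessD(2)[OF fn] by blast
      moreover from this(2) have "AE z in lebesgue_on ?S. norm (D z) \<le> 2 * \<epsilon>"
        by eventually_elim (use \<epsilon>(1) in simp)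
      ultimately show ?thesis unfolding small_kinetic_solution_def using fm(1) F(1,2) G(1) nu(5) vl(1) by blast
    qed
    have sk': "small_kinetic_solution L (2 * \<epsilon>) u' f' F'"
    proof -
      obtain D where D: "is_weak_gradient ?S f D" "AE z in lebesgue_on ?S. norm (D z) \<le> \<epsilon>"
        using W1inf_norm_lessD(2)[OF fn] by blast
      obtain D' where D': "is_weak_gradient ?S (\<lambda>z. f' z - f z) D'" "AE z in lebesgue_on ?S. norm (D' z) \<le> \<epsilon>"
        using W1inf_norm_lessD(2)[OF fn'] by blast
      have "is_weak_gradient ?S f' (\<lambda>z. D' z + D z)"
        using is_weak_gradient_add[OF open_Omega_UNIV D'(1) D(1)] by simp
      moreover have "AE z in lebesgue_on ?S. norm (D' z + D z) \<le> 2 * \<epsilon>"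
        using D(2) D'(2)
      proof eventually_elim
        case (elim z) then show ?case using norm_triangle_ineq[of "D' z" "D z"] by simp
      qed
      ultimately show ?thesis unfolding small_kinetic_solution_def using fm(2) F'(1,2) G'(1) nu'(5) vl(2) by blast
    qed
    define w where "w x = u' x - u x" for x
    define H where "H x = G' x - G x" for x
    define m where "m = wall_bound H"
    define I where "I = integral {- L..L} m"
    define A where "A = (LINT x|?M. (norm (H x))\<^sup>2)"
    have cH: "continuous_on (closure (Omega L)) H" and cw: "continuous_on (closure (Omega L)) w"
      unfolding H_def[abs_def] w_def[abs_def] by (intro continuous_on_diff G G')+
    have w0: "\<And>x. x \<in> frontier (Omega L) \<Longrightarrow> w x = 0" using bd by (simp add: w_def)
    have dw: "(w has_derivative (\<lambda>h. H x *v h)) (at x)" if x: "x \<in> Omega L" for x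
    proof -
      have "(u' has_derivative (\<lambda>h. G' x *v h)) (at x)" "(u has_derivative (\<lambda>h. G x *v h)) (at x)"
        using G(2)[OF x] G'(2)[OF x] jacobian_works[of u "at x"] jacobian_works[of u' "at x"] G(4)[OF x] G'(4)[OF x] by auto
      from has_derivative_diff[OF this] show ?thesis
        by (simp add: matrix_vector_mult_diff_rdistrib w_def[abs_def] H_def)
    qed
    note wb = wall_bound[OF L cH, folded m_def]
    have wm: "norm (w x) \<le> m (x$1)" if "x \<in> Omega L" for x
      using norm_le_wall_bound[OF L cH cw w0 dw that] by (simp add: m_def)
    have I0: "0 \<le> I" unfolding I_def
      by (intro Henstock_Kurzweil_Integration.integral_nonneg integrable_continuous_real wb) auto
    have IA: "I\<^sup>2 \<le> 4 * L * A" using wall_bound_integral[OF L cH] by (simp add: I_def A_def m_def)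
    have pw: "(LINT x|?M. (norm (w x))\<^sup>2) \<le> 4 * A" "(LINT x|?M. norm (w x)) \<le> 2 * I"
      using poincare_Omega[OF L cH cw w0 dw] by (simp_all add: A_def I_def m_def)
    \<comment> \<open>The bound on |F - F'| is linear in \<open>I\<close>; multiplied by the
      integral of |w|, at most 2 I, it is quadratic, as the energy estimate requires.\<close>
    define E where "E = exp (3 * T1) * (2 * \<epsilon>) / c0 * I"
    have E0: "0 \<le> E" using I0 c0 \<epsilon>(1) by (simp add: E_def)
    have l0: "0 \<le> 2 * \<epsilon>" using \<epsilon> by simp
    have one: "1/20 \<le> (1::real)" by simp
    have core1: "norm v \<le> R0 + 1 \<and> \<bar>F (x, v) - F' (x, v)\<bar> \<le> E" if "x \<in> Omega L" "F (x, v) \<noteq> 0" for x v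
      unfolding E_def I_def
    proof (rule density_difference_bound[where ?F'=F', OF L l0 T1 c0 sk sk' K(3,2) K\<psi> K0 F(3) F'(3) F(4) exits nu(1,2) order_trans[OF nu(3) one] wb(1,2) _ that])
      show "\<And>x. x \<in> Omega L \<Longrightarrow> norm (u x - u' x) \<le> m (x $ 1)" using wm by (simp add: w_def norm_minus_commute)
    qed
    \<comment> \<open>Where only \<open>F'\<close> carries mass, the characteristics of u' have to
      be followed instead, so the roles are exchanged.\<close>
    have core2: "norm v \<le> R0 + 1 \<and> \<bar>F' (x, v) - F (x, v)\<bar> \<le> E" if "x \<in> Omega L" "F' (x, v) \<noteq> 0" for x v
      unfolding E_def I_def
    proof (rule density_difference_bound[where ?F'=F, OF L l0 T1 c0 sk' sk K(3,2) K\<psi> K0 F'(3) F(3) F'(4) exits nu'(1,2) order_trans[OF nu'(3) one] wb(1,2) _ that])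
      show "\<And>x. x \<in> Omega L \<Longrightarrow> norm (u' x - u x) \<le> m (x $ 1)" using wm by (simp add: w_def)
    qed
    have supp: "norm v \<le> R0 + 1 \<and> \<bar>F (x, v) - F' (x, v)\<bar> \<le> E" if "x \<in> Omega L" "F (x, v) \<noteq> 0 \<or> F' (x, v) \<noteq> 0" for x v
      using core1[OF that(1)] core2[OF that(1)] that(2) by (auto simp: abs_minus_commute)
    have Fe: "\<bar>F (x, v)\<bar> \<le> \<epsilon>" if x: "x \<in> Omega L" for x v
    proof -
      have ae: "AE z in lebesgue_on ?S. F z \<in> {- \<epsilon>..\<epsilon>}"
        using W1inf_norm_lessD(1)[OF fn] F(2) by eventually_elim auto
      have c: "continuous_on ?S F"
        by (rule continuous_on_subset[OF F(1)]) (use closure_subset[of "Omega L"] in auto)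
      have "F (x, v) \<in> {- \<epsilon>..\<epsilon>}"
        by (rule AE_lebesgue_on_closed[OF open_Omega_UNIV ae c closed_atLeastAtMost]) (use x in simp)
      then show ?thesis by auto
    qed
    define Dg where "Dg x = V * (E * (R0 + 2) + \<epsilon> * norm (w x))" for x
    have cDg: "continuous_on (closure (Omega L)) Dg"
      unfolding Dg_def[abs_def] by (intro continuous_intros cw)
    have "AE x in ?M. norm (drag u' f' x - drag u f x) \<le> V * (E * (R0 + 1 + 1) + \<epsilon> * norm (u' x - u x))"
      unfolding V_def
    proof (rule drag_difference[OF L F(1,2) F'(1,2) ns _ E0 _ supp Fe])
      show "norm (u' x) \<le> 1" if "x \<in> Omega L" for x
        using nu'(3)[of x] that closure_subset[of "Omega L"] by force
    qed (use R0 \<epsilon> in auto)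
    then have Dg: "AE x in ?M. norm (drag u' f' x - drag u f x) \<le> Dg x"
      by (simp add: Dg_def w_def add.assoc)
    note intgr = continuous_on_closure_Omega_integrable[OF L]
    have iw: "integrable ?M (\<lambda>x. norm (w x))" "integrable ?M (\<lambda>x. (norm (w x))\<^sup>2)" "integrable ?M (\<lambda>x. (norm (H x))\<^sup>2)"
      by (intro intgr continuous_intros cw cH)+
    have en: "(LINT x|?M. (G' x *v u' x - G x *v u x) \<bullet> w x + (norm (H x))\<^sup>2) \<le> (LINT x|?M. Dg x * norm (w x))"
      unfolding w_def H_def
      by (rule navier_stokes_energy[OF L G(3,4) G'(3,4) G(1,2) G'(1,2) bd ns cDg Dg])
    have "(LINT x|?M. 19/20 * (norm (H x))\<^sup>2 - 9/80 * (norm (w x))\<^sup>2) \<le>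
       (LINT x|?M. (G' x *v u' x - G x *v u x) \<bullet> w x + (norm (H x))\<^sup>2)"
    proof (rule integral_mono)
      show "integrable ?M (\<lambda>x. 19/20 * (norm (H x))\<^sup>2 - 9/80 * (norm (w x))\<^sup>2)"
        using iw by (intro Bochner_Integration.integrable_diff integrable_mult_right) auto
      show "integrable ?M (\<lambda>x. (G' x *v u' x - G x *v u x) \<bullet> w x + (norm (H x))\<^sup>2)"
        by (intro intgr continuous_on_add continuous_on_inner continuous_on_diff continuous_on_matrix_vector_mult
            continuous_on_power continuous_on_norm G G' cw cH)
      fix x assume "x \<in> space ?M"
      then have x: "x \<in> Omega L" "x \<in> closure (Omega L)"
        using closure_subset[of "Omega L"] by (auto simp: space_restrict_space)
      have "G' x *v u' x - G x *v u x = H x *v u' x + G x *v w x"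
        by (simp add: H_def w_def matrix_vector_mult_diff_rdistrib matrix_vector_mult_diff_distrib)
      then show "19/20 * (norm (H x))\<^sup>2 - 9/80 * (norm (w x))\<^sup>2 \<le> (G' x *v u' x - G x *v u x) \<bullet> w x + (norm (H x))\<^sup>2"
        using nonlinear_term_lower_bound[OF nu'(3)[OF x(2)], of "G x" "H x" "w x"] nu(4)[OF x(1)] G(4)[OF x(1)] by simp
    qed
    moreover have "(LINT x|?M. 19/20 * (norm (H x))\<^sup>2 - 9/80 * (norm (w x))\<^sup>2) = 19/20 * A - 9/80 * (LINT x|?M. (norm (w x))\<^sup>2)"
      using iw by (simp add: A_def)
    moreover have "(LINT x|?M. Dg x * norm (w x)) \<le> 1/4 * A"
    proof -
      have "(LINT x|?M. Dg x * norm (w x)) = (LINT x|?M. V * (E * (R0 + 2)) * norm (w x) + V * \<epsilon> * (norm (w x))\<^sup>2)"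
        by (simp add: Dg_def power2_eq_square algebra_simps)
      also have "\<dots> = V * (E * (R0 + 2)) * (LINT x|?M. norm (w x)) + V * \<epsilon> * (LINT x|?M. (norm (w x))\<^sup>2)"
        using iw by simp
      also have "\<dots> \<le> V * (E * (R0 + 2)) * (2 * I) + V * \<epsilon> * (4 * A)"
        using V E0 R0 \<epsilon>(1) by (intro add_mono mult_left_mono pw) auto
      also have "\<dots> = 4 * Q * \<epsilon> * I\<^sup>2 + 4 * V * \<epsilon> * A"
        by (simp add: E_def Q_def power2_eq_square)
      also have "\<dots> \<le> 4 * Q * \<epsilon> * (4 * L * A) + 4 * V * \<epsilon> * A"
        using Q \<epsilon>(1) IA by (intro add_right_mono mult_left_mono) auto
      also have "\<dots> = \<epsilon> * C * A" by (simp add: C_def algebra_simps)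
      also have "\<dots> \<le> 1/4 * A" using \<epsilon>C by (intro mult_right_mono) (auto simp: A_def)
      finally show ?thesis .
    qed
    \<comment> \<open>On the left 19/20 - 4 * 9/80 = 1/2, on the right 1/4.\<close>
    ultimately have "A \<le> 0" using en pw(1) by linarith
    then have "I\<^sup>2 \<le> 0" using IA L by (smt (verit) mult_nonneg_nonpos)
    then have I: "I = 0" by simp
    \<comment> \<open>A continuous nonnegative function with zero integral vanishes identically, and
      it dominates |w| on each cross-section.\<close>
    have m0: "m y = 0" if "y \<in> {- L..L}" for y
    proof (rule has_integral_0_cbox_imp_0[of "- L" L m])
      show "(m has_integral 0) (cbox (- L) L)"
        using integrable_integral[OF integrable_continuous_real[OF wb(1)]] I by (simp add: I_def)
    qed (use wb that L in auto)
    have "w x = 0" if "x \<in> closure (Omega L)" for x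
    proof (cases "x \<in> Omega L")
      case True
      then have "x$1 \<in> {- L..L}" by (auto simp: Omega_def)
      then show ?thesis using wm[OF True] m0 by simp
    next
      case False
      then have "x \<in> frontier (Omega L)" using that by (simp add: frontier_def interior_open[OF open_Omega])
      then show ?thesis by (rule w0)
    qed
    moreover have "AE z in lebesgue_on ?S. f' z = f z"
    proof -
      have "E = 0" using I by (simp add: E_def)
      then have eq: "F (x, v) = F' (x, v)" if "x \<in> Omega L" for x v
        using supp[OF that, of v] by (cases "F (x, v) = 0 \<and> F' (x, v) = 0") auto
      have "AE z in lebesgue_on ?S. z \<in> ?S" by (rule AE_I2) (simp add: space_restrict_space)
      then show ?thesis using F(2) F'(2)
      proof eventually_elim
        case (elim z) then show ?case using eq[of "fst z" "snd z"] by (auto simp: mem_Times_iff)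
      qed
    qed
    ultimately show "(\<forall>x\<in>closure (Omega L). u' x = u x) \<and> (AE z in lebesgue_on ?S. f' z = f z)"
      by (simp add: w_def)
  qed
qed

theorem corollary5p3:
  fixes L :: real and P :: "(real^2 \<Rightarrow> real^2) \<Rightarrow> (real^2 \<Rightarrow> real^2)"
  assumes "0 < L" and "extension_operator (Omega L) P"
  shows "\<exists>K>0. \<forall>(T::real) (umax::real) (\<psi>::(real^2) \<times> (real^2) \<Rightarrow> real).
    1 < T \<longrightarrow> 0 < umax \<longrightarrow>
    Linf_norm (Omega L) (\<lambda>x. jacobian (poiseuille umax) (at x)) \<le> ennreal K \<longrightarrow>
    inflow_data L \<psi> \<longrightarrow>
    lateral_EGC L P (poiseuille umax) (T - 1) (Supp L \<psi>) \<longrightarrow>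
    (\<exists>U. is_neighborhood L U (poiseuille umax) (\<lambda>z. 0) \<and>
      (\<forall>(u, f)\<in>U. constructed_solution L P (poiseuille umax) \<psi> u f \<longrightarrow>
        (\<exists>N. is_neighborhood L N u f \<and>
          (\<forall>(u', f')\<in>N. stationary_solution L (poiseuille umax) \<psi> u' f' \<longrightarrow>
            (\<forall>x\<in>closure (Omega L). u' x = u x) \<and>
            (AE z in lebesgue_on (Omega L \<times> UNIV). f' z = f z)))))"
proof (intro exI[of _ "1/20"] conjI allI impI)
  fix T umax :: real and \<psi> :: "(real^2) \<times> (real^2) \<Rightarrow> real"
  assume T: "1 < T" and umax: "0 < umax"
    and K: "Linf_norm (Omega L) (\<lambda>x. jacobian (poiseuille umax) (at x)) \<le> ennreal (1/20)"
    and \<psi>: "inflow_data L \<psi>" and egc: "lateral_EGC L P (poiseuille umax) (T - 1) (Supp L \<psi>)"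
  have T1: "0 < T - 1" using T by simp
  obtain \<epsilon> where \<epsilon>: "0 < \<epsilon>"
    "\<And>u f u' f'. stationary_solution L (poiseuille umax) \<psi> u f \<Longrightarrow>
       stationary_solution L (poiseuille umax) \<psi> u' f' \<Longrightarrow>
       E_norm L (\<lambda>x. u x - poiseuille umax x) < ennreal \<epsilon> \<Longrightarrow> W1inf_norm (Omega L \<times> UNIV) f < ennreal \<epsilon> \<Longrightarrow>
       E_norm L (\<lambda>x. u' x - u x) < ennreal \<epsilon> \<Longrightarrow> W1inf_norm (Omega L \<times> UNIV) (\<lambda>z. f' z - f z) < ennreal \<epsilon> \<Longrightarrow>
       (\<forall>x\<in>closure (Omega L). u' x = u x) \<and> (AE z in lebesgue_on (Omega L \<times> UNIV). f' z = f z)"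
    using small_solutions_unique[OF assms umax poiseuille_umax_bound[OF assms(1) umax K] T1 \<psi> egc] by blast
  \<comment> \<open>The relative ball of radius \<epsilon>; one radius serves both around (u_p, 0)
    and around the constructed solution, since \<open>small_solutions_unique\<close> measures the
    second pair from the first.\<close>
  define B where "B u f = {(u', f'). u' \<in> E_space L \<and> f' \<in> W1inf (Omega L \<times> UNIV) \<and>
      E_norm L (\<lambda>x. u' x - u x) + W1inf_norm (Omega L \<times> UNIV) (\<lambda>z. f' z - f z) < ennreal \<epsilon>}"
    for u and f :: "(real^2) \<times> (real^2) \<Rightarrow> real"
  have nb: "is_neighborhood L (B u f) u f" for u f
    unfolding is_neighborhood_def B_def using \<epsilon>(1) by auto
  have less: "a < c" "b < c" if "a + b < c" for a b c :: ennreal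
    using that by (auto intro: le_less_trans[rotated])
  have BD: "E_norm L (\<lambda>x. u' x - u x) < ennreal \<epsilon>" "W1inf_norm (Omega L \<times> UNIV) (\<lambda>z. f' z - f z) < ennreal \<epsilon>"
    if "(u', f') \<in> B u f" for u u' f f'
  proof -
    have "E_norm L (\<lambda>x. u' x - u x) + W1inf_norm (Omega L \<times> UNIV) (\<lambda>z. f' z - f z) < ennreal \<epsilon>"
      using that by (simp add: B_def)
    then show "E_norm L (\<lambda>x. u' x - u x) < ennreal \<epsilon>" "W1inf_norm (Omega L \<times> UNIV) (\<lambda>z. f' z - f z) < ennreal \<epsilon>"
      by (rule less)+
  qed
  show "\<exists>U. is_neighborhood L U (poiseuille umax) (\<lambda>z. 0) \<and>
      (\<forall>(u, f)\<in>U. constructed_solution L P (poiseuille umax) \<psi> u f \<longrightarrow>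
        (\<exists>N. is_neighborhood L N u f \<and>
          (\<forall>(u', f')\<in>N. stationary_solution L (poiseuille umax) \<psi> u' f' \<longrightarrow>
            (\<forall>x\<in>closure (Omega L). u' x = u x) \<and>
            (AE z in lebesgue_on (Omega L \<times> UNIV). f' z = f z))))"
  proof (rule exI[of _ "B (poiseuille umax) (\<lambda>z. 0)"], intro conjI nb, clarify)
    fix u f assume uf: "(u, f) \<in> B (poiseuille umax) (\<lambda>z. 0)"
      and "constructed_solution L P (poiseuille umax) \<psi> u f"
    then have sol: "stationary_solution L (poiseuille umax) \<psi> u f" by (simp add: constructed_solution_def)
    have n: "E_norm L (\<lambda>x. u x - poiseuille umax x) < ennreal \<epsilon>" "W1inf_norm (Omega L \<times> UNIV) f < ennreal \<epsilon>"
      using BD[OF uf] by simp_all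
    show "\<exists>N. is_neighborhood L N u f \<and>
          (\<forall>(u', f')\<in>N. stationary_solution L (poiseuille umax) \<psi> u' f' \<longrightarrow>
            (\<forall>x\<in>closure (Omega L). u' x = u x) \<and>
            (AE z in lebesgue_on (Omega L \<times> UNIV). f' z = f z))"
    proof (rule exI[of _ "B u f"], intro conjI nb ballI, split prod.split, intro allI impI)
      fix p u' f' assume "p \<in> B u f" "p = (u', f')"
        and sol': "stationary_solution L (poiseuille umax) \<psi> u' f'"
      then have "(u', f') \<in> B u f" by simp
      from \<epsilon>(2)[OF sol sol' n BD[OF this]]
      show "(\<forall>x\<in>closure (Omega L). u' x = u x) \<and> (AE z in lebesgue_on (Omega L \<times> UNIV). f' z = f z)" .
    qed
  qed
qed simp

end
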